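(* Suppose that $h=h_n$ is chosen such that $h\to0$ and $\log n/(nh^{d+4})\to0$ as $n\to\infty$. Consider a mode $x_*$ of $f$. For any point $x_0$ in the basin of attraction of $x_*$, the following is true with probability tending to one as $n\to\infty$: when initialized at $x_0$, the Mean Shift method (with bandwidth $h$) produces a sequence that converges to $x_*$.
   Context: Density. $f$ is a probability density on $\mathbb{R}^d$ with respect to Lebesgue measure such that: (i) $f(x)\to0$ as $\|x\|\to\infty$; (ii) $f$ is twice differentiable everywhere, with bounded and uniformly continuous zeroth, first and second derivatives; (iii) the Hessian of $f$ is non-singular at every critical point of $f$. A mode is a local maximum of $f$. Gradient flow. For $x\in\mathbb{R}^d$, $\gamma_x$ is the solution of $\gamma_x(0)=x$, $\dot\gamma_x(t)=\nabla f(\gamma_x(t))$, $t\ge0$; $\gamma_x(t)$ converges to a critical point of $f$ as $t\to\infty$, denoted $\gamma_x(\infty)$. The basin of attraction of $x_*$ is $\{x:\gamma_x(\infty)=x_*\}$. Kernel. The kernel $K:\mathbb{R}^d\to\mathbb{R}$ (with $\int K=1$) is nonnegative, twice continuously differentiable, compactly supported, and of the form $K(x)=k(\|x\|^2)$, with shadow kernel $L(x)=\ell(\|x\|^2)$, where $\ell(u)=c\int_u^\infty k(v)\,dv$ and $c>0$ normalizes $L$. Mean Shift method. Based on an i.i.d. sample $x_1,\dots,x_n$ from $f$, it constructs the sequence $\hat x(0)=x_0$ and, for $k\ge0$, $$\hat x(k+1)=\frac{\sum_{j=1}^nK\big((x_j-\hat x(k))/h\big)x_j}{\sum_{j=1}^nK\big((x_j-\hat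 x(k))/h\big)}.$$
   Formalization: "Converges to x_*" is replaced by: for every ε>0, with probability tending to one the sequence is well defined and converges to a point within ε of x_*. For fixed n the limit is a critical point of a density estimate, so exact convergence to x_* has probability tending to zero. *)

theory Defs
  imports "HOL-Probability.Probability"
begin

definition grad :: "('a::real_inner \<Rightarrow> real) \<Rightarrow> 'a \<Rightarrow> 'a" where
  "grad f x = (THE D. GDERIV f x :> D)"

lemma grad_eqI:
  fixes f :: "'a::real_inner \<Rightarrow> real"
  assumes "GDERIV f x :> D"
  shows "grad f x = D"
  unfolding grad_def
proof (rule the_equality)
  show "GDERIV f x :> D" by fact
next
  fix E assume "GDERIV f x :> E"
  then have "(\<lambda>h. inner h E) = (\<lambda>h. inner h D)"
    using assms unfolding gderiv_def by (rule has_derivative_unique)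
  then have "inner (E - D) E = inner (E - D) D" by meson
  then show "E = D"
    by (metis inner_diff_right inner_eq_zero_iff right_minus_eq)
qed

definition hessian :: "(real^'d \<Rightarrow> real) \<Rightarrow> real^'d \<Rightarrow> real^'d^'d" where
  "hessian f x = jacobian (grad f) (at x)"

text \<open>Both differentiability conditions are needed for \<^term>\<open>grad f\<close> and
  \<^term>\<open>hessian f\<close> to be meaningful, since these are total functions.\<close>

definition twice_differentiable :: "(real^'d \<Rightarrow> real) \<Rightarrow> bool" where
  "twice_differentiable f \<longleftrightarrow>
     (\<forall>x. f differentiable (at x)) \<and> (\<forall>x. grad f differentiable (at x))"

definition bounded_unif_continuous :: "('a::metric_space \<Rightarrow> 'b::metric_space) \<Rightarrow> bool" where
  "bounded_unif_continuous f \<longleftrightarrow> bounded (range f) \<and> uniformly_continuous_on UNIV f"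

definition probability_density :: "(real^'d \<Rightarrow> real) \<Rightarrow> bool" where
  "probability_density f \<longleftrightarrow>
     (\<forall>x. 0 \<le> f x) \<and> integrable lborel f \<and> (LINT x|lborel. f x) = 1"

definition regular_density :: "(real^'d \<Rightarrow> real) \<Rightarrow> bool" where
  "regular_density f \<longleftrightarrow>
     probability_density f \<and>
     (f \<longlongrightarrow> 0) at_infinity \<and>
     twice_differentiable f \<and>
     bounded_unif_continuous f \<and>
     bounded_unif_continuous (grad f) \<and>
     bounded_unif_continuous (hessian f) \<and>
     (\<forall>x. grad f x = 0 \<longrightarrow> invertible (hessian f x))"

definition is_mode :: "(real^'d \<Rightarrow> real) \<Rightarrow> real^'d \<Rightarrow> bool" where
  "is_mode f x \<longleftrightarrow> (\<exists>r>0. \<forall>y\<in>ball x r. f y \<le> f x)"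

definition is_gradient_flow ::
    "(real^'d \<Rightarrow> real) \<Rightarrow> real^'d \<Rightarrow> (real \<Rightarrow> real^'d) \<Rightarrow> bool" where
  "is_gradient_flow f x \<gamma> \<longleftrightarrow>
     \<gamma> 0 = x \<and>
     (\<forall>t\<ge>0. (\<gamma> has_vector_derivative grad f (\<gamma> t)) (at t within {0..}))"

text \<open>For a density with bounded second derivatives the gradient is Lipschitz, so the
  gradient flow exists and is unique on \<open>{0..}\<close>; the existential below therefore just names
  the flow line from \<open>x\<close>.\<close>

definition basin_of_attraction :: "(real^'d \<Rightarrow> real) \<Rightarrow> real^'d \<Rightarrow> (real^'d) set" where
  "basin_of_attraction f xs = {x. \<exists>\<gamma>. is_gradient_flow f x \<gamma> \<and> (\<gamma> \<longlongrightarrow> xs) at_top}"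

text \<open>The values of the profile \<open>k\<close> at negative arguments are irrelevant.\<close>

definition is_kernel :: "(real^'d \<Rightarrow> real) \<Rightarrow> (real \<Rightarrow> real) \<Rightarrow> bool" where
  "is_kernel K k \<longleftrightarrow>
     (\<forall>x. 0 \<le> K x) \<and>
     integrable lborel K \<and> (LINT x|lborel. K x) = 1 \<and>
     twice_differentiable K \<and> continuous_on UNIV (hessian K) \<and>
     compact (closure {x. K x \<noteq> 0}) \<and>
     (\<forall>x. K x = k ((norm x)\<^sup>2))"

definition is_shadow_kernel ::
    "(real \<Rightarrow> real) \<Rightarrow> real \<Rightarrow> (real^'d \<Rightarrow> real) \<Rightarrow> bool" where
  "is_shadow_kernel k c L \<longleftrightarrow>
     0 < c \<and>
     (\<forall>x. L x = c * (LINT v:{(norm x)\<^sup>2..}|lborel. k v)) \<and>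
     integrable lborel L \<and> (LINT x|lborel. L x) = 1"

definition kernel_weight_sum ::
    "(real^'d \<Rightarrow> real) \<Rightarrow> real \<Rightarrow> nat \<Rightarrow> (nat \<Rightarrow> real^'d) \<Rightarrow> real^'d \<Rightarrow> real" where
  "kernel_weight_sum K h n X y = (\<Sum>j=1..n. K ((X j - y) /\<^sub>R h))"

primrec mean_shift ::
    "(real^'d \<Rightarrow> real) \<Rightarrow> real \<Rightarrow> nat \<Rightarrow> (nat \<Rightarrow> real^'d) \<Rightarrow> real^'d \<Rightarrow> nat \<Rightarrow> real^'d" where
  "mean_shift K h n X x0 0 = x0"
| "mean_shift K h n X x0 (Suc k) =
     (let y = mean_shift K h n X x0 k
      in (\<Sum>j=1..n. K ((X j - y) /\<^sub>R h) *\<^sub>R X j) /\<^sub>R kernel_weight_sum K h n X y)"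

text \<open>No update of the iteration divides by zero (as a total function,
  \<^const>\<open>mean_shift\<close> would jump to the origin there).\<close>

definition mean_shift_defined ::
    "(real^'d \<Rightarrow> real) \<Rightarrow> real \<Rightarrow> nat \<Rightarrow> (nat \<Rightarrow> real^'d) \<Rightarrow> real^'d \<Rightarrow> bool" where
  "mean_shift_defined K h n X x0 \<longleftrightarrow>
     (\<forall>k. kernel_weight_sum K h n X (mean_shift K h n X x0 k) \<noteq> 0)"

text \<open>For fixed \<open>n\<close> the limit of the iteration is a critical point of a kernel density
  estimate, which almost surely differs from the mode \<open>xs\<close> of the density itself. ``With
  probability tending to one the sequence converges to \<open>xs\<close>'' is therefore made precise as
  follows: the event below, that the iterates converge to a point within \<open>\<epsilon>\<close> of \<open>xs\<close>, has
  probability tending to one for every \<open>\<epsilon> > 0\<close>.\<close>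

definition mean_shift_converges_near ::
    "(real^'d \<Rightarrow> real) \<Rightarrow> real \<Rightarrow> nat \<Rightarrow> (nat \<Rightarrow> real^'d) \<Rightarrow> real^'d \<Rightarrow> real^'d \<Rightarrow> real \<Rightarrow> bool" where
  "mean_shift_converges_near K h n X x0 xs \<epsilon> \<longleftrightarrow>
     mean_shift_defined K h n X x0 \<and>
     (\<exists>y. mean_shift K h n X x0 \<longlonglongrightarrow> y \<and> dist y xs < \<epsilon>)"

end

theory Submission
  imports Defs
begin

text \<open>Why mean shift finds the mode.  Let \<open>p\<close> be the kernel density estimate and let \<open>G
x\<close> be the average of \<open>K ((X\<^sub>j - x) / h) (X\<^sub>j - x)\<close>, divided by \<open>h
^ (d + 2)\<close>.  One iteration moves \<open>x\<close> by the weighted mean of \<open>X\<^sub>j -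
x\<close>, which is \<open>(h\<^sup>2 / p x) G x\<close> (\<open>mean_shift_step\<close>).  Up to a
factor \<open>\<sigma>\<close>, the second moment of the kernel in any direction, \<open>G\<close>
estimates \<open>grad f\<close>.  So mean shift is an Euler scheme for the gradient flow of
\<open>f\<close>, with a small step that depends on the position and with an error in the field.

Such a scheme reaches the mode for two separate reasons.  Away from the mode it suffices that \<open>G /
\<sigma>\<close> is uniformly close to \<open>grad f\<close>: by a discrete Gronwall inequality the
iterates follow the flow line until it is close to the mode
(\<open>variable_step_euler_tracks_flow\<close>).  Close to the mode, uniform closeness would confine
the iterates but not make them converge.  There one uses that \<open>G / \<sigma>\<close> is strongly
monotone, so that it has a unique zero near the mode and every step contracts towards it
(\<open>variable_step_ascent_converges\<close>).  Strong monotonicity is a statement about the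
derivative of \<open>G\<close>, and controlling that derivative is what the condition \<open>n h ^ (d +
4) / ln n \<rightarrow> \<infinity>\<close> is for. \<open>perturbed_ascent_reaches_mode\<close> joins
the two phases.

The expectation of \<open>G\<close> is the smoothed gradient \<open>(1 / h) \<integral> K u f (x + h u)
u du\<close>.  Its bias is of order \<open>h\<close>.  Its increments contain second differences of
\<open>f\<close>, which are values \<open>a \<bullet> H b\<close> of the Hessian
(\<open>second_difference\<close>); hence near the mode it inherits strong monotonicity from the
Hessian, which is symmetric, negative semidefinite and nonsingular there, and so negative definite.

The random part is the deviation of averages of \<open>\<phi> ((X\<^sub>j - x) / h)\<close> from their
mean, where \<open>\<phi>\<close> is \<open>K\<close>, \<open>K w * w $ i\<close> or a partial
derivative of the latter.  The terms are bounded with variance of order \<open>h ^ d\<close>, so the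
Chernoff bound shows that a deviation of order \<open>h ^ (d + 2)\<close> at a given point has
probability at most \<open>2 exp (- \<kappa> n h ^ (d + 4))\<close>.  This beats every power of
\<open>n\<close>, in particular the number of points of a grid so fine that, by Lipschitz continuity, it
represents a whole ball (\<open>empirical_deviation_uniform\<close>).  On samples with small deviations
the convergence is deterministic (\<open>mean_shift_converges_on_good_samples\<close>).\<close>

section \<open>First and second differences\<close>

text \<open>On a Euclidean space every derivative of a real function is represented by an inner product,
so that differentiability alone gives \<^const>\<open>grad\<close> its intended meaning.\<close>

lemma GDERIV_grad:
  fixes f :: "'a::euclidean_space \<Rightarrow> real"
  assumes "f differentiable (at x)"
  shows "GDERIV f x :> grad f x"
proof -
  obtain D where D: "(f has_derivative D) (at x)"
    using assms unfolding differentiable_def by blast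
  have "linear D" using D by (rule has_derivative_linear)
  have "D = (\<lambda>v. v \<bullet> adjoint D 1)"
    using adjoint_works[OF \<open>linear D\<close>, of _ 1] by auto
  then have "GDERIV f x :> adjoint D 1" using D unfolding gderiv_def by simp
  then show ?thesis using grad_eqI by metis
qed

lemma has_derivative_grad:
  fixes f :: "real^'d \<Rightarrow> real"
  assumes "twice_differentiable f"
  shows "(grad f has_derivative (\<lambda>v. hessian f x *v v)) (at x)"
  using assms unfolding twice_differentiable_def hessian_def
  by (simp add: jacobian_works)

lemma has_derivative_twice_differentiable:
  fixes f :: "real^'d \<Rightarrow> real"
  assumes "twice_differentiable f"
  shows "(f has_derivative (\<lambda>v. v \<bullet> grad f x)) (at x)"
  using GDERIV_grad assms unfolding twice_differentiable_def gderiv_def by blast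

text \<open>Used outside the support of the kernel, and around a zero of the density that is a local
maximum.\<close>

lemma derivatives_zero_on_open:
  fixes f :: "real^'d \<Rightarrow> real"
  assumes td: "twice_differentiable f" and U: "open U" "\<And>y. y \<in> U \<Longrightarrow> f y = 0" and x: "x \<in> U"
  shows "grad f x = 0" "hessian f x = 0"
proof -
  have gz: "grad f y = 0" if "y \<in> U" for y
  proof (rule grad_eqI)
    have "(f has_derivative (\<lambda>h. 0)) (at y)"
      by (rule has_derivative_transform_within_open[OF has_derivative_const[of 0] U(1)]) (use that U(2) in auto)
    then show "GDERIV f y :> 0" by (simp add: gderiv_def)
  qed
  show "grad f x = 0" using gz x by blast
  have "(grad f has_derivative (\<lambda>h. 0)) (at x)"
    by (rule has_derivative_transform_within_open[OF has_derivative_const[of 0] U(1)]) (use x gz in auto)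
  then have "(\<lambda>v. hessian f x *v v) = (\<lambda>h. 0)"
    by (rule has_derivative_unique[OF has_derivative_grad[OF td]])
  then have "hessian f x *v v = 0 *v v" for v by (simp add: fun_eq_iff)
  then show "hessian f x = 0" by (simp add: matrix_eq)
qed

lemma twice_differentiable_continuous:
  fixes f :: "real^'d \<Rightarrow> real"
  assumes "twice_differentiable f"
  shows "continuous_on UNIV f"
  using has_derivative_continuous[OF has_derivative_twice_differentiable[OF assms]]
  by (auto simp: continuous_on_eq_continuous_at)

lemma mean_value_along_segment:
  fixes f :: "'a::real_normed_vector \<Rightarrow> real"
  assumes f': "\<And>x. (f has_derivative f' x) (at x)"
  shows "\<exists>s\<in>{0..1}. f (x + v) - f x = f' (x + s *\<^sub>R v) v"
proof -
  have "\<exists>s\<in>{0..1}. f (x + 1 *\<^sub>R v) - f (x + 0 *\<^sub>R v) = f' (x + s *\<^sub>R v) ((1 - 0) *\<^sub>R v)"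
    by (rule mvt_very_simple[where f = "\<lambda>s. f (x + s *\<^sub>R v)"
          and f' = "\<lambda>s t. f' (x + s *\<^sub>R v) (t *\<^sub>R v)"])
       (auto intro!: derivative_eq_intros has_derivative_compose[OF _ f'])
  then show ?thesis by simp
qed

text \<open>Apply the mean value theorem twice: along \<open>a\<close> to the increment \<open>f (w + b)
- f w\<close>, then along \<open>b\<close> to \<open>a \<bullet> grad f\<close>.  The identity serves
three purposes: symmetry of the Hessian, its sign at a mode, and the increments of the smoothed
gradient.\<close>

lemma second_difference:
  fixes f :: "real^'d \<Rightarrow> real"
  assumes f: "twice_differentiable f"
  shows "\<exists>\<xi>. dist \<xi> z \<le> norm a + norm b \<and>
           f (z + a + b) - f (z + a) - f (z + b) + f z = a \<bullet> (hessian f \<xi> *v b)"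
proof -
  have "\<And>x. ((\<lambda>w. f (w + b) - f w) has_derivative
      (\<lambda>v. v \<bullet> (grad f (x + b) - grad f x))) (at x)"
    unfolding inner_diff_right
    by (auto intro!: derivative_eq_intros has_derivative_compose[where f = "\<lambda>w. w + b"]
        has_derivative_twice_differentiable[OF f])
  from mean_value_along_segment[of "\<lambda>w. f (w + b) - f w", OF this, of z a]
  obtain s where s: "s \<in> {0..1}" and
    1: "(f (z + a + b) - f (z + a)) - (f (z + b) - f z)
        = a \<bullet> (grad f (z + s *\<^sub>R a + b) - grad f (z + s *\<^sub>R a))" by blast
  have "\<And>x. ((\<lambda>w. a \<bullet> grad f w) has_derivative (\<lambda>v. a \<bullet> (hessian f x *v v))) (at x)"
    by (auto intro!: derivative_eq_intros has_derivative_grad[OF f])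
  from mean_value_along_segment[of "\<lambda>w. a \<bullet> grad f w", OF this, of "z + s *\<^sub>R a" b]
  obtain t where t: "t \<in> {0..1}" and
    2: "a \<bullet> grad f (z + s *\<^sub>R a + b) - a \<bullet> grad f (z + s *\<^sub>R a)
        = a \<bullet> (hessian f (z + s *\<^sub>R a + t *\<^sub>R b) *v b)" by blast
  have "norm (s *\<^sub>R a + t *\<^sub>R b) \<le> norm (s *\<^sub>R a) + norm (t *\<^sub>R b)" by (rule norm_triangle_ineq)
  also have "\<dots> \<le> norm a + norm b"
    using s t by (auto intro!: add_mono mult_left_le_one_le)
  finally show ?thesis using 1 2
    by (intro exI[of _ "z + s *\<^sub>R a + t *\<^sub>R b"]) (auto simp: dist_norm inner_diff_right)
qed

lemma norm_matrix_vector_mult_le: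
  fixes A :: "real^'n^'m"
  shows "norm (A *v v) \<le> norm A * norm v"
proof -
  have "norm (A *v v) = L2_set (\<lambda>i. A $ i \<bullet> v) UNIV"
    by (simp add: norm_vec_def L2_set_def matrix_vector_mul_component)
  also have "\<dots> \<le> L2_set (\<lambda>i. norm (A $ i) * norm v) UNIV"
  proof -
    have "L2_set (\<lambda>i. A $ i \<bullet> v) UNIV = L2_set (\<lambda>i. \<bar>A $ i \<bullet> v\<bar>) UNIV"
      by (simp add: L2_set_def)
    also have "\<dots> \<le> L2_set (\<lambda>i. norm (A $ i) * norm v) UNIV"
      by (rule L2_set_mono) (auto simp: Cauchy_Schwarz_ineq2)
    finally show ?thesis .
  qed
  also have "\<dots> = norm A * norm v"
    by (simp add: norm_vec_def L2_set_left_distrib)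
  finally show ?thesis .
qed

lemma second_difference_quotient_tendsto:
  fixes f :: "real^'d \<Rightarrow> real"
  assumes f: "twice_differentiable f" and cont: "continuous_on UNIV (hessian f)"
  shows "((\<lambda>t. (f (x + t *\<^sub>R a + t *\<^sub>R b) - f (x + t *\<^sub>R a) - f (x + t *\<^sub>R b) + f x) / t\<^sup>2)
           \<longlongrightarrow> a \<bullet> (hessian f x *v b)) (at_right 0)"
proof -
  define q where "q t = (f (x + t *\<^sub>R a + t *\<^sub>R b) - f (x + t *\<^sub>R a) - f (x + t *\<^sub>R b) + f x) / t\<^sup>2" for t
  have "\<exists>\<xi>. \<forall>t>0. dist (\<xi> t) x \<le> t * (norm a + norm b) \<and> q t = a \<bullet> (hessian f (\<xi> t) *v b)"
  proof -
    have "\<exists>\<xi>. dist \<xi> x \<le> t * (norm a + norm b) \<and> q t = a \<bullet> (hessian f \<xi> *v b)" if "t > 0" for t :: real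
    proof -
      from second_difference[OF f, of x "t *\<^sub>R a" "t *\<^sub>R b"] obtain \<xi> where
        "dist \<xi> x \<le> norm (t *\<^sub>R a) + norm (t *\<^sub>R b)"
        "f (x + t *\<^sub>R a + t *\<^sub>R b) - f (x + t *\<^sub>R a) - f (x + t *\<^sub>R b) + f x = (t *\<^sub>R a) \<bullet> (hessian f \<xi> *v (t *\<^sub>R b))"
        by blast
      then show ?thesis using that
        by (intro exI[of _ \<xi>]) (simp add: q_def matrix_vector_mult_scaleR power2_eq_square algebra_simps)
    qed
    then show ?thesis by metis
  qed
  then obtain \<xi> where \<xi>: "\<And>t. t > 0 \<Longrightarrow> dist (\<xi> t) x \<le> t * (norm a + norm b)"
    "\<And>t. t > 0 \<Longrightarrow> q t = a \<bullet> (hessian f (\<xi> t) *v b)" by blast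
  have "(\<xi> \<longlongrightarrow> x) (at_right 0)"
  proof (rule tendsto_dist_iff[THEN iffD2], rule real_tendsto_sandwich[where f = "\<lambda>_. 0"])
    show "((\<lambda>t. t * (norm a + norm b)) \<longlongrightarrow> 0) (at_right 0)"
      by (auto intro!: tendsto_eq_intros)
  qed (use \<xi>(1) in \<open>auto simp: eventually_at_right_field intro!: exI[of _ 1]\<close>)
  moreover have "isCont (hessian f) x" using cont by (simp add: continuous_on_eq_continuous_at)
  ultimately have H: "((\<lambda>t. hessian f (\<xi> t)) \<longlongrightarrow> hessian f x) (at_right 0)"
    by (rule isCont_tendsto_compose[rotated])
  have "bounded_linear (\<lambda>A. a \<bullet> (A *v b) :: real)"
  proof (rule bounded_linear_intro[where K = "norm a * norm b"])
    fix A :: "real^'d^'d"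
    have "\<bar>a \<bullet> (A *v b)\<bar> \<le> norm a * norm (A *v b)" by (rule Cauchy_Schwarz_ineq2)
    also have "\<dots> \<le> norm a * (norm A * norm b)"
      by (intro mult_left_mono norm_matrix_vector_mult_le) auto
    finally show "norm (a \<bullet> (A *v b)) \<le> norm A * (norm a * norm b)" by (simp add: algebra_simps)
  qed (simp_all add: matrix_vector_mult_add_rdistrib inner_add_right scaleR_matrix_vector_assoc[symmetric])
  from bounded_linear.tendsto[OF this H]
  have "((\<lambda>t. a \<bullet> (hessian f (\<xi> t) *v b)) \<longlongrightarrow> a \<bullet> (hessian f x *v b)) (at_right 0)" .
  moreover have "\<forall>\<^sub>F t in at_right 0. a \<bullet> (hessian f (\<xi> t) *v b) = q t"
    using \<xi>(2) by (auto simp: eventually_at_right_field intro!: exI[of _ 1])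
  ultimately have "(q \<longlongrightarrow> a \<bullet> (hessian f x *v b)) (at_right 0)"
    by (rule Lim_transform_eventually)
  then show ?thesis unfolding q_def .
qed

text \<open>The second difference is symmetric in \<open>a\<close> and \<open>b\<close>, and so is the
limit of its quotient.\<close>

lemma hessian_symmetric:
  fixes f :: "real^'d \<Rightarrow> real"
  assumes f: "twice_differentiable f" and cont: "continuous_on UNIV (hessian f)"
  shows "a \<bullet> (hessian f x *v b) = b \<bullet> (hessian f x *v a)"
proof (rule tendsto_unique[OF _ second_difference_quotient_tendsto[OF f cont]])
  show "((\<lambda>t. (f (x + t *\<^sub>R a + t *\<^sub>R b) - f (x + t *\<^sub>R a) - f (x + t *\<^sub>R b) + f x) / t\<^sup>2)
           \<longlongrightarrow> b \<bullet> (hessian f x *v a)) (at_right 0)"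
    using second_difference_quotient_tendsto[OF f cont, of x b a] by (simp add: algebra_simps)
qed simp

lemma mode_grad_zero:
  fixes f :: "real^'d \<Rightarrow> real"
  assumes f: "twice_differentiable f" and "is_mode f x"
  shows "grad f x = 0"
proof -
  obtain r where r: "r > 0" "\<forall>y\<in>ball x r. f y \<le> f x" using assms(2) unfolding is_mode_def by blast
  have "(\<lambda>v. v \<bullet> grad f x) = (\<lambda>v. 0)"
    using differential_zero_maxmin[OF _ _ has_derivative_twice_differentiable[OF f], of x "ball x r"] r by auto
  then show ?thesis by (metis inner_eq_zero_iff)
qed

text \<open>The second difference with \<open>a = v\<close> and \<open>b = - v\<close> compares \<open>f
x\<close> with the smaller values of \<open>f\<close> on both sides.\<close>

lemma mode_hessian_nonpos:
  fixes f :: "real^'d \<Rightarrow> real"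
  assumes f: "twice_differentiable f" and cont: "continuous_on UNIV (hessian f)" and mode: "is_mode f x"
  shows "v \<bullet> (hessian f x *v v) \<le> 0"
proof -
  obtain r where r: "r > 0" "\<And>y. y\<in>ball x r \<Longrightarrow> f y \<le> f x" using mode unfolding is_mode_def by blast
  define q where "q t = (f (x + t *\<^sub>R v + t *\<^sub>R (-v)) - f (x + t *\<^sub>R v) - f (x + t *\<^sub>R (-v)) + f x) / t\<^sup>2" for t
  have "(q \<longlongrightarrow> v \<bullet> (hessian f x *v (- v))) (at_right 0)"
    unfolding q_def by (rule second_difference_quotient_tendsto[OF f cont])
  moreover have "\<forall>\<^sub>F t in at_right 0. 0 \<le> q t"
  proof -
    have "\<forall>\<^sub>F t in at_right (0::real). 0 < t \<and> t < r / (norm v + 1)"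
      using r(1) by (auto simp: eventually_at_right_field intro!: exI[of _ "r / (norm v + 1)"] divide_pos_pos add_nonneg_pos)
    then show ?thesis
    proof eventually_elim
      case (elim t)
      have "t * norm v \<le> t * (norm v + 1)" using elim by simp
      also have "\<dots> < r" using elim by (simp add: pos_less_divide_eq add_nonneg_pos)
      finally have "f (x + t *\<^sub>R v) \<le> f x" "f (x + t *\<^sub>R (-v)) \<le> f x"
        using elim by (auto intro!: r(2) simp: dist_norm)
      then show ?case by (auto simp: q_def)
    qed
  qed
  ultimately have "0 \<le> v \<bullet> (hessian f x *v (- v))"
    by (intro tendsto_lowerbound[of q _ "at_right 0"]) auto
  moreover have "hessian f x *v (- v) = - (hessian f x *v v)"
    using matrix_vector_mult_scaleR[of "hessian f x" "-1" v] by simp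
  ultimately show ?thesis by simp
qed

text \<open>If \<open>v \<bullet> A v = 0\<close> with \<open>w = A v \<noteq> 0\<close>, then,
\<open>A\<close> being symmetric, moving from \<open>v\<close> a little in direction \<open>w\<close>
makes the quadratic form positive.  So the form is negative off zero, and compactness of the unit sphere
gives the uniform constant.\<close>

lemma negative_semidefinite_invertible_imp_definite:
  fixes A :: "real^'d^'d"
  assumes sym: "\<And>a b. a \<bullet> (A *v b) = b \<bullet> (A *v a)"
    and nonpos: "\<And>v. v \<bullet> (A *v v) \<le> 0" and inv: "invertible A"
  shows "\<exists>m>0. \<forall>v. v \<bullet> (A *v v) \<le> - m * (norm v)\<^sup>2"
proof -
  have neg: "v \<bullet> (A *v v) < 0" if "v \<noteq> 0" for v
  proof (rule ccontr)
    assume "\<not> v \<bullet> (A *v v) < 0"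
    then have v0: "v \<bullet> (A *v v) = 0" using nonpos[of v] by simp
    define w where "w = A *v v"
    define c where "c = w \<bullet> (A *v w)"
    have "w \<noteq> 0"
      unfolding w_def using inv \<open>v \<noteq> 0\<close>
      by (metis invertible_def matrix_vector_mul_assoc matrix_vector_mul_lid matrix_vector_mult_0_right)
    \<comment> \<open>small enough for the term linear in \<open>s\<close> to dominate the quadratic one\<close>
    define s where "s = (norm w)\<^sup>2 / (\<bar>c\<bar> + 1)"
    have s: "s > 0" using \<open>w \<noteq> 0\<close> by (simp add: s_def)
    have "(v + s *\<^sub>R w) \<bullet> (A *v (v + s *\<^sub>R w)) = s * (2 * (norm w)\<^sup>2 + s * c)"
      using v0 sym[of v w]
      by (simp add: matrix_vector_right_distrib matrix_vector_mult_scaleR inner_add_left inner_add_right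
          w_def[symmetric] c_def[symmetric] power2_norm_eq_inner algebra_simps)
    then have "2 * (norm w)\<^sup>2 + s * c \<le> 0"
      using nonpos[of "v + s *\<^sub>R w"] s by (simp add: mult_le_0_iff)
    moreover have "\<bar>s * c\<bar> \<le> (norm w)\<^sup>2"
    proof -
      have "\<bar>s * c\<bar> = s * \<bar>c\<bar>" using s by (simp add: abs_mult)
      also have "\<dots> \<le> s * (\<bar>c\<bar> + 1)" using s by simp
      also have "\<dots> = (norm w)\<^sup>2" by (simp add: s_def)
      finally show ?thesis .
    qed
    moreover have "(norm w)\<^sup>2 > 0" using \<open>w \<noteq> 0\<close> by simp
    ultimately show False by linarith
  qed
  have "\<exists>u\<in>sphere 0 1. \<forall>v\<in>sphere 0 1. v \<bullet> (A *v v) \<le> u \<bullet> (A *v u)"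
    by (intro continuous_attains_sup continuous_intros compact_sphere)
       (auto intro!: exI[of _ "axis undefined 1"] simp: linear_continuous_on matrix_vector_mul_bounded_linear)
  then obtain u where u: "norm u = 1" "\<And>v. norm v = 1 \<Longrightarrow> v \<bullet> (A *v v) \<le> u \<bullet> (A *v u)" by auto
  have "v \<bullet> (A *v v) \<le> - (- (u \<bullet> (A *v u))) * (norm v)\<^sup>2" for v
  proof (cases "v = 0")
    case False
    define e where "e = v /\<^sub>R norm v"
    have v: "v = norm v *\<^sub>R e" using False by (simp add: e_def)
    have "norm e = 1" using False by (simp add: e_def)
    have "v \<bullet> (A *v v) = (norm v)\<^sup>2 * (e \<bullet> (A *v e))"
      by (subst (1 2) v) (simp add: matrix_vector_mult_scaleR power2_eq_square)
    also have "\<dots> \<le> (norm v)\<^sup>2 * (u \<bullet> (A *v u))"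
      using u(2)[OF \<open>norm e = 1\<close>] by (intro mult_left_mono) auto
    finally show ?thesis by (simp add: algebra_simps)
  qed simp
  moreover have "u \<noteq> 0" using u(1) by auto
  then have "- (u \<bullet> (A *v u)) > 0" using neg[of u] by simp
  ultimately show ?thesis by blast
qed

lemma regular_density_uniform_bounds:
  fixes f :: "real^'d \<Rightarrow> real"
  assumes f: "regular_density f"
  obtains B \<Lambda> where "B > 0" "\<Lambda> > 0" "\<And>x. f x \<le> B" "\<And>x. norm (grad f x) \<le> B"
    "\<And>x v. norm (hessian f x *v v) \<le> \<Lambda> * norm v"
proof -
  obtain B1 where B1: "\<And>x. norm (f x) \<le> B1"
    using f unfolding regular_density_def bounded_unif_continuous_def bounded_iff by auto
  obtain B2 where B2: "\<And>x. norm (grad f x) \<le> B2"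
    using f unfolding regular_density_def bounded_unif_continuous_def bounded_iff by auto
  obtain B3 where B3: "\<And>x. norm (hessian f x) \<le> B3"
    using f unfolding regular_density_def bounded_unif_continuous_def bounded_iff by auto
  show ?thesis
  proof (rule that[of "max 1 (max B1 B2)" "max 1 B3"])
    fix x show "f x \<le> max 1 (max B1 B2)" using B1[of x] by auto
    show "norm (grad f x) \<le> max 1 (max B1 B2)" using B2[of x] by auto
    fix v
    have "norm (hessian f x *v v) \<le> norm (hessian f x) * norm v" by (rule norm_matrix_vector_mult_le)
    also have "\<dots> \<le> max 1 B3 * norm v" using B3[of x] by (intro mult_right_mono) auto
    finally show "norm (hessian f x *v v) \<le> max 1 B3 * norm v" .
  qed auto
qed

lemma grad_lipschitz:
  fixes f :: "real^'d \<Rightarrow> real"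
  assumes f: "twice_differentiable f" and \<Lambda>: "\<And>x v. norm (hessian f x *v v) \<le> \<Lambda> * norm v"
  shows "norm (grad f x - grad f y) \<le> \<Lambda> * norm (x - y)"
  by (rule differentiable_bound[of UNIV _ "\<lambda>x v. hessian f x *v v"])
     (auto intro!: has_derivative_at_withinI has_derivative_grad f onorm_bound \<Lambda>
       simp: order_trans[OF norm_ge_zero \<Lambda>[of 0 "axis undefined 1"], simplified])

lemma lipschitz_of_bounded_grad:
  fixes f :: "real^'d \<Rightarrow> real"
  assumes f: "twice_differentiable f" and B: "\<And>x. norm (grad f x) \<le> B"
  shows "\<bar>f x - f y\<bar> \<le> B * norm (x - y)"
proof -
  have "\<bar>v \<bullet> grad f z\<bar> \<le> B * norm v" for v z
    using Cauchy_Schwarz_ineq2[of v "grad f z"] mult_right_mono[OF B[of z], of "norm v"]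
    by (simp add: mult.commute)
  then have "norm (f x - f y) \<le> B * norm (x - y)"
    by (intro differentiable_bound[of UNIV _ "\<lambda>x v. v \<bullet> grad f x"])
       (auto intro!: has_derivative_at_withinI has_derivative_twice_differentiable f onorm_bound
         order_trans[OF norm_ge_zero B])
  then show ?thesis by simp
qed

lemma first_order_taylor_bound:
  fixes f :: "real^'d \<Rightarrow> real"
  assumes f: "twice_differentiable f" and \<Lambda>: "\<And>x y. norm (grad f x - grad f y) \<le> \<Lambda> * norm (x - y)"
  shows "\<bar>f (x + v) - f x - v \<bullet> grad f x\<bar> \<le> \<Lambda> * (norm v)\<^sup>2"
proof -
  have "0 \<le> \<Lambda> * norm (axis undefined 1 - 0 :: real^'d)" by (rule order_trans[OF norm_ge_zero \<Lambda>])
  then have "\<Lambda> \<ge> 0" by simp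
  from mean_value_along_segment[of f, OF has_derivative_twice_differentiable[OF f], of x v]
  obtain s where s: "s \<in> {0..1}" "f (x + v) - f x = v \<bullet> grad f (x + s *\<^sub>R v)" by blast
  have "\<bar>f (x + v) - f x - v \<bullet> grad f x\<bar> = \<bar>v \<bullet> (grad f (x + s *\<^sub>R v) - grad f x)\<bar>"
    by (simp add: s(2) inner_diff_right)
  also have "\<dots> \<le> norm v * norm (grad f (x + s *\<^sub>R v) - grad f x)" by (rule Cauchy_Schwarz_ineq2)
  also have "\<dots> \<le> norm v * (\<Lambda> * norm (s *\<^sub>R v))"
    using \<Lambda>[of "x + s *\<^sub>R v" x] by (intro mult_left_mono) auto
  also have "\<dots> \<le> norm v * (\<Lambda> * norm v)"
    using s(1) \<open>\<Lambda> \<ge> 0\<close> by (intro mult_left_mono) (auto intro: mult_left_le_one_le)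
  finally show ?thesis by (simp add: power2_eq_square algebra_simps)
qed

lemma mode_properties:
  fixes f :: "real^'d \<Rightarrow> real"
  assumes f: "regular_density f" and mode: "is_mode f xs"
  shows "grad f xs = 0" and "\<exists>m>0. \<forall>v. v \<bullet> (hessian f xs *v v) \<le> - m * (norm v)\<^sup>2"
proof -
  have td: "twice_differentiable f" and cont: "continuous_on UNIV (hessian f)"
    using f unfolding regular_density_def bounded_unif_continuous_def
    by (auto intro: uniformly_continuous_imp_continuous)
  show "grad f xs = 0" by (rule mode_grad_zero[OF td mode])
  then have "invertible (hessian f xs)" using f unfolding regular_density_def by auto
  then show "\<exists>m>0. \<forall>v. v \<bullet> (hessian f xs *v v) \<le> - m * (norm v)\<^sup>2"
    by (intro negative_semidefinite_invertible_imp_definite hessian_symmetric[OF td cont]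
        mode_hessian_nonpos[OF td cont mode])
qed

text \<open>At a zero of the nonnegative function \<open>f\<close> that is also a local maximum,
\<open>f\<close> would vanish on a neighbourhood, and its Hessian there would be zero.\<close>

lemma mode_density_pos:
  fixes f :: "real^'d \<Rightarrow> real"
  assumes f: "regular_density f" and mode: "is_mode f xs"
  shows "f xs > 0"
proof (rule ccontr)
  assume "\<not> f xs > 0"
  have td: "twice_differentiable f" and nonneg: "\<And>x. 0 \<le> f x"
    using f unfolding regular_density_def probability_density_def by auto
  from \<open>\<not> f xs > 0\<close> have "f xs = 0" using nonneg[of xs] by simp
  obtain r where r: "r > 0" "\<And>y. y\<in>ball xs r \<Longrightarrow> f y \<le> f xs" using mode unfolding is_mode_def by blast
  have "f y = 0" if "y \<in> ball xs r" for y using r(2)[OF that] nonneg[of y] \<open>f xs = 0\<close> by simp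
  then have "hessian f xs = 0" using r(1) by (intro derivatives_zero_on_open(2)[OF td, of "ball xs r"]) auto
  moreover obtain m where m: "m > 0" "\<And>v. v \<bullet> (hessian f xs *v v) \<le> - m * (norm v)\<^sup>2"
    using mode_properties(2)[OF f mode] by blast
  ultimately show False using m(2)[of "axis undefined 1"] by simp
qed

section \<open>Gradient flow, its Euler scheme, and contraction near a zero\<close>

lemma onorm_scaleR_le:
  fixes w :: "'a::real_normed_vector"
  assumes "norm w \<le> B"
  shows "onorm (\<lambda>h::real. h *\<^sub>R w) \<le> B"
proof (rule onorm_bound)
  show "0 \<le> B" using assms norm_ge_zero by (rule order_trans[rotated])
  fix h :: real
  have "norm (h *\<^sub>R w) = norm w * norm h" by (simp add: mult.commute)
  also have "\<dots> \<le> B * norm h" by (rule mult_right_mono[OF assms]) simp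
  finally show "norm (h *\<^sub>R w) \<le> B * norm h" .
qed

lemma gradient_flow_displacement:
  fixes f :: "real^'d \<Rightarrow> real"
  assumes flow: "is_gradient_flow f x0 \<gamma>"
    and B: "\<And>x. norm (grad f x) \<le> B" and st: "0 \<le> s" "s \<le> t"
  shows "norm (\<gamma> t - \<gamma> s) \<le> B * (t - s)"
proof -
  have "norm (\<gamma> t - \<gamma> s) \<le> B * norm (t - s)"
  proof (rule differentiable_bound[where f = \<gamma> and S = "{0..}" and f' = "\<lambda>t h. h *\<^sub>R grad f (\<gamma> t)"])
    fix u :: real assume "u \<in> {0..}"
    then show "(\<gamma> has_derivative (\<lambda>h. h *\<^sub>R grad f (\<gamma> u))) (at u within {0..})"
      using flow unfolding is_gradient_flow_def has_vector_derivative_def by auto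
    show "onorm (\<lambda>h. h *\<^sub>R grad f (\<gamma> u)) \<le> B"
      by (rule onorm_scaleR_le[OF B])
  qed (use st in auto)
  then show ?thesis using st by simp
qed

lemma gradient_flow_euler_error:
  fixes f :: "real^'d \<Rightarrow> real"
  assumes flow: "is_gradient_flow f x0 \<gamma>"
    and B: "\<And>x. norm (grad f x) \<le> B"
    and \<Lambda>: "\<And>x y. norm (grad f x - grad f y) \<le> \<Lambda> * norm (x - y)" "\<Lambda> \<ge> 0"
    and "0 \<le> t" "0 \<le> \<tau>"
  shows "norm (\<gamma> (t + \<tau>) - \<gamma> t - \<tau> *\<^sub>R grad f (\<gamma> t)) \<le> \<Lambda> * B * \<tau>\<^sup>2"
proof -
  have "norm ((\<gamma> (t + \<tau>) - (t + \<tau>) *\<^sub>R grad f (\<gamma> t)) - (\<gamma> t - t *\<^sub>R grad f (\<gamma> t))) \<le> (\<Lambda> * B * \<tau>) * norm ((t + \<tau>) - t)"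
  proof (rule differentiable_bound[where f = "\<lambda>s. \<gamma> s - s *\<^sub>R grad f (\<gamma> t)" and x = "t + \<tau>" and y = t and S = "{t..t+\<tau>}" and f' = "\<lambda>s h. h *\<^sub>R grad f (\<gamma> s) - h *\<^sub>R grad f (\<gamma> t)"])
    fix s assume s: "s \<in> {t..t + \<tau>}"
    have "(\<gamma> has_derivative (\<lambda>h. h *\<^sub>R grad f (\<gamma> s))) (at s within {t..t + \<tau>})"
      using flow s \<open>0 \<le> t\<close> unfolding is_gradient_flow_def has_vector_derivative_def
      by (auto intro: has_derivative_subset[where s = "{0..}"])
    then show "((\<lambda>s. \<gamma> s - s *\<^sub>R grad f (\<gamma> t)) has_derivative (\<lambda>h. h *\<^sub>R grad f (\<gamma> s) - h *\<^sub>R grad f (\<gamma> t)))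
        (at s within {t..t + \<tau>})"
      by (auto intro!: derivative_eq_intros)
    have "norm (grad f (\<gamma> s) - grad f (\<gamma> t)) \<le> \<Lambda> * norm (\<gamma> s - \<gamma> t)" by (rule \<Lambda>)
    also have "\<dots> \<le> \<Lambda> * (B * (s - t))"
      using s \<open>0 \<le> t\<close> \<Lambda>(2) by (intro mult_left_mono gradient_flow_displacement[OF flow B]) auto
    also have "\<dots> \<le> \<Lambda> * (B * \<tau>)"
    proof -
      have "0 \<le> B" using B[of 0] norm_ge_zero order_trans by blast
      then show ?thesis using s \<Lambda>(2) by (intro mult_left_mono) auto
    qed
    finally have "norm (grad f (\<gamma> s) - grad f (\<gamma> t)) \<le> \<Lambda> * B * \<tau>" by simp
    then show "onorm (\<lambda>h. h *\<^sub>R grad f (\<gamma> s) - h *\<^sub>R grad f (\<gamma> t)) \<le> \<Lambda> * B * \<tau>"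
      using onorm_scaleR_le[of "grad f (\<gamma> s) - grad f (\<gamma> t)"] by (simp add: scaleR_diff_right)
  qed (use \<open>0 \<le> \<tau>\<close> in auto)
  then show ?thesis using \<open>0 \<le> \<tau>\<close> by (simp add: algebra_simps power2_eq_square)
qed

text \<open>Along the flow the derivative of \<open>f\<close> is the squared norm of its
gradient.\<close>

lemma gradient_flow_ascends:
  fixes f :: "real^'d \<Rightarrow> real"
  assumes flow: "is_gradient_flow f x0 \<gamma>" and f: "twice_differentiable f"
    and "0 \<le> s" "s \<le> t"
  shows "f (\<gamma> s) \<le> f (\<gamma> t)"
proof (cases "s = t")
  case False
  have "\<exists>u\<in>{s<..<t}. f (\<gamma> t) - f (\<gamma> s) = (t - s) *\<^sub>R grad f (\<gamma> u) \<bullet> grad f (\<gamma> u)"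
  proof (rule mvt_simple[where f = "\<lambda>u. f (\<gamma> u)" and f' = "\<lambda>u h. h *\<^sub>R grad f (\<gamma> u) \<bullet> grad f (\<gamma> u)"])
    fix u assume u: "s \<le> u" "u \<le> t"
    have "(\<gamma> has_derivative (\<lambda>h. h *\<^sub>R grad f (\<gamma> u))) (at u within {s..t})"
      using flow u \<open>0 \<le> s\<close> unfolding is_gradient_flow_def has_vector_derivative_def
      by (auto intro: has_derivative_subset[where s = "{0..}"])
    from has_derivative_compose[OF this has_derivative_twice_differentiable[OF f]]
    show "((\<lambda>u. f (\<gamma> u)) has_derivative (\<lambda>h. h *\<^sub>R grad f (\<gamma> u) \<bullet> grad f (\<gamma> u))) (at u within {s..t})" .
  qed (use False assms in auto)
  then obtain u where "f (\<gamma> t) - f (\<gamma> s) = (t - s) * (norm (grad f (\<gamma> u)))\<^sup>2"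
    by (auto simp: power2_norm_eq_inner)
  moreover have "0 \<le> (t - s) * (norm (grad f (\<gamma> u)))\<^sup>2" using assms by simp
  ultimately show ?thesis by linarith
qed simp

text \<open>Uniqueness of the constant flow line, by Gronwall's argument: \<open>exp (- 2 \<Lambda> s)
|\<gamma> s - x0|\<^sup>2\<close> starts at zero and does not increase.\<close>

lemma gradient_flow_from_critical_point:
  fixes f :: "real^'d \<Rightarrow> real"
  assumes flow: "is_gradient_flow f x0 \<gamma>"
    and \<Lambda>: "\<And>x y. norm (grad f x - grad f y) \<le> \<Lambda> * norm (x - y)"
    and crit: "grad f x0 = 0" and "0 \<le> t"
  shows "\<gamma> t = x0"
proof (cases "t = 0")
  case False
  define u where "u s = exp (- (2 * \<Lambda> * s)) * ((\<gamma> s - x0) \<bullet> (\<gamma> s - x0))" for s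
  have "\<exists>s\<in>{0<..<t}. u t - u 0 = exp (- (2 * \<Lambda> * s)) * (2 * ((\<gamma> s - x0) \<bullet> grad f (\<gamma> s))
      - 2 * \<Lambda> * ((\<gamma> s - x0) \<bullet> (\<gamma> s - x0))) * (t - 0)"
  proof (rule mvt_simple[where f = u and f' = "\<lambda>s h. exp (- (2 * \<Lambda> * s)) * (2 * ((\<gamma> s - x0) \<bullet> grad f (\<gamma> s))
      - 2 * \<Lambda> * ((\<gamma> s - x0) \<bullet> (\<gamma> s - x0))) * h"])
    fix s assume s: "0 \<le> s" "s \<le> t"
    have "(\<gamma> has_derivative (\<lambda>h. h *\<^sub>R grad f (\<gamma> s))) (at s within {0..t})"
      using flow s unfolding is_gradient_flow_def has_vector_derivative_def
      by (auto intro: has_derivative_subset[where s = "{0..}"])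
    then show "(u has_derivative (\<lambda>h. exp (- (2 * \<Lambda> * s)) * (2 * ((\<gamma> s - x0) \<bullet> grad f (\<gamma> s))
      - 2 * \<Lambda> * ((\<gamma> s - x0) \<bullet> (\<gamma> s - x0))) * h)) (at s within {0..t})"
      unfolding u_def by (auto intro!: derivative_eq_intros simp: algebra_simps inner_commute)
  qed (use False \<open>0 \<le> t\<close> in auto)
  then obtain s where s: "0 < s" "s < t" "u t - u 0 = exp (- (2 * \<Lambda> * s)) * (2 * ((\<gamma> s - x0) \<bullet> grad f (\<gamma> s))
      - 2 * \<Lambda> * ((\<gamma> s - x0) \<bullet> (\<gamma> s - x0))) * t" by auto
  have "(\<gamma> s - x0) \<bullet> grad f (\<gamma> s) \<le> norm (\<gamma> s - x0) * norm (grad f (\<gamma> s) - grad f x0)"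
    using crit norm_cauchy_schwarz by auto
  also have "\<dots> \<le> norm (\<gamma> s - x0) * (\<Lambda> * norm (\<gamma> s - x0))"
    by (intro mult_left_mono \<Lambda>) auto
  also have "\<dots> = \<Lambda> * ((\<gamma> s - x0) \<bullet> (\<gamma> s - x0))"
    by (simp add: power2_norm_eq_inner[symmetric] power2_eq_square)
  finally have "u t - u 0 \<le> 0" using \<open>0 \<le> t\<close> unfolding s(3)
    by (intro mult_nonpos_nonneg mult_nonneg_nonpos) auto
  moreover have "u 0 = 0" using flow by (simp add: u_def is_gradient_flow_def)
  ultimately have "(\<gamma> t - x0) \<bullet> (\<gamma> t - x0) \<le> 0" unfolding u_def
    by (simp add: mult_le_0_iff)
  then show ?thesis by (metis inner_ge_zero inner_eq_zero_iff order_antisym right_minus_eq)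
qed (use flow in \<open>simp add: is_gradient_flow_def\<close>)

text \<open>Compare \<open>y j\<close> with the flow at the elapsed time \<open>t j\<close>, the sum of
the first \<open>j\<close> steps.  One step multiplies the distance by at most \<open>1 + \<Lambda>
h\<close> and adds \<open>h \<beta>\<close>, where \<open>\<beta>\<close> collects the error
\<open>\<delta>\<close> of the field and the local Euler error.  By induction the distance is at most
\<open>\<beta> t exp (\<Lambda> t)\<close>, which for times up to \<open>T + \<tau>hi\<close> does not
exceed the radius \<open>r\<close> of the tube on which the bounds on \<open>g\<close> and
\<open>\<tau>\<close> are available.  The lower bound \<open>\<tau>lo\<close> makes the elapsed time
reach \<open>T\<close>.\<close>

lemma variable_step_euler_tracks_flow:
  fixes f :: "real^'d \<Rightarrow> real"
  assumes flow: "is_gradient_flow f x0 \<gamma>"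
    and B: "\<And>x. norm (grad f x) \<le> B"
    and \<Lambda>: "\<And>x y. norm (grad f x - grad f y) \<le> \<Lambda> * norm (x - y)" "\<Lambda> \<ge> 0"
    and y0: "y 0 = x0" and ySuc: "\<And>j. y (Suc j) = y j + \<tau> (y j) *\<^sub>R g (y j)"
    and tube: "\<And>z t. 0 \<le> t \<Longrightarrow> dist z (\<gamma> t) \<le> r \<Longrightarrow>
        norm (g z - grad f z) \<le> \<delta> \<and> \<tau>lo \<le> \<tau> z \<and> \<tau> z \<le> \<tau>hi"
    and "0 \<le> r" "0 < \<tau>lo" "0 \<le> \<delta>" "0 \<le> T"
    and small: "(\<delta> + \<Lambda> * B * \<tau>hi) * (T + \<tau>hi) * exp (\<Lambda> * (T + \<tau>hi)) \<le> r"
  shows "\<exists>J. \<exists>t\<ge>T. dist (y J) (\<gamma> t) \<le> r \<and> (\<forall>j\<le>J. \<exists>s\<ge>0. dist (y j) (\<gamma> s) \<le> r)"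
proof -
  have "dist x0 (\<gamma> 0) \<le> r" using flow \<open>0 \<le> r\<close> by (simp add: is_gradient_flow_def)
  then have "\<tau>lo \<le> \<tau>hi" using tube[of 0 x0] by auto
  then have \<tau>hi: "0 < \<tau>hi" using \<open>0 < \<tau>lo\<close> by simp
  have "0 \<le> B" using B[of 0] norm_ge_zero order_trans by blast
  define \<beta> where "\<beta> = \<delta> + \<Lambda> * B * \<tau>hi"
  have \<beta>: "0 \<le> \<beta>" using \<open>0 \<le> \<delta>\<close> \<Lambda>(2) \<open>0 \<le> B\<close> \<tau>hi by (simp add: \<beta>_def)
  define t where "t j = (\<Sum>i<j. \<tau> (y i))" for j
  have tSuc: "t (Suc j) = t j + \<tau> (y j)" for j by (simp add: t_def)
  \<comment> \<open>the induction invariant; its last part implies that \<open>y j\<close> is in the tube\<close>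
  define good where "good j \<longleftrightarrow> real j * \<tau>lo \<le> t j \<and> t j \<le> T + \<tau>hi \<and>
      dist (y j) (\<gamma> (t j)) \<le> \<beta> * t j * exp (\<Lambda> * t j)" for j
  have good_nonneg: "0 \<le> t j" if "good j" for j
    using that \<open>0 < \<tau>lo\<close> unfolding good_def by (meson mult_nonneg_nonneg of_nat_0_le_iff order_trans less_imp_le)
  have in_tube: "dist (y j) (\<gamma> (t j)) \<le> r" if "good j" for j
  proof -
    have "\<beta> * t j * exp (\<Lambda> * t j) \<le> \<beta> * (T + \<tau>hi) * exp (\<Lambda> * (T + \<tau>hi))"
      using that good_nonneg[OF that] \<beta> \<Lambda>(2) \<tau>hi \<open>0 \<le> T\<close> unfolding good_def
      by (intro mult_mono) (auto intro!: mult_left_mono)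
    then show ?thesis using that small unfolding good_def \<beta>_def by linarith
  qed
  have step: "good (Suc j)" if "good j" "t j < T" for j
  proof -
    define z s h where "z = y j" and "s = t j" and "h = \<tau> (y j)"
    have s: "0 \<le> s" using good_nonneg[OF that(1)] by (simp add: s_def)
    have b: "norm (g z - grad f z) \<le> \<delta>" "\<tau>lo \<le> h" "h \<le> \<tau>hi"
      using tube[OF s, of z] in_tube[OF that(1)] by (auto simp: z_def s_def h_def)
    have h: "0 < h" using b(2) \<open>0 < \<tau>lo\<close> by simp
    have e: "norm (z - \<gamma> s) \<le> \<beta> * s * exp (\<Lambda> * s)" using that(1) by (simp add: good_def z_def s_def dist_norm)
    have tri: "norm (a + b + c - d) \<le> norm a + norm b + norm c + norm d" for a b c d :: "real^'d"
      using norm_triangle_ineq4[of "a + b + c" d] norm_triangle_ineq[of "a + b" c] norm_triangle_ineq[of a b]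
      by linarith
    have "y (Suc j) - \<gamma> (s + h) = (z - \<gamma> s) + h *\<^sub>R (g z - grad f z) + h *\<^sub>R (grad f z - grad f (\<gamma> s))
        - (\<gamma> (s + h) - \<gamma> s - h *\<^sub>R grad f (\<gamma> s))"
      by (simp add: ySuc z_def h_def algebra_simps)
    also have "norm \<dots> \<le> norm (z - \<gamma> s) + norm (h *\<^sub>R (g z - grad f z)) + norm (h *\<^sub>R (grad f z - grad f (\<gamma> s)))
        + norm (\<gamma> (s + h) - \<gamma> s - h *\<^sub>R grad f (\<gamma> s))"
      by (rule tri)
    also have "\<dots> \<le> norm (z - \<gamma> s) + h * \<delta> + h * (\<Lambda> * norm (z - \<gamma> s)) + \<Lambda> * B * h\<^sup>2"
      using h b(1) \<Lambda>(1)[of z "\<gamma> s"] gradient_flow_euler_error[OF flow B \<Lambda> s, of h]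
      by (intro add_mono) auto
    also have "\<dots> = (1 + \<Lambda> * h) * norm (z - \<gamma> s) + h * (\<delta> + \<Lambda> * B * h)"
      by (simp add: algebra_simps power2_eq_square)
    also have "\<dots> \<le> exp (\<Lambda> * h) * (\<beta> * s * exp (\<Lambda> * s)) + h * (\<beta> * exp (\<Lambda> * (s + h)))"
    proof (intro add_mono mult_mono e)
      have "\<delta> + \<Lambda> * B * h \<le> \<beta>" unfolding \<beta>_def using b(3) \<Lambda>(2) \<open>0 \<le> B\<close> by (auto intro!: mult_left_mono)
      also have "\<beta> * 1 \<le> \<beta> * exp (\<Lambda> * (s + h))"
        using \<beta> \<Lambda>(2) s h by (intro mult_left_mono) auto
      finally show "\<delta> + \<Lambda> * B * h \<le> \<beta> * exp (\<Lambda> * (s + h))" by simp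
    qed (use h \<beta> \<Lambda>(2) \<open>0 \<le> B\<close> \<open>0 \<le> \<delta>\<close> exp_ge_add_one_self[of "\<Lambda> * h"] in auto)
    also have "\<dots> = \<beta> * (s + h) * exp (\<Lambda> * (s + h))"
      by (simp add: algebra_simps exp_add)
    finally show ?thesis
      using that b(2,3) by (simp add: good_def tSuc s_def[symmetric] h_def[symmetric] dist_norm algebra_simps)
  qed
  have good0: "good 0" using flow y0 \<tau>hi \<open>0 \<le> T\<close> by (simp add: good_def t_def is_gradient_flow_def)
  have goodI: "good j" if "\<forall>i<j. t i < T" for j
    using that by (induction j) (auto intro: good0 step)
  have "\<exists>j. T \<le> t j"
  proof (rule ccontr)
    assume "\<not> (\<exists>j. T \<le> t j)"
    then have lt: "t j < T" for j by (simp add: not_le)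
    obtain j :: nat where "T < real j * \<tau>lo" using reals_Archimedean3[OF \<open>0 < \<tau>lo\<close>] by blast
    moreover have "real j * \<tau>lo \<le> t j" using goodI[of j] lt by (simp add: good_def)
    ultimately show False using lt[of j] by simp
  qed
  then obtain J where J: "T \<le> t J" "\<And>i. i < J \<Longrightarrow> t i < T"
    using LeastI_ex[of "\<lambda>j. T \<le> t j"] not_less_Least[of _ "\<lambda>j. T \<le> t j"]
    by (meson not_le)
  have "good j" if "j \<le> J" for j using goodI[of j] J(2) that by auto
  then show ?thesis using J(1) in_tube good_nonneg
    by (intro exI[of _ J] exI[of _ "t J"]) auto
qed

text \<open>Expand the square: the cross term gains \<open>2 \<tau> m\<close>, the quadratic term loses
at most \<open>\<tau>\<^sup>2 \<Lambda>\<^sup>2 \<le> \<tau> m\<close>.\<close>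

lemma strongly_monotone_step_contracts:
  fixes x y :: "'a::real_inner"
  assumes mono: "(g x - g y) \<bullet> (x - y) \<le> - m * (norm (x - y))\<^sup>2"
    and lip: "norm (g x - g y) \<le> \<Lambda> * norm (x - y)"
    and \<tau>: "0 \<le> \<tau>" "\<tau> * \<Lambda>\<^sup>2 \<le> m"
  shows "(norm ((x + \<tau> *\<^sub>R g x) - (y + \<tau> *\<^sub>R g y)))\<^sup>2 \<le> (1 - \<tau> * m) * (norm (x - y))\<^sup>2"
proof -
  have "(norm ((x + \<tau> *\<^sub>R g x) - (y + \<tau> *\<^sub>R g y)))\<^sup>2 = (norm ((x - y) + \<tau> *\<^sub>R (g x - g y)))\<^sup>2"
    by (simp add: algebra_simps)
  also have "\<dots> = (norm (x - y))\<^sup>2 + 2 * \<tau> * ((g x - g y) \<bullet> (x - y)) + \<tau>\<^sup>2 * (norm (g x - g y))\<^sup>2"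
    unfolding power2_norm_eq_inner by (simp add: inner_add_left inner_add_right inner_commute power2_eq_square algebra_simps)
  also have "\<dots> \<le> (norm (x - y))\<^sup>2 + 2 * \<tau> * (- m * (norm (x - y))\<^sup>2) + \<tau>\<^sup>2 * (\<Lambda> * norm (x - y))\<^sup>2"
    using \<tau>(1) by (intro add_mono mult_left_mono mono power_mono lip) auto
  also have "\<dots> = (norm (x - y))\<^sup>2 * (1 - 2 * \<tau> * m + \<tau> * (\<tau> * \<Lambda>\<^sup>2))"
    by (simp add: algebra_simps power2_eq_square)
  also have "\<dots> \<le> (norm (x - y))\<^sup>2 * (1 - 2 * \<tau> * m + \<tau> * m)"
    using \<tau> by (intro mult_left_mono add_left_mono) auto
  finally show ?thesis by (simp add: algebra_simps)
qed

text \<open>A zero of \<open>g\<close> is a fixed point of the step \<open>x + \<tau> g x\<close> with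
constant \<open>\<tau>\<close>, which is a contraction.  It maps the ball into itself because it moves
the centre only by \<open>\<tau> |g a|\<close>.  Monotonicity between the zero and the centre then
improves the distance to \<open>r / 3\<close>.\<close>

lemma strongly_monotone_zero_exists:
  fixes g :: "'a::euclidean_space \<Rightarrow> 'a"
  assumes mono: "\<And>x y. x \<in> cball a r \<Longrightarrow> y \<in> cball a r \<Longrightarrow>
        (g x - g y) \<bullet> (x - y) \<le> - m * (norm (x - y))\<^sup>2"
    and lip: "\<And>x y. x \<in> cball a r \<Longrightarrow> y \<in> cball a r \<Longrightarrow> norm (g x - g y) \<le> \<Lambda> * norm (x - y)"
    and pos: "0 < r" "0 < m" and small: "norm (g a) \<le> m * r / 3"
  shows "\<exists>z\<in>cball a (r / 3). g z = 0"
proof -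
  \<comment> \<open>chosen such that both \<open>\<tau> \<Lambda>\<^sup>2 \<le> m\<close> and \<open>\<tau> m \<le> 1\<close>\<close>
  define \<tau> where "\<tau> = m / (\<Lambda>\<^sup>2 + m\<^sup>2)"
  have D: "\<Lambda>\<^sup>2 + m\<^sup>2 > 0" using pos by (simp add: add_nonneg_pos)
  have \<tau>: "0 < \<tau>" using pos D by (simp add: \<tau>_def)
  have \<tau>\<Lambda>: "\<tau> * \<Lambda>\<^sup>2 \<le> m" 
    using pos D by (simp add: \<tau>_def divide_le_eq power2_eq_square algebra_simps)
  have \<tau>m: "\<tau> * m \<le> 1" using pos D by (simp add: \<tau>_def divide_le_eq power2_eq_square)
  define q where "q = sqrt (1 - \<tau> * m)"
  have "q\<^sup>2 = 1 - \<tau> * m" using \<tau>m by (simp add: q_def)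
  have q0: "0 \<le> q" using \<tau>m by (simp add: q_def)
  have q1: "q < 1" using \<tau> pos by (simp add: q_def)
  have q2: "q \<le> 1 - \<tau> * m / 2"
  proof (rule power2_le_imp_le)
    show "q\<^sup>2 \<le> (1 - \<tau> * m / 2)\<^sup>2" unfolding \<open>q\<^sup>2 = _\<close>
      using zero_le_power2[of "\<tau> * m"] by (simp add: power2_eq_square algebra_simps)
  qed (use \<tau>m in auto)
  define S where "S x = x + \<tau> *\<^sub>R g x" for x
  have contr: "norm (S x - S y) \<le> q * norm (x - y)" if "x \<in> cball a r" "y \<in> cball a r" for x y
  proof (rule power2_le_imp_le)
    show "(norm (S x - S y))\<^sup>2 \<le> (q * norm (x - y))\<^sup>2"
      unfolding S_def power_mult_distrib \<open>q\<^sup>2 = _\<close>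
      using strongly_monotone_step_contracts[OF mono lip, OF that that] \<tau> \<tau>\<Lambda> by simp
  qed (use q0 in auto)
  have "\<exists>!z\<in>cball a r. S z = z"
  proof (rule Banach_fix[OF complete_eq_closed[THEN iffD2] _ q0 q1])
    show "closed (cball a r)" by simp
    show "cball a r \<noteq> {}" using pos by simp
    show "S ` cball a r \<subseteq> cball a r"
    proof clarify
      fix x assume x: "x \<in> cball a r"
      have "norm (S x - a) \<le> norm (S x - S a) + norm (S a - a)"
        using norm_triangle_ineq[of "S x - S a" "S a - a"] by simp
      also have "\<dots> \<le> (1 - \<tau> * m / 2) * r + \<tau> * (m * r / 3)"
      proof (intro add_mono)
        have "norm (S x - S a) \<le> q * norm (x - a)" using contr[OF x] pos by simp
        also have "\<dots> \<le> (1 - \<tau> * m / 2) * r"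
          using q0 q2 x by (intro mult_mono) (auto simp: dist_norm norm_minus_commute)
        finally show "norm (S x - S a) \<le> (1 - \<tau> * m / 2) * r" .
        show "norm (S a - a) \<le> \<tau> * (m * r / 3)"
          unfolding S_def using \<tau> small by simp
      qed
      also have "\<dots> \<le> r" using \<tau> pos by (simp add: algebra_simps)
      finally show "S x \<in> cball a r" by (simp add: dist_norm norm_minus_commute)
    qed
    show "dist (S x) (S y) \<le> q * dist x y" if "x \<in> cball a r" "y \<in> cball a r" for x y
      using contr[OF that] by (simp add: dist_norm)
  qed
  then obtain z where z: "z \<in> cball a r" "g z = 0" using \<tau> by (auto simp: S_def)
  have "m * (norm (z - a))\<^sup>2 \<le> (g a - g z) \<bullet> (z - a)"
    using mono[OF z(1), of a] pos by (simp add: inner_diff_left)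
  also have "\<dots> \<le> norm (g a) * norm (z - a)" using z(2) norm_cauchy_schwarz by simp
  also have "\<dots> \<le> m * r / 3 * norm (z - a)" by (intro mult_right_mono small) auto
  finally have "m * (norm (z - a) * norm (z - a)) \<le> m * (r / 3 * norm (z - a))"
    by (simp add: power2_eq_square)
  then have "norm (z - a) * norm (z - a) \<le> r / 3 * norm (z - a)" using pos(2) by simp
  then have "norm (z - a) \<le> r / 3" using pos
    by (cases "z = a") (auto simp: mult_le_cancel_right)
  then show ?thesis using z(2) by (auto simp: dist_norm norm_minus_commute)
qed

text \<open>All steps share the zero \<open>z\<close> of \<open>g\<close> as a fixed point, so varying
\<open>\<tau>\<close> does no harm: every step shrinks the squared distance to \<open>z\<close> at least
by the factor \<open>1 - \<tau>lo m\<close>.  Starting within \<open>r / 3\<close> of the centre, with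
\<open>z\<close> also within \<open>r / 3\<close>, the iterates stay within \<open>2 r / 3\<close> of
\<open>z\<close> and hence in the ball.\<close>

lemma variable_step_ascent_converges:
  fixes g :: "'a::euclidean_space \<Rightarrow> 'a" and x :: "nat \<Rightarrow> 'a"
  assumes mono: "\<And>x y. x \<in> cball a r \<Longrightarrow> y \<in> cball a r \<Longrightarrow>
        (g x - g y) \<bullet> (x - y) \<le> - m * (norm (x - y))\<^sup>2"
    and lip: "\<And>x y. x \<in> cball a r \<Longrightarrow> y \<in> cball a r \<Longrightarrow> norm (g x - g y) \<le> \<Lambda> * norm (x - y)"
    and pos: "0 < r" "0 < m" and small: "norm (g a) \<le> m * r / 3"
    and x0: "x 0 \<in> cball a (r / 3)" and xSuc: "\<And>j. x (Suc j) = x j + \<tau> (x j) *\<^sub>R g (x j)"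
    and \<tau>: "\<And>z. z \<in> cball a r \<Longrightarrow> \<tau>lo \<le> \<tau> z \<and> \<tau> z \<le> \<tau>hi"
    and \<tau>lo: "0 < \<tau>lo" and \<tau>hi: "\<tau>hi * \<Lambda>\<^sup>2 \<le> m" "\<tau>hi * m \<le> 1"
  shows "(\<forall>j. x j \<in> cball a r) \<and> (\<exists>z. x \<longlonglongrightarrow> z \<and> norm (z - a) \<le> norm (g a) / m)"
proof -
  obtain z where z: "z \<in> cball a (r / 3)" "g z = 0"
    using strongly_monotone_zero_exists[OF mono lip pos small] by blast
  have zr: "z \<in> cball a r" using z(1) pos by auto
  define Q where "Q = 1 - \<tau>lo * m"
  have "\<tau>lo \<le> \<tau>hi" using \<tau>[OF zr] by auto
  then have "\<tau>lo * m \<le> 1" using \<tau>hi(2) pos(2) mult_right_mono[of \<tau>lo \<tau>hi m] by linarith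
  then have Q: "0 \<le> Q" "Q < 1" using \<tau>lo pos by (auto simp: Q_def)
  have near: "x j \<in> cball a r" if "norm (x j - z) \<le> 2 * r / 3" for j
    using that z(1) norm_triangle_ineq[of "x j - z" "z - a"]
    by (auto simp: dist_norm norm_minus_commute)
  have step: "(norm (x (Suc j) - z))\<^sup>2 \<le> Q * (norm (x j - z))\<^sup>2" if "norm (x j - z) \<le> 2 * r / 3" for j
  proof -
    note xj = near[OF that]
    have \<tau>j: "0 \<le> \<tau> (x j)" using \<tau>[OF xj] \<tau>lo by linarith
    have "\<tau> (x j) * \<Lambda>\<^sup>2 \<le> \<tau>hi * \<Lambda>\<^sup>2" using \<tau>[OF xj] by (intro mult_right_mono) auto
    then have "(norm ((x j + \<tau> (x j) *\<^sub>R g (x j)) - (z + \<tau> (x j) *\<^sub>R g z)))\<^sup>2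
        \<le> (1 - \<tau> (x j) * m) * (norm (x j - z))\<^sup>2"
      using \<tau>hi(1) \<tau>j by (intro strongly_monotone_step_contracts[OF mono lip, OF xj zr xj zr]) auto
    also have "\<dots> \<le> Q * (norm (x j - z))\<^sup>2"
      unfolding Q_def using \<tau>[OF xj] pos by (intro mult_right_mono) auto
    finally show ?thesis by (simp add: xSuc z(2))
  qed
  have rate: "norm (x j - z) \<le> 2 * r / 3 \<and> (norm (x j - z))\<^sup>2 \<le> Q ^ j * (norm (x 0 - z))\<^sup>2" for j
  proof (induction j)
    case 0
    show ?case using x0 z(1) norm_triangle_ineq[of "x 0 - a" "a - z"]
      by (auto simp: dist_norm norm_minus_commute)
  next
    case (Suc j)
    have s: "(norm (x (Suc j) - z))\<^sup>2 \<le> Q * (norm (x j - z))\<^sup>2" using step Suc by blast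
    have "\<dots> \<le> 1 * (norm (x j - z))\<^sup>2" using Q by (intro mult_right_mono) auto
    with s have "(norm (x (Suc j) - z))\<^sup>2 \<le> (norm (x j - z))\<^sup>2" by linarith
    then have "norm (x (Suc j) - z) \<le> norm (x j - z)" by (rule power2_le_imp_le) simp
    moreover have "Q * (norm (x j - z))\<^sup>2 \<le> Q * (Q ^ j * (norm (x 0 - z))\<^sup>2)"
      using Q Suc by (intro mult_left_mono) auto
    ultimately show ?case using Suc s by auto
  qed
  have "(\<lambda>j. Q ^ j * (norm (x 0 - z))\<^sup>2) \<longlonglongrightarrow> 0"
    using Q by (auto intro!: tendsto_mult_left_zero LIMSEQ_realpow_zero)
  then have "(\<lambda>j. (norm (x j - z))\<^sup>2) \<longlonglongrightarrow> 0"
    by (rule real_tendsto_sandwich[where f = "\<lambda>_. 0", rotated 3]) (use rate in auto)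
  then have "(\<lambda>j. sqrt ((norm (x j - z))\<^sup>2)) \<longlonglongrightarrow> sqrt 0" by (rule tendsto_real_sqrt)
  then have lim: "x \<longlonglongrightarrow> z" by (simp add: LIM_zero_iff tendsto_norm_zero_iff)
  have "m * (norm (z - a))\<^sup>2 \<le> (g a - g z) \<bullet> (z - a)"
    using mono[OF zr, of a] pos by (simp add: inner_diff_left)
  also have "\<dots> \<le> norm (g a) * norm (z - a)" using z(2) norm_cauchy_schwarz by simp
  finally have "m * norm (z - a) * norm (z - a) \<le> norm (g a) * norm (z - a)"
    by (simp add: power2_eq_square)
  then have "m * norm (z - a) \<le> norm (g a)"
    by (cases "z = a") (auto simp: mult_le_cancel_right)
  then have "norm (z - a) \<le> norm (g a) / m" using pos by (simp add: pos_le_divide_eq mult.commute)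
  then show ?thesis using rate near lim by blast
qed

section \<open>Kernels\<close>

lemma prod_Basis_cart: "(\<Prod>b\<in>(Basis::(real^'d) set). g b) = (\<Prod>i\<in>UNIV. g (axis i 1))"
proof -
  have "(Basis::(real^'d) set) = range (\<lambda>i. axis i 1)" by (auto simp: Basis_vec_def)
  moreover have "inj (\<lambda>i::'d. axis i (1::real))" by (auto simp: inj_on_def axis_eq_axis)
  ultimately show ?thesis by (metis (no_types, lifting) comp_apply prod.cong prod.reindex)
qed

text \<open>The two families of symmetries below, coordinate permutations and sign changes, suffice to
compute the first two moments of a radial kernel.  Both preserve the volume of boxes.\<close>

lemma lborel_distr_permute_coords:
  fixes p :: "'d::finite \<Rightarrow> 'd"
  assumes p: "bij p"
  shows "distr lborel borel (\<lambda>x::real^'d. \<chi> i. x $ p i) = lborel"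
proof (rule sym, rule lborel_eqI)
  let ?T = "\<lambda>x::real^'d. \<chi> i. x $ p i"
  have [measurable]: "?T \<in> borel \<rightarrow>\<^sub>M borel"
    by (intro borel_measurable_continuous_onI continuous_intros)
  fix l u :: "real^'d"
  assume le: "\<And>b. b \<in> Basis \<Longrightarrow> l \<bullet> b \<le> u \<bullet> b"
  let ?q = "inv p"
  have pq: "p (?q i) = i" "?q (p i) = i" for i
    using p by (simp_all add: bij_is_surj surj_f_inv_f bij_is_inj)
  have eq: "?T -` box l u = box (\<chi> i. l $ ?q i) (\<chi> i. u $ ?q i)"
  proof (intro set_eqI)
    fix x
    have "(\<forall>i. l $ i < x $ p i \<and> x $ p i < u $ i) \<longleftrightarrow> (\<forall>i. l $ ?q i < x $ i \<and> x $ i < u $ ?q i)"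
      by (metis pq)
    then show "x \<in> ?T -` box l u \<longleftrightarrow> x \<in> box (\<chi> i. l $ ?q i) (\<chi> i. u $ ?q i)"
      by (simp add: mem_box_cart)
  qed
  have le': "l $ i \<le> u $ i" for i using le[of "axis i 1"] by (simp add: inner_axis)
  have "emeasure (distr lborel borel ?T) (box l u) = emeasure lborel (?T -` box l u)"
    by (subst emeasure_distr) auto
  also have "\<dots> = (\<Prod>b\<in>Basis. ((\<chi> i. u $ ?q i) - (\<chi> i. l $ ?q i)) \<bullet> b)"
    unfolding eq by (rule emeasure_lborel_box) (auto simp: Basis_vec_def inner_axis le')
  also have "(\<Prod>b\<in>Basis. ((\<chi> i. u $ ?q i) - (\<chi> i. l $ ?q i)) \<bullet> b) = (\<Prod>i\<in>UNIV. u $ ?q i - l $ ?q i)"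
    by (simp add: prod_Basis_cart inner_axis)
  also have "\<dots> = (\<Prod>i\<in>UNIV. u $ i - l $ i)"
    by (rule prod.reindex_bij_betw[of ?q, symmetric, symmetric]) (use p in \<open>simp add: bij_imp_bij_inv\<close>)
  also have "\<dots> = (\<Prod>b\<in>Basis. (u - l) \<bullet> b)" by (simp add: prod_Basis_cart inner_axis)
  finally show "emeasure (distr lborel borel ?T) (box l u) = (\<Prod>b\<in>Basis. (u - l) \<bullet> b)" .
qed simp

lemma flip_coord_measurable:
  "(\<lambda>x::real^'d. \<chi> k. if k = i then - x $ k else x $ k) \<in> borel_measurable borel"
proof (intro borel_measurable_continuous_onI continuous_on_vec_lambda)
  show "continuous_on UNIV (\<lambda>x::real^'d. if k = i then - x $ k else x $ k)" for k
    by (cases "k = i") (auto intro!: continuous_intros)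
qed

lemma lborel_distr_flip_coord:
  fixes i :: "'d::finite"
  shows "distr lborel borel (\<lambda>x::real^'d. \<chi> k. if k = i then - x $ k else x $ k) = lborel"
proof (rule sym, rule lborel_eqI)
  let ?T = "\<lambda>x::real^'d. \<chi> k. if k = i then - x $ k else x $ k"
  have [measurable]: "?T \<in> borel \<rightarrow>\<^sub>M borel" by (rule flip_coord_measurable)
  fix l u :: "real^'d"
  assume le: "\<And>b. b \<in> Basis \<Longrightarrow> l \<bullet> b \<le> u \<bullet> b"
  let ?l = "\<chi> k. if k = i then - u $ k else l $ k" and ?u = "\<chi> k. if k = i then - l $ k else u $ k"
  have eq: "?T -` box l u = box ?l ?u"
    by (auto simp: mem_box_cart split: if_splits) (metis neg_less_iff_less minus_minus)+
  have le': "l $ k \<le> u $ k" for k using le[of "axis k 1"] by (simp add: inner_axis)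
  have "emeasure (distr lborel borel ?T) (box l u) = emeasure lborel (?T -` box l u)"
    by (subst emeasure_distr) auto
  also have "\<dots> = (\<Prod>b\<in>Basis. (?u - ?l) \<bullet> b)"
    unfolding eq by (rule emeasure_lborel_box) (auto simp: Basis_vec_def inner_axis le')
  also have "(\<Prod>b\<in>Basis. (?u - ?l) \<bullet> b) = (\<Prod>b\<in>Basis. (u - l) \<bullet> b)"
    unfolding prod_Basis_cart by (intro prod.cong) (auto simp: inner_axis)
  finally show "emeasure (distr lborel borel ?T) (box l u) = (\<Prod>b\<in>Basis. (u - l) \<bullet> b)" .
qed simp

lemma norm_permute_coords:
  fixes x :: "real^'d"
  assumes "bij p" shows "norm (\<chi> i. x $ p i) = norm x"
  unfolding norm_vec_def L2_set_def
  using sum.reindex_bij_betw[OF assms, of "\<lambda>i. (norm (x $ i))\<^sup>2"] by simp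

lemma norm_flip_coord:
  fixes x :: "real^'d"
  shows "norm (\<chi> k. if k = i then - x $ k else x $ k) = norm x"
  unfolding norm_vec_def L2_set_def
  by (intro arg_cong[of _ _ sqrt] sum.cong) auto

lemma integral_lborel_distr_invariant:
  fixes g :: "'a::euclidean_space \<Rightarrow> real"
  assumes T: "distr lborel borel T = lborel" "T \<in> borel_measurable borel" and g: "g \<in> borel_measurable borel"
  shows "(LINT x|lborel. g (T x)) = (LINT x|lborel. g x)"
proof -
  have "(LINT x|lborel. g x) = (LINT x|distr lborel borel T. g x)" by (simp only: T)
  also have "\<dots> = (LINT x|lborel. g (T x))"
    using T g by (intro integral_distr) auto
  finally show ?thesis by simp
qed

text \<open>A single constant \<open>C\<close> bounds the function and its Lipschitz quotients; only the
existence of such a constant matters.\<close>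

definition compact_lipschitz :: "real \<Rightarrow> real \<Rightarrow> (real^'d \<Rightarrow> real) \<Rightarrow> bool" where
  "compact_lipschitz R C \<phi> \<longleftrightarrow> 0 < R \<and> 0 < C \<and>
     (\<forall>x. R < norm x \<longrightarrow> \<phi> x = 0) \<and> (\<forall>x. \<bar>\<phi> x\<bar> \<le> C) \<and> (\<forall>x y. \<bar>\<phi> x - \<phi> y\<bar> \<le> C * norm (x - y))"

lemma compact_lipschitzD:
  assumes "compact_lipschitz R C \<phi>"
  shows "0 < R" "0 < C" "R < norm x \<Longrightarrow> \<phi> x = 0" "\<bar>\<phi> x\<bar> \<le> C" "\<bar>\<phi> x - \<phi> y\<bar> \<le> C * norm (x - y)"
  using assms unfolding compact_lipschitz_def by auto

lemma compact_lipschitz_continuous: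
  assumes "compact_lipschitz R C \<phi>"
  shows "continuous_on UNIV \<phi>"
proof -
  have "C-lipschitz_on UNIV \<phi>"
    using compact_lipschitzD[OF assms] by (intro lipschitz_onI) (auto simp: dist_norm)
  then show ?thesis by (rule lipschitz_on_continuous_on)
qed

lemma compact_lipschitz_measurable [measurable_dest]:
  assumes "compact_lipschitz R C \<phi>"
  shows "\<phi> \<in> borel_measurable borel"
  using compact_lipschitz_continuous[OF assms] by (rule borel_measurable_continuous_onI)

lemma compact_lipschitz_mono:
  assumes "compact_lipschitz R C \<phi>" "R \<le> R'" "C \<le> C'"
  shows "compact_lipschitz R' C' \<phi>"
  unfolding compact_lipschitz_def
proof (intro conjI allI impI)
  note D = compact_lipschitzD[OF assms(1)]
  show "0 < R'" "0 < C'" using D(1,2) assms by linarith+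
  show "\<phi> x = 0" if "R' < norm x" for x using D(3)[of x] that assms by linarith
  show "\<bar>\<phi> x\<bar> \<le> C'" for x using D(4)[of x] assms by linarith
  show "\<bar>\<phi> x - \<phi> y\<bar> \<le> C' * norm (x - y)" for x y
    using D(5)[of x y] mult_right_mono[OF assms(3), of "norm (x - y)"] by simp
qed

lemma compact_lipschitz_add:
  assumes "compact_lipschitz R C \<phi>" "compact_lipschitz R C' \<psi>"
  shows "compact_lipschitz R (C + C') (\<lambda>x. \<phi> x + \<psi> x)"
  unfolding compact_lipschitz_def
proof (intro conjI allI impI)
  note D = compact_lipschitzD[OF assms(1)] and E = compact_lipschitzD[OF assms(2)]
  show "0 < R" "0 < C + C'" using D(1,2) E(2) by linarith+
  show "\<phi> x + \<psi> x = 0" if "R < norm x" for x using D(3) E(3) that by simp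
  show "\<bar>\<phi> x + \<psi> x\<bar> \<le> C + C'" for x using D(4)[of x] E(4)[of x] by linarith
  show "\<bar>\<phi> x + \<psi> x - (\<phi> y + \<psi> y)\<bar> \<le> (C + C') * norm (x - y)" for x y
    using D(5)[of x y] E(5)[of x y] by (simp add: algebra_simps)
qed

text \<open>The coordinate function is unbounded, but at most \<open>R\<close> on the support.  Of two
points at least one may be assumed to be in the support, and the product is expanded at that
point.\<close>

lemma compact_lipschitz_times_coord:
  fixes \<phi> :: "real^'d \<Rightarrow> real"
  assumes "compact_lipschitz R C \<phi>"
  shows "compact_lipschitz R (C * (R + 1)) (\<lambda>x. \<phi> x * x $ i)"
  unfolding compact_lipschitz_def
proof (intro conjI allI impI)
  note D = compact_lipschitzD[OF assms]
  show "0 < R" by (rule D)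
  show "0 < C * (R + 1)" using D(1,2) by simp
  show "\<phi> x * x $ i = 0" if "R < norm x" for x using D(3) that by simp
  have inside: "\<bar>x $ i\<bar> \<le> R" if "norm x \<le> R" for x :: "real^'d"
    using component_le_norm_cart[of x i] that by linarith
  show "\<bar>\<phi> x * x $ i\<bar> \<le> C * (R + 1)" for x
  proof (cases "norm x \<le> R")
    case True
    have "\<bar>\<phi> x\<bar> * \<bar>x $ i\<bar> \<le> C * (R + 1)"
      using D(1,2) D(4)[of x] inside[OF True] by (intro mult_mono) auto
    then show ?thesis by (simp add: abs_mult)
  qed (use D in auto)
  have main: "\<bar>\<phi> x * x $ i - \<phi> y * y $ i\<bar> \<le> C * (R + 1) * norm (x - y)" if "norm x \<le> R" for x y
  proof -
    have "\<phi> x * x $ i - \<phi> y * y $ i = (\<phi> x - \<phi> y) * x $ i + \<phi> y * (x - y) $ i"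
      by (simp add: algebra_simps)
    also have "\<bar>\<dots>\<bar> \<le> \<bar>\<phi> x - \<phi> y\<bar> * \<bar>x $ i\<bar> + \<bar>\<phi> y\<bar> * \<bar>(x - y) $ i\<bar>"
      by (simp only: abs_mult[symmetric] abs_triangle_ineq)
    also have "\<dots> \<le> (C * norm (x - y)) * R + C * norm (x - y)"
      using D(1,2) D(4,5) inside[OF that] component_le_norm_cart[of "x - y" i]
      by (intro add_mono mult_mono) auto
    finally show ?thesis by (simp add: algebra_simps)
  qed
  show "\<bar>\<phi> x * x $ i - \<phi> y * y $ i\<bar> \<le> C * (R + 1) * norm (x - y)" for x y
  proof (cases "norm x \<le> R \<or> norm y \<le> R")
    case True
    then show ?thesis using main[of x y] main[of y x] by (auto simp: norm_minus_commute abs_minus_commute)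
  next
    case False
    then show ?thesis using D by auto
  qed
qed

lemma continuous_bounded_on_cball:
  fixes \<phi> :: "real^'d \<Rightarrow> 'b::real_normed_vector"
  assumes "continuous_on UNIV \<phi>"
  shows "\<exists>B. \<forall>x. norm x \<le> R \<longrightarrow> norm (\<phi> x) \<le> B"
proof -
  have "compact (\<phi> ` cball 0 R)"
    by (intro compact_continuous_image continuous_on_subset[OF assms]) auto
  then have "bounded (\<phi> ` cball 0 R)" by (rule compact_imp_bounded)
  then obtain B where "\<forall>x\<in>cball 0 R. norm (\<phi> x) \<le> B" unfolding bounded_iff by auto
  then show ?thesis by (intro exI[of _ B]) simp
qed

lemma lipschitz_imp_compact_lipschitz:
  fixes \<phi> :: "real^'d \<Rightarrow> real"
  assumes cont: "continuous_on UNIV \<phi>" and "0 < R" and zero: "\<And>x. R < norm x \<Longrightarrow> \<phi> x = 0"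
    and lip: "\<And>x y. \<bar>\<phi> x - \<phi> y\<bar> \<le> C * norm (x - y)"
  shows "\<exists>C'. compact_lipschitz R C' \<phi>"
proof -
  obtain B where B: "\<And>x. norm x \<le> R \<Longrightarrow> \<bar>\<phi> x\<bar> \<le> B"
    using continuous_bounded_on_cball[OF cont] unfolding real_norm_def by metis
  have "\<bar>\<phi> x\<bar> \<le> \<bar>B\<bar>" for x using B[of x] zero[of x] by (cases "norm x \<le> R") auto
  moreover have "\<bar>\<phi> x - \<phi> y\<bar> \<le> (\<bar>C\<bar> + \<bar>B\<bar> + 1) * norm (x - y)" for x y
  proof -
    have "\<bar>\<phi> x - \<phi> y\<bar> \<le> C * norm (x - y)" by (rule lip)
    also have "\<dots> \<le> (\<bar>C\<bar> + \<bar>B\<bar> + 1) * norm (x - y)" by (intro mult_right_mono) auto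
    finally show ?thesis .
  qed
  moreover have "\<bar>B\<bar> \<le> \<bar>C\<bar> + \<bar>B\<bar> + 1" by simp
  ultimately have "compact_lipschitz R (\<bar>C\<bar> + \<bar>B\<bar> + 1) \<phi>"
    using zero \<open>0 < R\<close> unfolding compact_lipschitz_def by (metis abs_ge_zero add_nonneg_pos order_trans
      zero_less_one add_nonneg_nonneg)
  then show ?thesis by blast
qed

lemma kernel_support:
  assumes "is_kernel K k"
  obtains R where "R > 0" "\<And>x. R < norm x \<Longrightarrow> K x = 0"
proof -
  have "bounded {x. K x \<noteq> 0}"
    using assms unfolding is_kernel_def by (metis compact_imp_bounded bounded_subset closure_subset)
  then obtain b where "\<And>x. K x \<noteq> 0 \<Longrightarrow> norm x \<le> b" unfolding bounded_iff by auto
  then show ?thesis by (intro that[of "max b 1"]) (auto simp: max_def not_le split: if_splits, force+)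
qed

lemma kernel_regularity:
  fixes K :: "real^'d \<Rightarrow> real"
  assumes K: "is_kernel K k"
  obtains R C \<Lambda> where "compact_lipschitz R C K" "\<And>j. compact_lipschitz R C (\<lambda>w. grad K w $ j)"
    "\<And>x y. norm (grad K x - grad K y) \<le> \<Lambda> * norm (x - y)"
proof -
  have td: "twice_differentiable K" and cont: "continuous_on UNIV (hessian K)"
    using K unfolding is_kernel_def by auto
  obtain R where R: "R > 0" and zero: "\<And>x. R < norm x \<Longrightarrow> K x = 0" using kernel_support[OF K] by blast
  have zeros: "grad K x = 0" "hessian K x = 0" if "R < norm x" for x
    using derivatives_zero_on_open[OF td, of "{x. R < norm x}" x] that zero
      open_Collect_less[OF continuous_on_const continuous_on_norm_id, of R] by auto
  obtain H where H: "\<And>x. norm x \<le> R \<Longrightarrow> norm (hessian K x) \<le> H"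
    using continuous_bounded_on_cball[OF cont] by metis
  have "norm (hessian K x) \<le> \<bar>H\<bar>" for x
    using H[of x] zeros(2)[of x] by (cases "norm x \<le> R") auto
  then have "norm (hessian K x *v v) \<le> \<bar>H\<bar> * norm v" for x v
    using norm_matrix_vector_mult_le[of "hessian K x" v] mult_right_mono[of "norm (hessian K x)" "\<bar>H\<bar>" "norm v"]
    by (auto intro: order_trans)
  then have lipg: "norm (grad K x - grad K y) \<le> \<bar>H\<bar> * norm (x - y)" for x y
    by (rule grad_lipschitz[OF td])
  have contg: "continuous_on UNIV (grad K)"
    using has_derivative_continuous[OF has_derivative_grad[OF td]]
    by (auto simp: continuous_on_eq_continuous_at)
  have contK: "continuous_on UNIV K"
    by (rule twice_differentiable_continuous[OF td])
  obtain G where G: "\<And>x. norm x \<le> R \<Longrightarrow> norm (grad K x) \<le> G"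
    using continuous_bounded_on_cball[OF contg] by metis
  have "norm (grad K x) \<le> \<bar>G\<bar>" for x
    using G[of x] zeros(1)[of x] by (cases "norm x \<le> R") auto
  then have "\<bar>K x - K y\<bar> \<le> \<bar>G\<bar> * norm (x - y)" for x y
    by (rule lipschitz_of_bounded_grad[OF td])
  then obtain C0 where C0: "compact_lipschitz R C0 K"
    using lipschitz_imp_compact_lipschitz[OF contK R zero] by blast
  have "\<exists>C. compact_lipschitz R C (\<lambda>w. grad K w $ j)" for j
  proof (rule lipschitz_imp_compact_lipschitz[OF _ R])
    show "continuous_on UNIV (\<lambda>w. grad K w $ j)" by (intro continuous_intros contg)
    show "\<bar>grad K x $ j - grad K y $ j\<bar> \<le> \<bar>H\<bar> * norm (x - y)" for x y
      using component_le_norm_cart[of "grad K x - grad K y" j] lipg[of x y] by simp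
  qed (use zeros in auto)
  then obtain C1 where C1: "\<And>j. compact_lipschitz R (C1 j) (\<lambda>w. grad K w $ j)" by metis
  define C where "C = C0 + (\<Sum>j\<in>UNIV. C1 j)"
  have "C0 \<le> C" "C1 j \<le> C" for j
    unfolding C_def using compact_lipschitzD(2)[OF C1] compact_lipschitzD(2)[OF C0]
      member_le_sum[of j UNIV C1] by (auto simp: less_imp_le sum_nonneg intro: add_increasing)
  then show ?thesis using that[of R C "\<bar>H\<bar>"] C0 C1 lipg compact_lipschitz_mono by blast
qed

text \<open>These coordinates of \<open>K w *\<^sub>R w\<close> form the numerator of the mean shift, up
to centring and scaling.\<close>

definition kernel_moment :: "(real^'d \<Rightarrow> real) \<Rightarrow> 'd \<Rightarrow> real^'d \<Rightarrow> real" where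
  "kernel_moment K i w = K w * w $ i"

text \<open>The partial derivative of \<^term>\<open>kernel_moment K i\<close> in direction
\<open>j\<close>.\<close>

definition kernel_moment_deriv :: "(real^'d \<Rightarrow> real) \<Rightarrow> 'd \<Rightarrow> 'd \<Rightarrow> real^'d \<Rightarrow> real" where
  "kernel_moment_deriv K i j w = grad K w $ j * w $ i + (if j = i then K w else 0)"

text \<open>The functions whose empirical averages are to be controlled: they make up the kernel density
estimate, the gradient estimate, and the derivative of the latter.\<close>

definition kernel_functions :: "(real^'d \<Rightarrow> real) \<Rightarrow> (real^'d \<Rightarrow> real) set" where
  "kernel_functions K = insert K (range (kernel_moment K) \<union> range (\<lambda>(i, j). kernel_moment_deriv K i j))"

lemma kernel_functions_mem:
  "K \<in> kernel_functions K" "kernel_moment K i \<in> kernel_functions K"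
  "kernel_moment_deriv K i j \<in> kernel_functions K"
  by (auto simp: kernel_functions_def)

text \<open>The Taylor estimate is all that is used about the derivative of
\<^const>\<open>kernel_moment\<close>: being uniform in \<open>w\<close>, it survives averaging over a
sample as well as integration against the density.  If \<open>w\<close> is outside the support then
\<open>K\<close> and its gradient vanish at \<open>w\<close>, and the product is expanded at \<open>w +
v\<close>, where the coordinate is bounded.\<close>

lemma kernel_moment_regularity:
  fixes K :: "real^'d \<Rightarrow> real"
  assumes K: "is_kernel K k"
  obtains R C where "\<And>\<phi>. \<phi> \<in> kernel_functions K \<Longrightarrow> compact_lipschitz R C \<phi>"
    "\<And>i w v. \<bar>kernel_moment K i (w + v) - kernel_moment K i w
               - (\<Sum>j\<in>UNIV. v $ j * kernel_moment_deriv K i j w)\<bar> \<le> C * (norm v)\<^sup>2"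
proof -
  have td: "twice_differentiable K" using K unfolding is_kernel_def by auto
  obtain R C \<Lambda> where C: "compact_lipschitz R C K" and gC: "\<And>j. compact_lipschitz R C (\<lambda>w. grad K w $ j)"
    and \<Lambda>: "\<And>x y. norm (grad K x - grad K y) \<le> \<Lambda> * norm (x - y)"
    using kernel_regularity[OF K] by blast
  note D = compact_lipschitzD[OF C]
  define C' where "C' = C * (R + 1) + C + \<bar>\<Lambda>\<bar> * R"
  have C': "C \<le> C'" "C * (R + 1) \<le> C'" "C * (R + 1) + C \<le> C'"
    using D(1,2) by (auto simp: C'_def add_nonneg_nonneg)
  have zero: "compact_lipschitz R C (\<lambda>w::real^'d. 0)" using D(1,2) by (auto simp: compact_lipschitz_def)
  show ?thesis
  proof (rule that[of R C'])
    have "compact_lipschitz R C' K" using compact_lipschitz_mono[OF C] C' by simp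
    moreover have "compact_lipschitz R C' (kernel_moment K i)" for i
      unfolding kernel_moment_def using compact_lipschitz_mono[OF compact_lipschitz_times_coord[OF C]] C' by simp
    moreover have "compact_lipschitz R C' (kernel_moment_deriv K i j)" for i j
    proof -
      have "compact_lipschitz R C (\<lambda>w. if j = i then K w else 0)" using C zero by (cases "j = i") auto
      from compact_lipschitz_mono[OF compact_lipschitz_add[OF compact_lipschitz_times_coord[OF gC] this] order_refl C'(3)]
      show ?thesis unfolding kernel_moment_deriv_def .
    qed
    ultimately show "compact_lipschitz R C' \<phi>" if "\<phi> \<in> kernel_functions K" for \<phi>
      using that by (auto simp: kernel_functions_def)
    fix i and w v :: "real^'d"
    define T where "T = K (w + v) - K w - v \<bullet> grad K w"
    have T: "\<bar>T\<bar> \<le> \<bar>\<Lambda>\<bar> * (norm v)\<^sup>2"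
      unfolding T_def
    proof (rule first_order_taylor_bound[OF td])
      fix x y show "norm (grad K x - grad K y) \<le> \<bar>\<Lambda>\<bar> * norm (x - y)"
        using \<Lambda>[of x y] mult_right_mono[OF abs_ge_self[of \<Lambda>] norm_ge_zero[of "x - y"]] by linarith
    qed
    have "(\<Sum>j\<in>UNIV. v $ j * kernel_moment_deriv K i j w) = (v \<bullet> grad K w) * w $ i + v $ i * K w"
      by (simp add: kernel_moment_deriv_def inner_vec_def distrib_left sum.distrib sum_distrib_right mult.assoc
          if_distrib[of "(*) _"] cong: if_cong)
    then have eq: "kernel_moment K i (w + v) - kernel_moment K i w - (\<Sum>j\<in>UNIV. v $ j * kernel_moment_deriv K i j w)
        = T * w $ i + (K (w + v) - K w) * v $ i"
      by (simp add: kernel_moment_def T_def algebra_simps)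
    have coord: "\<bar>x $ i\<bar> \<le> R" if "norm x \<le> R" for x :: "real^'d"
      using component_le_norm_cart[of x i] that by linarith
    have "\<bar>T * w $ i + (K (w + v) - K w) * v $ i\<bar> \<le> \<bar>\<Lambda>\<bar> * R * (norm v)\<^sup>2 + C * (norm v)\<^sup>2"
    proof (cases "norm w \<le> R")
      case True
      have "\<bar>T * w $ i + (K (w + v) - K w) * v $ i\<bar> \<le> \<bar>T\<bar> * \<bar>w $ i\<bar> + \<bar>K (w + v) - K w\<bar> * \<bar>v $ i\<bar>"
        by (simp only: abs_mult[symmetric] abs_triangle_ineq)
      also have "\<dots> \<le> (\<bar>\<Lambda>\<bar> * (norm v)\<^sup>2) * R + (C * norm v) * norm v"
        using T coord[OF True] D(1,2) D(5)[of "w + v" w] component_le_norm_cart[of v i]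
        by (intro add_mono mult_mono) auto
      finally show ?thesis by (simp add: power2_eq_square algebra_simps)
    next
      case False
      then have "K w = 0" "grad K w = 0"
        using D(3) compact_lipschitzD(3)[OF gC, of w] by (auto simp: vec_eq_iff)
      then have T': "T = K (w + v)" by (simp add: T_def)
      then have "T * w $ i + (K (w + v) - K w) * v $ i = T * (w + v) $ i"
        using \<open>K w = 0\<close> by (simp add: algebra_simps)
      also have "\<bar>\<dots>\<bar> \<le> \<bar>\<Lambda>\<bar> * (norm v)\<^sup>2 * R"
      proof (cases "norm (w + v) \<le> R")
        case True
        then show ?thesis using T coord[OF True] D(1) unfolding abs_mult by (intro mult_mono) auto
      next
        case False
        then show ?thesis using T' D(1) D(3)[of "w + v"] by simp
      qed
      finally show ?thesis using D(2) by (simp add: algebra_simps add_increasing)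
    qed
    also have "\<dots> \<le> C' * (norm v)\<^sup>2"
    proof -
      have "\<bar>\<Lambda>\<bar> * R + C \<le> C'" using D(1,2) by (simp add: C'_def)
      from mult_right_mono[OF this, of "(norm v)\<^sup>2"] show ?thesis by (simp add: algebra_simps)
    qed
    finally show "\<bar>kernel_moment K i (w + v) - kernel_moment K i w
               - (\<Sum>j\<in>UNIV. v $ j * kernel_moment_deriv K i j w)\<bar> \<le> C' * (norm v)\<^sup>2"
      unfolding eq .
  qed
qed

section \<open>Bias of the smoothed density and gradient\<close>

lemma integrable_compact_lipschitz_times:
  assumes \<phi>: "compact_lipschitz R C \<phi>" and g: "continuous_on UNIV g"
  shows "integrable lborel (\<lambda>u. \<phi> u * g u :: real)"
proof -
  have "integrable lborel (\<lambda>u. indicator (cball 0 R) u *\<^sub>R (\<phi> u * g u))"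
    by (intro borel_integrable_compact continuous_intros continuous_on_subset[OF g]
        continuous_on_subset[OF compact_lipschitz_continuous[OF \<phi>]]) auto
  moreover have "(\<lambda>u. indicator (cball 0 R) u *\<^sub>R (\<phi> u * g u)) = (\<lambda>u. \<phi> u * g u)"
    using compact_lipschitzD(3)[OF \<phi>] by (auto simp: indicator_def fun_eq_iff not_le)
  ultimately show ?thesis by simp
qed

lemma is_kernelD:
  assumes "is_kernel K k"
  shows "0 \<le> K x" "integrable lborel K" "(LINT x|lborel. K x) = 1" "norm x = norm y \<Longrightarrow> K x = K y"
proof -
  show "0 \<le> K x" "integrable lborel K" "(LINT x|lborel. K x) = 1"
    using assms unfolding is_kernel_def by blast+
  show "K x = K y" if "norm x = norm y"
    using assms that unfolding is_kernel_def by metis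
qed

text \<open>Flipping a coordinate preserves \<open>K\<close> and changes the sign of that
coordinate.\<close>

lemma kernel_first_moment:
  fixes K :: "real^'d \<Rightarrow> real"
  assumes K: "is_kernel K k" and C: "compact_lipschitz R C K"
  shows "(LINT u|lborel. K u * (u \<bullet> w)) = 0"
proof -
  have [measurable]: "K \<in> borel_measurable borel" by (rule compact_lipschitz_measurable[OF C])
  have coord: "(LINT u|lborel. K u * u $ i) = 0" for i
  proof -
    let ?T = "\<lambda>x::real^'d. \<chi> k. if k = i then - x $ k else x $ k"
    have [measurable]: "?T \<in> borel_measurable borel" by (rule flip_coord_measurable)
    have "K (?T u) = K u" for u by (rule is_kernelD(4)[OF K norm_flip_coord])
    then have "(LINT u|lborel. - (K u * u $ i)) = (LINT u|lborel. K (?T u) * ?T u $ i)" by simp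
    also have "\<dots> = (LINT u|lborel. K u * u $ i)"
      by (rule integral_lborel_distr_invariant[of ?T "\<lambda>u. K u * u $ i", OF lborel_distr_flip_coord]) measurable
    finally show ?thesis by simp
  qed
  have "(LINT u|lborel. K u * (u \<bullet> w)) = (LINT u|lborel. (\<Sum>i\<in>UNIV. w $ i * (K u * u $ i)))"
    by (simp add: inner_vec_def sum_distrib_left algebra_simps)
  also have "\<dots> = (\<Sum>i\<in>UNIV. w $ i * (LINT u|lborel. K u * u $ i))"
    by (subst Bochner_Integration.integral_sum)
       (auto intro!: integrable_mult_right integrable_compact_lipschitz_times[OF C] continuous_intros)
  finally show ?thesis by (simp add: coord)
qed

text \<open>The second moment of \<open>K\<close> in one coordinate, which by symmetry does not depend
on the coordinate.\<close>

definition kernel_variance :: "(real^'d \<Rightarrow> real) \<Rightarrow> real" where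
  "kernel_variance K = (LINT u|lborel. K u * (norm u)\<^sup>2) / real CARD('d)"

text \<open>The matrix of second moments is a multiple of the identity: flipping coordinate
\<open>i\<close> kills the entries off the diagonal and exchanging two coordinates identifies those on
it.  This is why mean shift follows the gradient of \<open>f\<close> itself, not its image under some
other matrix.\<close>

lemma kernel_second_moment:
  fixes K :: "real^'d \<Rightarrow> real"
  assumes K: "is_kernel K k" and C: "compact_lipschitz R C K"
  shows "(LINT u|lborel. K u * (u \<bullet> a) * (u \<bullet> b)) = kernel_variance K * (a \<bullet> b)"
proof -
  have [measurable]: "K \<in> borel_measurable borel" by (rule compact_lipschitz_measurable[OF C])
  define S where "S i j = (LINT u|lborel. K u * (u $ i * u $ j))" for i j
  have int: "integrable lborel (\<lambda>u. K u * (u $ i * u $ j))" for i j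
    by (intro integrable_compact_lipschitz_times[OF C] continuous_intros)
  have off: "S i j = 0" if "i \<noteq> j" for i j
  proof -
    let ?T = "\<lambda>x::real^'d. \<chi> k. if k = i then - x $ k else x $ k"
    have [measurable]: "?T \<in> borel_measurable borel" by (rule flip_coord_measurable)
    have "K (?T u) = K u" for u by (rule is_kernelD(4)[OF K norm_flip_coord])
    then have "(LINT u|lborel. - (K u * (u $ i * u $ j))) = (LINT u|lborel. K (?T u) * (?T u $ i * ?T u $ j))"
      using that by (simp add: eq_commute[of j i])
    also have "\<dots> = S i j" unfolding S_def
      by (rule integral_lborel_distr_invariant[of ?T "\<lambda>u. K u * (u $ i * u $ j)", OF lborel_distr_flip_coord]) measurable
    finally show ?thesis by (simp add: S_def)
  qed
  have diag: "S i i = S j j" for i j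
  proof -
    let ?T = "\<lambda>x::real^'d. \<chi> k. x $ (Transposition.transpose i j) k"
    have bij: "bij (Transposition.transpose i j)" by (rule bij_transpose)
    have [measurable]: "?T \<in> borel_measurable borel"
      by (intro borel_measurable_continuous_onI continuous_on_vec_lambda continuous_intros)
    have "K (?T u) = K u" for u by (rule is_kernelD(4)[OF K norm_permute_coords[OF bij]])
    then have "S j j = (LINT u|lborel. K (?T u) * (?T u $ i * ?T u $ i))"
      unfolding S_def by simp
    also have "\<dots> = S i i" unfolding S_def
      by (rule integral_lborel_distr_invariant[of ?T "\<lambda>u. K u * (u $ i * u $ i)", OF lborel_distr_permute_coords[OF bij]]) measurable
    finally show ?thesis by simp
  qed
  have "(LINT u|lborel. K u * (norm u)\<^sup>2) = (LINT u|lborel. (\<Sum>i\<in>UNIV. K u * (u $ i * u $ i)))"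
    by (simp add: power2_norm_eq_inner inner_vec_def sum_distrib_left)
  also have "\<dots> = (\<Sum>i\<in>UNIV. S i i)" unfolding S_def
    by (subst Bochner_Integration.integral_sum) (auto intro: int)
  also have "\<dots> = real CARD('d) * S j j" for j
  proof -
    have "(\<Sum>i\<in>UNIV. S i i) = (\<Sum>i::'d\<in>UNIV. S j j)" by (intro sum.cong refl diag)
    then show ?thesis by simp
  qed
  finally have tot: "(LINT u|lborel. K u * (norm u)\<^sup>2) = real CARD('d) * S j j" for j .
  have var: "S j j = kernel_variance K" for j
    by (simp add: kernel_variance_def tot[of j])
  have "(LINT u|lborel. K u * (u \<bullet> a) * (u \<bullet> b)) =
      (LINT u|lborel. (\<Sum>i\<in>UNIV. \<Sum>j\<in>UNIV. a $ i * b $ j * (K u * (u $ i * u $ j))))"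
  proof (intro Bochner_Integration.integral_cong refl)
    fix u :: "real^'d"
    have "K u * (u \<bullet> a) * (u \<bullet> b) = K u * (\<Sum>i\<in>UNIV. \<Sum>j\<in>UNIV. (u $ i * a $ i) * (u $ j * b $ j))"
      by (simp only: inner_vec_def inner_real_def sum_product mult.assoc)
    also have "\<dots> = (\<Sum>i\<in>UNIV. \<Sum>j\<in>UNIV. a $ i * b $ j * (K u * (u $ i * u $ j)))"
      unfolding sum_distrib_left by (intro sum.cong refl) (simp add: mult_ac)
    finally show "K u * (u \<bullet> a) * (u \<bullet> b) = (\<Sum>i\<in>UNIV. \<Sum>j\<in>UNIV. a $ i * b $ j * (K u * (u $ i * u $ j)))" .
  qed
  also have "\<dots> = (\<Sum>i\<in>UNIV. \<Sum>j\<in>UNIV. a $ i * b $ j * S i j)"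
    unfolding S_def
    by (subst Bochner_Integration.integral_sum, (intro Bochner_Integration.integrable_sum integrable_mult_right int),
        subst Bochner_Integration.integral_sum, (intro integrable_mult_right int), simp)
  also have "\<dots> = (\<Sum>i\<in>UNIV. a $ i * b $ i * kernel_variance K)"
  proof (intro sum.cong refl)
    fix i
    have "(\<Sum>j\<in>UNIV. a $ i * b $ j * S i j) = (\<Sum>j\<in>UNIV. if j = i then a $ i * b $ i * kernel_variance K else 0)"
      by (intro sum.cong) (auto simp: off var)
    then show "(\<Sum>j\<in>UNIV. a $ i * b $ j * S i j) = a $ i * b $ i * kernel_variance K" by simp
  qed
  finally show ?thesis by (simp add: inner_vec_def sum_distrib_left mult_ac)
qed

text \<open>Otherwise \<open>K\<close> would vanish almost everywhere, against its integral being
one.\<close>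

lemma kernel_variance_pos:
  fixes K :: "real^'d \<Rightarrow> real"
  assumes K: "is_kernel K k" and C: "compact_lipschitz R C K"
  shows "0 < kernel_variance K"
proof -
  have int: "integrable lborel (\<lambda>u. K u * (norm u)\<^sup>2)"
    by (intro integrable_compact_lipschitz_times[OF C] continuous_intros)
  have nn: "AE u in lborel. 0 \<le> K u * (norm u)\<^sup>2" using is_kernelD(1)[OF K] by simp
  have "(LINT u|lborel. K u * (norm u)\<^sup>2) \<noteq> 0"
  proof
    assume "(LINT u|lborel. K u * (norm u)\<^sup>2) = 0"
    then have "AE u in lborel. K u * (norm u)\<^sup>2 = 0"
      using integral_nonneg_eq_0_iff_AE[OF int nn] by simp
    moreover have "AE u in lborel. u \<noteq> (0::real^'d)" by (rule AE_lborel_singleton)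
    ultimately have "AE u in lborel. K u = 0" by eventually_elim auto
    then have "(LINT u|lborel. K u) = 0" by (rule integral_eq_zero_AE)
    then show False using is_kernelD(3)[OF K] by simp
  qed
  moreover have "0 \<le> (LINT u|lborel. K u * (norm u)\<^sup>2)" by (rule integral_nonneg_AE[OF nn])
  ultimately show ?thesis by (simp add: kernel_variance_def)
qed

lemma kernel_average_bound:
  fixes K e :: "real^'d \<Rightarrow> real"
  assumes K: "is_kernel K k" and C: "compact_lipschitz R C K" and e: "continuous_on UNIV e"
    and E: "\<And>u. norm u \<le> R \<Longrightarrow> \<bar>e u\<bar> \<le> E"
  shows "\<bar>LINT u|lborel. K u * e u\<bar> \<le> (E::real)"
proof -
  have "\<bar>LINT u|lborel. K u * e u\<bar> \<le> (LINT u|lborel. K u * E)"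
  proof (intro integral_abs_bound_integral integrable_compact_lipschitz_times[OF C] e continuous_intros)
    fix u show "\<bar>K u * e u\<bar> \<le> K u * E"
      using E[of u] compact_lipschitzD(3)[OF C, of u] is_kernelD(1)[OF K, of u]
      by (cases "norm u \<le> R") (auto simp: abs_mult mult_left_mono)
  qed
  also have "\<dots> = E" using is_kernelD(3)[OF K] by simp
  finally show ?thesis .
qed

lemma kernel_weighted_average_bound:
  fixes K e :: "real^'d \<Rightarrow> real"
  assumes K: "is_kernel K k" and C: "compact_lipschitz R C K" and e: "continuous_on UNIV e"
    and E: "\<And>u. norm u \<le> R \<Longrightarrow> \<bar>e u\<bar> \<le> E"
  shows "\<bar>LINT u|lborel. K u * (u \<bullet> w) * e u\<bar> \<le> R * E * norm w"
  unfolding mult.assoc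
proof (rule kernel_average_bound[OF K C])
  show "continuous_on UNIV (\<lambda>u. (u \<bullet> w) * e u)" by (intro continuous_intros e)
  fix u :: "real^'d" assume u: "norm u \<le> R"
  have "\<bar>u \<bullet> w\<bar> \<le> R * norm w"
    using Cauchy_Schwarz_ineq2[of u w] mult_right_mono[OF u norm_ge_zero[of w]] by linarith
  then have "\<bar>u \<bullet> w\<bar> * \<bar>e u\<bar> \<le> R * norm w * E"
    using E[OF u] compact_lipschitzD(1)[OF C] by (intro mult_mono) auto
  then show "\<bar>(u \<bullet> w) * e u\<bar> \<le> R * (E * norm w)" by (simp add: abs_mult algebra_simps)
qed

text \<open>The expectation of the kernel density estimate, after substituting \<open>z = x + h
u\<close>.\<close>

definition smoothed_density :: "(real^'d \<Rightarrow> real) \<Rightarrow> (real^'d \<Rightarrow> real) \<Rightarrow> real \<Rightarrow> real^'d \<Rightarrow> real" where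
  "smoothed_density K f h x = (LINT u|lborel. K u * f (x + h *\<^sub>R u))"

text \<open>The expectation of the gradient estimate, after substituting \<open>z = x + h u\<close>; it
approximates \<^term>\<open>kernel_variance K *\<^sub>R grad f x\<close>.\<close>

definition smoothed_gradient :: "(real^'d \<Rightarrow> real) \<Rightarrow> (real^'d \<Rightarrow> real) \<Rightarrow> real \<Rightarrow> real^'d \<Rightarrow> real^'d" where
  "smoothed_gradient K f h x = (\<chi> i. (LINT u|lborel. kernel_moment K i u * f (x + h *\<^sub>R u)) / h)"

lemma continuous_shift_scale:
  fixes f :: "real^'d \<Rightarrow> real"
  assumes "continuous_on UNIV f" shows "continuous_on UNIV (\<lambda>u. f (x + h *\<^sub>R u))"
  by (intro continuous_on_compose2[OF assms] continuous_intros) auto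

lemma smoothed_gradient_inner:
  fixes f :: "real^'d \<Rightarrow> real"
  assumes K: "is_kernel K k" and C: "compact_lipschitz R C K" and f: "continuous_on UNIV f"
  shows "smoothed_gradient K f h x \<bullet> w = (LINT u|lborel. K u * (u \<bullet> w) * f (x + h *\<^sub>R u)) / h"
proof -
  have "(LINT u|lborel. K u * (u \<bullet> w) * f (x + h *\<^sub>R u)) =
     (LINT u|lborel. (\<Sum>i\<in>UNIV. w $ i * (K u * (u $ i * f (x + h *\<^sub>R u)))))"
    by (intro Bochner_Integration.integral_cong refl)
       (simp add: inner_vec_def sum_distrib_left sum_distrib_right algebra_simps)
  also have "\<dots> = (\<Sum>i\<in>UNIV. w $ i * (LINT u|lborel. K u * (u $ i * f (x + h *\<^sub>R u))))"
    by (subst Bochner_Integration.integral_sum)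
       (auto intro!: integrable_mult_right integrable_compact_lipschitz_times[OF C] continuous_intros
          continuous_shift_scale f)
  finally show ?thesis
    by (simp add: smoothed_gradient_def inner_vec_def kernel_moment_def mult.assoc sum_divide_distrib mult.commute)
qed

lemma smoothed_density_bias:
  fixes f :: "real^'d \<Rightarrow> real"
  assumes K: "is_kernel K k" and C: "compact_lipschitz R C K" and f: "twice_differentiable f"
    and B: "\<And>x. norm (grad f x) \<le> B" and h: "0 < h"
  shows "\<bar>smoothed_density K f h x - f x\<bar> \<le> B * R * h"
proof -
  have B0: "0 \<le> B" using B[of 0] norm_ge_zero order_trans by blast
  have cont: "continuous_on UNIV f"
    by (rule twice_differentiable_continuous[OF f])
  have "smoothed_density K f h x - f x = (LINT u|lborel. K u * f (x + h *\<^sub>R u)) - (LINT u|lborel. K u * f x)"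
    using is_kernelD(3)[OF K] by (simp add: smoothed_density_def)
  also have "\<dots> = (LINT u|lborel. K u * (f (x + h *\<^sub>R u) - f x))"
    by (subst Bochner_Integration.integral_diff[symmetric])
       (auto intro!: integrable_compact_lipschitz_times[OF C] continuous_shift_scale cont
         Bochner_Integration.integral_cong is_kernelD(2)[OF K] simp: algebra_simps)
  also have "\<bar>\<dots>\<bar> \<le> B * R * h"
  proof (rule kernel_average_bound[OF K C])
    show "continuous_on UNIV (\<lambda>u. f (x + h *\<^sub>R u) - f x)" by (intro continuous_intros continuous_shift_scale cont)
    fix u :: "real^'d" assume u: "norm u \<le> R"
    have "\<bar>f (x + h *\<^sub>R u) - f x\<bar> \<le> B * norm (h *\<^sub>R u)"
      using lipschitz_of_bounded_grad[OF f B, of "x + h *\<^sub>R u" x] by simp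
    also have "\<dots> \<le> B * (h * R)" using u h B0 by (intro mult_left_mono) auto
    finally show "\<bar>f (x + h *\<^sub>R u) - f x\<bar> \<le> B * R * h" by (simp add: mult_ac)
  qed
  finally show ?thesis .
qed

lemma norm_le_of_inner_bound:
  fixes z :: "real^'d"
  assumes "\<And>w. \<bar>z \<bullet> w\<bar> \<le> E * norm w"
  shows "norm z \<le> E"
proof (cases "z = 0")
  case True
  then show ?thesis using assms[of "axis undefined 1"] by simp
next
  case False
  have "norm z * norm z \<le> E * norm z"
    using assms[of z] by (simp add: power2_norm_eq_inner[symmetric] power2_eq_square)
  then show ?thesis using False by simp
qed

text \<open>Expand \<open>f (x + h u)\<close> at \<open>x\<close>.  The constant term is annihilated by
the vanishing first moment of \<open>K\<close>, the linear term gives the gradient by the second moment,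
and the remainder is of order \<open>h\<^sup>2\<close> before the division by \<open>h\<close>.\<close>

lemma smoothed_gradient_bias:
  fixes f :: "real^'d \<Rightarrow> real"
  assumes K: "is_kernel K k" and C: "compact_lipschitz R C K" and f: "twice_differentiable f"
    and \<Lambda>: "\<And>x y. norm (grad f x - grad f y) \<le> \<Lambda> * norm (x - y)" and "0 \<le> \<Lambda>" and h: "0 < h"
  shows "norm (smoothed_gradient K f h x - kernel_variance K *\<^sub>R grad f x) \<le> \<Lambda> * R ^ 3 * h"
proof (rule norm_le_of_inner_bound)
  fix w :: "real^'d"
  have cont: "continuous_on UNIV f"
    by (rule twice_differentiable_continuous[OF f])
  note R = compact_lipschitzD(1)[OF C]
  have int: "integrable lborel (\<lambda>u. K u * (u \<bullet> w) * g u)" if "continuous_on UNIV g" for g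
    unfolding mult.assoc
    by (intro integrable_compact_lipschitz_times[OF C] continuous_intros that)
  define e where "e u = (f (x + h *\<^sub>R u) - f x - (h *\<^sub>R u) \<bullet> grad f x) / h" for u
  have e: "continuous_on UNIV e" unfolding e_def
    using h by (intro continuous_intros continuous_shift_scale cont) auto
  have "(LINT u|lborel. K u * (u \<bullet> w) * e u) =
     (LINT u|lborel. K u * (u \<bullet> w) * f (x + h *\<^sub>R u) / h - (f x / h) * (K u * (u \<bullet> w)) - K u * (u \<bullet> w) * (u \<bullet> grad f x))"
    using h by (intro Bochner_Integration.integral_cong refl) (simp add: e_def field_simps)
  also have "\<dots> = (LINT u|lborel. K u * (u \<bullet> w) * f (x + h *\<^sub>R u)) / h - (f x / h) * (LINT u|lborel. K u * (u \<bullet> w))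
      - (LINT u|lborel. K u * (u \<bullet> w) * (u \<bullet> grad f x))"
    using int[of "\<lambda>u. f (x + h *\<^sub>R u)"] int[of "\<lambda>_. 1"] int[of "\<lambda>u. u \<bullet> grad f x"] continuous_shift_scale[OF cont]
    by (subst Bochner_Integration.integral_diff, (intro Bochner_Integration.integrable_diff; simp add: continuous_intros), 
        simp add: continuous_intros)
       (subst Bochner_Integration.integral_diff, auto)
  also have "\<dots> = (smoothed_gradient K f h x - kernel_variance K *\<^sub>R grad f x) \<bullet> w"
    by (simp add: kernel_first_moment[OF K C] kernel_second_moment[OF K C] smoothed_gradient_inner[OF K C cont]
        inner_diff_left inner_commute[of w "grad f x"])
  finally have "\<bar>(smoothed_gradient K f h x - kernel_variance K *\<^sub>R grad f x) \<bullet> w\<bar> = \<bar>LINT u|lborel. K u * (u \<bullet> w) * e u\<bar>"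
    by simp
  also have "\<dots> \<le> R * (\<Lambda> * R\<^sup>2 * h) * norm w"
  proof (rule kernel_weighted_average_bound[OF K C e])
    fix u :: "real^'d" assume u: "norm u \<le> R"
    have "\<bar>e u\<bar> \<le> \<Lambda> * (norm (h *\<^sub>R u))\<^sup>2 / h"
      unfolding e_def abs_divide using first_order_taylor_bound[OF f \<Lambda>, of x "h *\<^sub>R u"] h
      by (simp add: divide_right_mono)
    also have "\<dots> = \<Lambda> * (norm u)\<^sup>2 * h" using h by (simp add: power2_eq_square)
    also have "\<dots> \<le> \<Lambda> * R\<^sup>2 * h"
      using u h \<open>0 \<le> \<Lambda>\<close> by (intro mult_right_mono mult_left_mono power_mono) auto
    finally show "\<bar>e u\<bar> \<le> \<Lambda> * R\<^sup>2 * h" .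
  qed
  finally show "\<bar>(smoothed_gradient K f h x - kernel_variance K *\<^sub>R grad f x) \<bullet> w\<bar> \<le> \<Lambda> * R ^ 3 * h * norm w"
    by (simp add: power2_eq_square power3_eq_cube mult_ac)
qed

text \<open>Subtracting the constant \<open>f x - f y\<close>, which the vanishing first moment of
\<open>K\<close> permits, turns the increment of \<open>f\<close> at \<open>x + h u\<close> and \<open>y
+ h u\<close> into a second difference with steps \<open>h u\<close> and \<open>x - y\<close>.  It is
thus a value of the Hessian, compared here with a fixed matrix \<open>A\<close>: the Hessian at the mode
gives strong monotonicity, and \<open>A = 0\<close> gives a Lipschitz bound.\<close>

lemma smoothed_gradient_increment:
  fixes f :: "real^'d \<Rightarrow> real" and A :: "real^'d^'d"
  assumes K: "is_kernel K k" and C: "compact_lipschitz R C K" and f: "twice_differentiable f"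
    and h: "0 < h" 
    and H: "\<And>\<xi>. dist \<xi> y \<le> h * R + norm (x - y) \<Longrightarrow> norm ((hessian f \<xi> - A) *v (x - y)) \<le> \<delta> * norm (x - y)"
  shows "norm (smoothed_gradient K f h x - smoothed_gradient K f h y - kernel_variance K *\<^sub>R (A *v (x - y)))
           \<le> R\<^sup>2 * \<delta> * norm (x - y)"
proof (rule norm_le_of_inner_bound)
  fix w :: "real^'d"
  have cont: "continuous_on UNIV f"
    by (rule twice_differentiable_continuous[OF f])
  note R = compact_lipschitzD(1)[OF C]
  have int: "integrable lborel (\<lambda>u. K u * (u \<bullet> w) * g u)" if "continuous_on UNIV g" for g
    unfolding mult.assoc
    by (intro integrable_compact_lipschitz_times[OF C] continuous_intros that)
  define e where "e u = (f (x + h *\<^sub>R u) - f (y + h *\<^sub>R u) - f x + f y) / h - u \<bullet> (A *v (x - y))" for u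
  have e: "continuous_on UNIV e" unfolding e_def
    using h by (intro continuous_intros continuous_shift_scale cont) auto
  have "(LINT u|lborel. K u * (u \<bullet> w) * e u) =
     (LINT u|lborel. K u * (u \<bullet> w) * f (x + h *\<^sub>R u) / h - K u * (u \<bullet> w) * f (y + h *\<^sub>R u) / h
       - ((f x - f y) / h) * (K u * (u \<bullet> w)) - K u * (u \<bullet> w) * (u \<bullet> (A *v (x - y))))"
    using h by (intro Bochner_Integration.integral_cong refl) (simp add: e_def field_simps)
  also have "\<dots> = (LINT u|lborel. K u * (u \<bullet> w) * f (x + h *\<^sub>R u)) / h - (LINT u|lborel. K u * (u \<bullet> w) * f (y + h *\<^sub>R u)) / h
      - ((f x - f y) / h) * (LINT u|lborel. K u * (u \<bullet> w))
      - (LINT u|lborel. K u * (u \<bullet> w) * (u \<bullet> (A *v (x - y))))"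
  proof -
    have "integrable lborel (\<lambda>u. K u * (u \<bullet> w) * f (x + h *\<^sub>R u) / h)"
      "integrable lborel (\<lambda>u. K u * (u \<bullet> w) * f (y + h *\<^sub>R u) / h)"
      "integrable lborel (\<lambda>u. (f x - f y) / h * (K u * (u \<bullet> w)))"
      "integrable lborel (\<lambda>u. K u * (u \<bullet> w) * (u \<bullet> (A *v (x - y))))"
      using int[of "\<lambda>u. f (x + h *\<^sub>R u)"] int[of "\<lambda>u. f (y + h *\<^sub>R u)"] int[of "\<lambda>_. 1"]
        int[of "\<lambda>u. u \<bullet> (A *v (x - y))"] continuous_shift_scale[OF cont]
        continuous_on_inner[OF continuous_on_id continuous_on_const, of UNIV "A *v (x - y)"]
      by auto
    then show ?thesis by simp
  qed
  also have "\<dots> = (smoothed_gradient K f h x - smoothed_gradient K f h y - kernel_variance K *\<^sub>R (A *v (x - y))) \<bullet> w"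
    by (simp add: kernel_first_moment[OF K C] kernel_second_moment[OF K C] smoothed_gradient_inner[OF K C cont]
        inner_diff_left inner_commute[of w "A *v (x - y)"])
  finally have "\<bar>(smoothed_gradient K f h x - smoothed_gradient K f h y - kernel_variance K *\<^sub>R (A *v (x - y))) \<bullet> w\<bar>
      = \<bar>LINT u|lborel. K u * (u \<bullet> w) * e u\<bar>"
    by simp
  also have "\<dots> \<le> R * (R * (\<delta> * norm (x - y))) * norm w"
  proof (rule kernel_weighted_average_bound[OF K C e])
    fix u :: "real^'d" assume u: "norm u \<le> R"
    obtain \<xi> where \<xi>: "dist \<xi> y \<le> norm (h *\<^sub>R u) + norm (x - y)"
      "f (y + h *\<^sub>R u + (x - y)) - f (y + h *\<^sub>R u) - f (y + (x - y)) + f y = h *\<^sub>R u \<bullet> (hessian f \<xi> *v (x - y))"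
      using second_difference[OF f, of y "h *\<^sub>R u" "x - y"] by blast
    have "dist \<xi> y \<le> h * R + norm (x - y)"
      using \<xi>(1) mult_left_mono[OF u less_imp_le[OF h]] unfolding norm_scaleR abs_of_pos[OF h] by linarith
    note H = H[OF this]
    have "e u = u \<bullet> ((hessian f \<xi> - A) *v (x - y))"
      using \<xi>(2) h by (simp add: e_def matrix_vector_mult_diff_rdistrib inner_diff_right add.commute field_simps)
    also have "\<bar>\<dots>\<bar> \<le> norm u * norm ((hessian f \<xi> - A) *v (x - y))" by (rule Cauchy_Schwarz_ineq2)
    also have "\<dots> \<le> R * (\<delta> * norm (x - y))" using u H R by (intro mult_mono) auto
    finally show "\<bar>e u\<bar> \<le> R * (\<delta> * norm (x - y))" .
  qed
  finally show "\<bar>(smoothed_gradient K f h x - smoothed_gradient K f h y - kernel_variance K *\<^sub>R (A *v (x - y))) \<bullet> w\<bar>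
      \<le> R\<^sup>2 * \<delta> * norm (x - y) * norm w"
    by (simp add: power2_eq_square mult_ac)
qed

section \<open>Uniform deviations of empirical averages\<close>

lemma exp_le_quadratic:
  fixes x :: real
  assumes "\<bar>x\<bar> \<le> 1"
  shows "exp x \<le> 1 + x + x\<^sup>2"
proof (cases "0 \<le> x")
  case True
  then show ?thesis using assms exp_bound by auto
next
  case False
  define y where "y = - x"
  have y: "0 \<le> y" using False by (simp add: y_def)
  have "(1 - y + y\<^sup>2) * (1 + y + y\<^sup>2 / 2) = 1 + (y ^ 2 + y ^ 3 + y ^ 4) / 2"
    by (simp add: field_simps power2_eq_square power3_eq_cube power4_eq_xxxx)
  then have "1 \<le> (1 - y + y\<^sup>2) * (1 + y + y\<^sup>2 / 2)"
    using y by simp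
  also have "\<dots> \<le> (1 - y + y\<^sup>2) * exp y"
  proof (intro mult_left_mono exp_lower_Taylor_quadratic y)
    have "y \<le> 1" using assms by (simp add: y_def)
    then show "0 \<le> 1 - y + y\<^sup>2" using zero_le_power2[of y] by linarith
  qed
  finally have "exp (- y) \<le> 1 - y + y\<^sup>2" by (simp add: exp_minus field_simps)
  then show ?thesis by (simp add: y_def)
qed

text \<open>For \<open>l b \<le> 1\<close> the inequality \<open>exp x \<le> 1 + x + x\<^sup>2\<close>
bounds the moment generating function by \<open>exp (l\<^sup>2 v)\<close>.  A bound by the variance is
essential: the terms to which it is applied have variance of order \<open>h ^ d\<close>, much less than
the square of their range, which would be all that Hoeffding's inequality sees.\<close>

lemma (in prob_space) chernoff_bound_centred:
  fixes Y :: "nat \<Rightarrow> 'a \<Rightarrow> real"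
  assumes indep: "indep_vars (\<lambda>_. borel) Y I" and fin: "finite I"
    and bound: "\<And>j \<omega>. j \<in> I \<Longrightarrow> \<bar>Y j \<omega>\<bar> \<le> b"
    and mean: "\<And>j. j \<in> I \<Longrightarrow> expectation (Y j) = 0"
    and var: "\<And>j. j \<in> I \<Longrightarrow> expectation (\<lambda>\<omega>. (Y j \<omega>)\<^sup>2) \<le> v"
    and l: "0 < l" "l * b \<le> 1"
  shows "prob {\<omega> \<in> space M. t \<le> (\<Sum>j\<in>I. Y j \<omega>)} \<le> exp (real (card I) * l\<^sup>2 * v - l * t)"
proof -
  have rv [measurable]: "random_variable borel (Y j)" if "j \<in> I" for j
    using indep that by (auto simp: indep_vars_def)
  have int: "integrable M (\<lambda>\<omega>. g (Y j \<omega>))" if "j \<in> I" "g \<in> borel_measurable borel" "\<And>y. \<bar>y\<bar> \<le> b \<Longrightarrow> \<bar>g y\<bar> \<le> B" 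
    for j g and B :: real
    using that bound rv[OF that(1)] by (intro integrable_const_bound[where B = B]) auto
  have intexp: "integrable M (\<lambda>\<omega>. exp (l * Y j \<omega>))" if "j \<in> I" for j
  proof (rule int[OF that])
    fix y assume "\<bar>y\<bar> \<le> b"
    then have "l * y \<le> l * b" using l(1) by (intro mult_left_mono) auto
    then show "\<bar>exp (l * y)\<bar> \<le> exp 1" using l(2) by simp
  qed simp
  have mgf: "expectation (\<lambda>\<omega>. exp (l * Y j \<omega>)) \<le> exp (l\<^sup>2 * v)" if j: "j \<in> I" for j
  proof -
    have i1: "integrable M (Y j)" using int[OF j, of "\<lambda>y. y" b] by simp
    have i2: "integrable M (\<lambda>\<omega>. (Y j \<omega>)\<^sup>2)"
      by (rule int[OF j, of _ "b\<^sup>2"]) (auto simp: abs_le_square_iff[symmetric] power2_le_iff_abs_le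
          intro: order_trans)
    have "expectation (\<lambda>\<omega>. exp (l * Y j \<omega>)) \<le> expectation (\<lambda>\<omega>. 1 + l * Y j \<omega> + l\<^sup>2 * (Y j \<omega>)\<^sup>2)"
    proof (intro integral_mono intexp j)
      show "integrable M (\<lambda>\<omega>. 1 + l * Y j \<omega> + l\<^sup>2 * (Y j \<omega>)\<^sup>2)" using i1 i2 by simp
      fix \<omega>
      have "\<bar>l * Y j \<omega>\<bar> \<le> l * b" using l(1) bound[OF j, of \<omega>] by (simp add: abs_mult)
      then have "\<bar>l * Y j \<omega>\<bar> \<le> 1" using l(2) by linarith
      from exp_le_quadratic[OF this]
      show "exp (l * Y j \<omega>) \<le> 1 + l * Y j \<omega> + l\<^sup>2 * (Y j \<omega>)\<^sup>2" by (simp add: power_mult_distrib)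
    qed
    also have "\<dots> = 1 + l\<^sup>2 * expectation (\<lambda>\<omega>. (Y j \<omega>)\<^sup>2)"
      using i1 i2 mean[OF j] by (simp add: prob_space)
    also have "\<dots> \<le> 1 + l\<^sup>2 * v" using var[OF j] by (intro add_left_mono mult_left_mono) auto
    also have "\<dots> \<le> exp (l\<^sup>2 * v)" by (rule exp_ge_add_one_self)
    finally show ?thesis .
  qed
  have indep': "indep_vars (\<lambda>_. borel) (\<lambda>j \<omega>. exp (l * Y j \<omega>)) I"
    by (rule indep_vars_compose2[OF indep]) simp
  have expsum: "exp (l * (\<Sum>j\<in>I. Y j \<omega>)) = (\<Prod>j\<in>I. exp (l * Y j \<omega>))" for \<omega>
    by (simp add: sum_distrib_left exp_sum fin)
  have intprod: "integrable M (\<lambda>\<omega>. exp (l * (\<Sum>j\<in>I. Y j \<omega>)))"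
    unfolding expsum by (rule indep_vars_integrable[OF fin indep' intexp])
  have "prob {\<omega> \<in> space M. t \<le> (\<Sum>j\<in>I. Y j \<omega>)}
      \<le> exp (- l * t) * (LINT \<omega>:space M|M. exp (l * (\<Sum>j\<in>I. Y j \<omega>)))"
    by (rule Chernoff_ineq_ge[OF l(1) _ sets.top], unfold set_integrable_def)
       (rule integrable_mult_indicator[OF sets.top intprod])
  also have "(LINT \<omega>:space M|M. exp (l * (\<Sum>j\<in>I. Y j \<omega>))) = expectation (\<lambda>\<omega>. exp (l * (\<Sum>j\<in>I. Y j \<omega>)))"
    by (rule set_integral_space[OF intprod])
  also have "\<dots> = (\<Prod>j\<in>I. expectation (\<lambda>\<omega>. exp (l * Y j \<omega>)))"
    unfolding expsum by (rule indep_vars_lebesgue_integral[OF fin indep' intexp])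
  also have "exp (- l * t) * \<dots> \<le> exp (- l * t) * (\<Prod>j\<in>I. exp (l\<^sup>2 * v))"
    by (intro mult_left_mono prod_mono) (auto intro: mgf)
  also have "(\<Prod>j\<in>I. exp (l\<^sup>2 * v)) = exp (real (card I) * (l\<^sup>2 * v))"
    by (simp add: exp_of_nat_mult)
  also have "exp (- l * t) * exp (real (card I) * (l\<^sup>2 * v)) = exp (real (card I) * l\<^sup>2 * v - l * t)"
    by (simp add: exp_add[symmetric] algebra_simps)
  finally show ?thesis .
qed

text \<open>Round every coordinate down to a multiple of \<open>s / d\<close>.\<close>

lemma finite_net_cball:
  fixes \<rho> s :: real
  assumes s: "0 < s" and \<rho>: "0 \<le> \<rho>"
  obtains F :: "(real^'d) set" where "finite F" "real (card F) \<le> (2 * (\<rho> * CARD('d) / s) + 3) ^ CARD('d)"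
    "\<And>x. norm x \<le> \<rho> \<Longrightarrow> \<exists>y\<in>F. dist x y \<le> s"
proof -
  define d where "d = real CARD('d)"
  have d: "0 < d" by (simp add: d_def)
  define m where "m = \<lfloor>\<rho> * d / s\<rfloor>"
  define F where "F = (\<lambda>p. (\<chi> i. of_int (p i) * (s / d))) ` (UNIV \<rightarrow>\<^sub>E {- (m + 1)..m + 1}) \<inter> (UNIV :: (real^'d) set)"
  define P where "P = ((UNIV::'d set) \<rightarrow>\<^sub>E {- (m + 1)..m + 1})"
  have m0: "0 \<le> m" using s \<rho> d by (simp add: m_def)
  have finP: "finite P" unfolding P_def by (intro finite_PiE) auto
  have F: "F = (\<lambda>p. (\<chi> i. of_int (p i) * (s / d))) ` P" by (simp add: F_def P_def)
  show ?thesis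
  proof (rule that[of F])
    show "finite F" using finP by (simp add: F)
    have "card F \<le> card P" unfolding F by (rule card_image_le[OF finP])
    also have "card P = nat (2 * m + 3) ^ CARD('d)"
      unfolding P_def by (subst card_PiE) (auto simp: algebra_simps)
    finally have "real (card F) \<le> real (nat (2 * m + 3)) ^ CARD('d)"
      by (metis of_nat_le_iff of_nat_power)
    also have "\<dots> \<le> (2 * (\<rho> * CARD('d) / s) + 3) ^ CARD('d)"
    proof (rule power_mono)
      have "real_of_int m \<le> \<rho> * d / s" by (simp add: m_def)
      then show "real (nat (2 * m + 3)) \<le> 2 * (\<rho> * CARD('d) / s) + 3" using m0 by (simp add: d_def)
    qed simp
    finally show "real (card F) \<le> (2 * (\<rho> * CARD('d) / s) + 3) ^ CARD('d)" .
    fix x :: "real^'d" assume x: "norm x \<le> \<rho>"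
    define p where "p i = \<lfloor>x $ i * d / s\<rfloor>" for i
    have "p i \<in> {- (m + 1)..m + 1}" for i
    proof -
      have "\<bar>x $ i\<bar> \<le> \<rho>" using component_le_norm_cart[of x i] x by linarith
      then have le: "\<bar>x $ i * d / s\<bar> \<le> \<rho> * d / s"
        using s d by (simp add: abs_mult divide_right_mono mult_right_mono)
      have "p i \<le> m" unfolding p_def m_def using le by (intro floor_mono) linarith
      moreover have "- (m + 1) \<le> p i"
      proof -
        have "\<rho> * d / s < of_int (m + 1)" unfolding m_def by linarith
        then have "- (of_int m + 1) \<le> x $ i * d / s" using abs_ge_minus_self[of "x $ i * d / s"] le by simp
        then show ?thesis unfolding p_def by (simp add: le_floor_iff)
      qed
      ultimately show ?thesis by simp
    qed
    then have "p \<in> P" by (auto simp: P_def)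
    define y where "y = (\<chi> i. of_int (p i) * (s / d))"
    have "y \<in> F" using \<open>p \<in> P\<close> by (auto simp: F y_def)
    have "norm (x - y) \<le> (\<Sum>i\<in>UNIV. \<bar>(x - y) $ i\<bar>)" by (rule norm_le_l1_cart)
    also have "\<dots> \<le> (\<Sum>i::'d\<in>UNIV. s / d)"
    proof (rule sum_mono)
      fix i
      have "(x - y) $ i = (x $ i * d / s - of_int (p i)) * (s / d)"
        using s d by (simp add: y_def field_simps)
      also have "\<bar>\<dots>\<bar> \<le> 1 * (s / d)"
        unfolding abs_mult using s d by (intro mult_mono) (auto simp: p_def abs_le_iff, linarith)
      finally show "\<bar>(x - y) $ i\<bar> \<le> s / d" by simp
    qed
    also have "\<dots> = s" using d by (simp add: d_def)
    finally show "\<exists>y\<in>F. dist x y \<le> s" using \<open>y \<in> F\<close> by (auto simp: dist_norm)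
  qed
qed

text \<open>The average over the sample minus its expectation under the density \<open>f\<close>,
without normalization by powers of \<open>h\<close>, so that one estimate serves functions that are
normalized by different powers.\<close>

definition empirical_deviation ::
    "(real^'d \<Rightarrow> real) \<Rightarrow> (real^'d \<Rightarrow> real) \<Rightarrow> real \<Rightarrow> nat \<Rightarrow> (nat \<Rightarrow> real^'d) \<Rightarrow> real^'d \<Rightarrow> real" where
  "empirical_deviation f \<phi> h n X x =
     (\<Sum>j=1..n. \<phi> ((X j - x) /\<^sub>R h)) / real n - (LINT z|lborel. f z * \<phi> ((z - x) /\<^sub>R h))"

lemma integrable_density_times_bounded:
  fixes f g :: "real^'d \<Rightarrow> real"
  assumes f: "probability_density f" and g: "g \<in> borel_measurable borel" "\<And>x. \<bar>g x\<bar> \<le> C"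
  shows "integrable lborel (\<lambda>z. f z * g z)"
proof (rule Bochner_Integration.integrable_bound)
  show "integrable lborel (\<lambda>z. f z * C)" using f by (simp add: probability_density_def)
  have "f \<in> borel_measurable lborel" using f unfolding probability_density_def by (blast intro: borel_measurable_integrable)
  then show "(\<lambda>z. f z * g z) \<in> borel_measurable lborel" using g by simp
  show "AE z in lborel. norm (f z * g z) \<le> norm (f z * C)"
  proof (rule AE_I2)
    fix z
    have "\<bar>g z\<bar> \<le> \<bar>C\<bar>" using g(2)[of z] by linarith
    then show "norm (f z * g z) \<le> norm (f z * C)" by (simp add: abs_mult mult_left_mono)
  qed
qed

lemma density_average_le:
  fixes f g :: "real^'d \<Rightarrow> real"
  assumes f: "probability_density f" and g: "g \<in> borel_measurable borel" "\<And>x. \<bar>g x\<bar> \<le> C"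
  shows "\<bar>LINT z|lborel. f z * g z\<bar> \<le> C"
proof -
  have "\<bar>LINT z|lborel. f z * g z\<bar> \<le> (LINT z|lborel. f z * C)"
  proof (rule integral_abs_bound_integral[OF integrable_density_times_bounded[OF f g]])
    show "integrable lborel (\<lambda>z. f z * C)" using f by (simp add: probability_density_def)
    show "\<bar>f z * g z\<bar> \<le> f z * C" for z
      using g(2)[of z] f by (simp add: abs_mult mult_left_mono probability_density_def)
  qed
  also have "\<dots> = C" using f by (simp add: probability_density_def)
  finally show ?thesis .
qed

lemma shifted_scaled_measurable [measurable]:
  fixes \<phi> :: "real^'d \<Rightarrow> real"
  assumes "\<phi> \<in> borel_measurable borel"
  shows "(\<lambda>z. \<phi> ((z - x) /\<^sub>R h)) \<in> borel_measurable borel"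
  by (rule measurable_compose[OF _ assms]) measurable

lemma empirical_deviation_lipschitz:
  fixes f \<phi> :: "real^'d \<Rightarrow> real"
  assumes f: "probability_density f" and \<phi>: "compact_lipschitz R C \<phi>" and h: "0 < h" and n: "0 < n"
  shows "\<bar>empirical_deviation f \<phi> h n X x - empirical_deviation f \<phi> h n X y\<bar> \<le> 2 * C / h * norm (x - y)"
proof -
  note D = compact_lipschitzD[OF \<phi>]
  have [measurable]: "\<phi> \<in> borel_measurable borel" by (rule compact_lipschitz_measurable[OF \<phi>])
  define g where "g z = \<phi> ((z - x) /\<^sub>R h) - \<phi> ((z - y) /\<^sub>R h)" for z
  have [measurable]: "g \<in> borel_measurable borel" unfolding g_def by measurable
  have g: "\<bar>g z\<bar> \<le> C / h * norm (x - y)" for z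
  proof -
    have "\<bar>g z\<bar> \<le> C * norm ((z - x) /\<^sub>R h - (z - y) /\<^sub>R h)" unfolding g_def by (rule D(5))
    also have "(z - x) /\<^sub>R h - (z - y) /\<^sub>R h = (y - x) /\<^sub>R h" by (simp add: algebra_simps)
    finally show ?thesis using h by (simp add: norm_minus_commute divide_inverse mult_ac)
  qed
  have int: "integrable lborel (\<lambda>z. f z * \<phi> ((z - x) /\<^sub>R h))" for x
    by (rule integrable_density_times_bounded[OF f _ D(4)]) measurable
  have "empirical_deviation f \<phi> h n X x - empirical_deviation f \<phi> h n X y
      = (\<Sum>j=1..n. g (X j)) / real n - (LINT z|lborel. f z * g z)"
    using int by (simp add: empirical_deviation_def g_def sum_subtractf diff_divide_distrib right_diff_distrib)
  also have "\<bar>\<dots>\<bar> \<le> \<bar>(\<Sum>j=1..n. g (X j)) / real n\<bar> + \<bar>LINT z|lborel. f z * g z\<bar>"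
    by (rule abs_triangle_ineq4)
  also have "\<bar>(\<Sum>j=1..n. g (X j)) / real n\<bar> \<le> C / h * norm (x - y)"
  proof -
    have "\<bar>\<Sum>j=1..n. g (X j)\<bar> \<le> (\<Sum>j=1..n. C / h * norm (x - y))"
      by (rule order_trans[OF sum_abs sum_mono]) (rule g)
    then show ?thesis using n by (simp add: abs_divide divide_le_eq mult_ac)
  qed
  also have "\<bar>LINT z|lborel. f z * g z\<bar> \<le> C / h * norm (x - y)"
    by (rule density_average_le[OF f _ g]) simp
  finally show ?thesis by simp
qed

text \<open>The integrand is supported in a ball of radius \<open>h R\<close>, which has volume of order
\<open>h ^ d\<close>.\<close>

lemma scaled_second_moment_le:
  fixes f \<phi> :: "real^'d \<Rightarrow> real"
  assumes f: "probability_density f" and B: "\<And>x. f x \<le> B" and \<phi>: "compact_lipschitz R C \<phi>" and h: "0 < h"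
  shows "(LINT z|lborel. f z * (\<phi> ((z - x) /\<^sub>R h))\<^sup>2) \<le> B * C\<^sup>2 * (unit_ball_vol (real CARD('d)) * R ^ CARD('d)) * h ^ CARD('d)"
proof -
  note D = compact_lipschitzD[OF \<phi>]
  have [measurable]: "\<phi> \<in> borel_measurable borel" by (rule compact_lipschitz_measurable[OF \<phi>])
  have f0: "0 \<le> f z" for z using f by (simp add: probability_density_def)
  have B0: "0 \<le> B" using f0[of 0] B[of 0] by linarith
  have sq: "(\<phi> u)\<^sup>2 \<le> C\<^sup>2" for u using D(2) D(4)[of u] by (intro abs_le_square_iff[THEN iffD1]) auto
  have int1: "integrable lborel (\<lambda>z. f z * (\<phi> ((z - x) /\<^sub>R h))\<^sup>2)"
    by (rule integrable_density_times_bounded[OF f, where C = "C\<^sup>2"]) (auto simp: sq)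
  have "(LINT z|lborel. f z * (\<phi> ((z - x) /\<^sub>R h))\<^sup>2) \<le> (LINT z|lborel. B * C\<^sup>2 * indicator (cball x (h * R)) z)"
  proof (rule integral_mono[OF int1])
    show "integrable lborel (\<lambda>z. B * C\<^sup>2 * indicator (cball x (h * R)) z)"
      by (intro integrable_mult_right integrable_real_indicator) (use emeasure_bounded_finite[OF bounded_cball, of x "h * R"] in auto)
    fix z
    show "f z * (\<phi> ((z - x) /\<^sub>R h))\<^sup>2 \<le> B * C\<^sup>2 * indicator (cball x (h * R)) z"
    proof (cases "z \<in> cball x (h * R)")
      case True
      then show ?thesis using B[of z] sq B0 by (auto intro!: mult_mono)
    next
      case False
      have "norm ((z - x) /\<^sub>R h) = norm (z - x) / h" using h by (simp add: divide_inverse mult.commute)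
      then have "R < norm ((z - x) /\<^sub>R h)"
        using h False by (simp add: dist_norm norm_minus_commute pos_less_divide_eq mult.commute)
      then show ?thesis using D(3) False by simp
    qed
  qed
  also have "\<dots> = B * C\<^sup>2 * measure lborel (cball x (h * R))" by simp
  also have "measure lborel (cball x (h * R)) = unit_ball_vol (real CARD('d)) * (h * R) ^ CARD('d)"
    using h D(1) by (subst content_cball) auto
  finally show ?thesis by (simp add: power_mult_distrib mult_ac)
qed

lemma compact_lipschitz_uminus:
  assumes "compact_lipschitz R C \<phi>"
  shows "compact_lipschitz R C (\<lambda>x. - \<phi> x)"
  using assms unfolding compact_lipschitz_def by (auto simp: abs_minus_commute)

lemma empirical_deviation_uminus:
  "empirical_deviation f (\<lambda>x. - \<phi> x) h n X x = - empirical_deviation f \<phi> h n X x"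
  by (simp add: empirical_deviation_def sum_negf)

lemma empirical_deviation_measurable:
  assumes \<phi>: "\<phi> \<in> borel_measurable borel"
    and X: "\<And>j. 1 \<le> j \<Longrightarrow> X j \<in> M \<rightarrow>\<^sub>M borel"
  shows "(\<lambda>\<omega>. empirical_deviation f \<phi> h n (\<lambda>j. X j \<omega>) x) \<in> borel_measurable M"
proof -
  have [measurable]: "X j \<in> M \<rightarrow>\<^sub>M borel" if "j \<in> {1..n}" for j using X that by simp
  have [measurable]: "(\<lambda>\<omega>. \<phi> ((X j \<omega> - x) /\<^sub>R h)) \<in> borel_measurable M" if "j \<in> {1..n}" for j
    by (rule measurable_compose[OF _ shifted_scaled_measurable[OF \<phi>]]) (use that in measurable)
  show ?thesis unfolding empirical_deviation_def by measurable
qed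

context prob_space
begin

text \<open>The Chernoff bound with parameter \<open>l = a h\<^sup>2\<close>: both terms of the exponent
become multiples of \<open>n h ^ (d + 4)\<close>, and a small \<open>a\<close> makes the linear one
prevail.\<close>

lemma empirical_deviation_upper_tail:
  fixes f \<phi> :: "real^'d \<Rightarrow> real" and X :: "nat \<Rightarrow> 'a \<Rightarrow> real^'d"
  assumes f: "probability_density f" and B: "\<And>x. f x \<le> B" and \<phi>: "compact_lipschitz R C \<phi>"
    and indep: "indep_vars (\<lambda>_. borel) X {1..}"
    and law: "\<And>j. j \<ge> 1 \<Longrightarrow> distributed M lborel (X j) (\<lambda>x. ennreal (f x))"
    and h: "0 < h" and n: "0 < n" and a: "0 < a" "a * h\<^sup>2 * (2 * C) \<le> 1"
  defines "V \<equiv> B * C\<^sup>2 * (unit_ball_vol (real CARD('d)) * R ^ CARD('d))"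
  shows "prob {\<omega> \<in> space M. \<theta> * h ^ (CARD('d) + 2) \<le> empirical_deviation f \<phi> h n (\<lambda>j. X j \<omega>) x}
     \<le> exp (- (real n * h ^ (CARD('d) + 4) * (a * \<theta> - a\<^sup>2 * V)))"
proof -
  note D = compact_lipschitzD[OF \<phi>]
  have \<phi>m [measurable]: "\<phi> \<in> borel_measurable borel" by (rule compact_lipschitz_measurable[OF \<phi>])
  define g where "g z = \<phi> ((z - x) /\<^sub>R h)" for z
  define \<mu> where "\<mu> = (LINT z|lborel. f z * g z)"
  have gm [measurable]: "g \<in> borel_measurable borel" unfolding g_def by measurable
  have gb: "\<bar>g z\<bar> \<le> C" for z unfolding g_def by (rule D(4))
  have f0: "0 \<le> f z" for z using f by (simp add: probability_density_def)
  have \<mu>: "\<bar>\<mu>\<bar> \<le> C" unfolding \<mu>_def by (rule density_average_le[OF f gm gb])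
  have E: "expectation (\<lambda>\<omega>. w (X j \<omega>)) = (LINT z|lborel. f z * w z)"
    if "1 \<le> j" "w \<in> borel_measurable borel" for j and w :: "real^'d \<Rightarrow> real"
    using distributed_integral[OF law[OF that(1)], of w] that(2) f0 by simp
  have Xm: "X j \<in> M \<rightarrow>\<^sub>M borel" if "1 \<le> j" for j
    using distributed_measurable[OF law[OF that]] by simp
  define Y where "Y j \<omega> = g (X j \<omega>) - \<mu>" for j \<omega>
  have Yi: "indep_vars (\<lambda>_. borel) Y {1..n}"
    unfolding Y_def
    by (rule indep_vars_compose2[OF indep_vars_subset[OF indep]]) auto
  have int: "integrable M (\<lambda>\<omega>. w (X j \<omega>))" if "1 \<le> j" "w \<in> borel_measurable borel" "\<And>z. \<bar>w z\<bar> \<le> b" 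
    for j b and w :: "real^'d \<Rightarrow> real"
    using that Xm[OF that(1)] by (intro integrable_const_bound[where B = b]) auto
  have g2: "(g z)\<^sup>2 \<le> C\<^sup>2" for z using D(2) gb[of z] by (intro abs_le_square_iff[THEN iffD1]) auto
  have mean: "expectation (Y j) = 0" if "j \<in> {1..n}" for j
    using int[OF _ gm gb, of j] E[OF _ gm, of j] that by (simp add: Y_def[abs_def] \<mu>_def prob_space)
  have var: "expectation (\<lambda>\<omega>. (Y j \<omega>)\<^sup>2) \<le> V * h ^ CARD('d)" if j: "j \<in> {1..n}" for j
  proof -
    have "1 \<le> j" using j by simp
    have i1: "integrable M (\<lambda>\<omega>. g (X j \<omega>))" by (rule int[OF \<open>1 \<le> j\<close> gm gb])
    have i2: "integrable M (\<lambda>\<omega>. (g (X j \<omega>))\<^sup>2)"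
    proof (rule int[OF \<open>1 \<le> j\<close>])
      show "\<bar>(g z)\<^sup>2\<bar> \<le> C\<^sup>2" for z using g2 by simp
    qed measurable
    have "expectation (\<lambda>\<omega>. (Y j \<omega>)\<^sup>2) = expectation (\<lambda>\<omega>. (g (X j \<omega>))\<^sup>2 - (2 * \<mu>) * g (X j \<omega>) + \<mu>\<^sup>2)"
      by (simp add: Y_def power2_eq_square algebra_simps)
    also have "\<dots> = expectation (\<lambda>\<omega>. (g (X j \<omega>))\<^sup>2) - \<mu>\<^sup>2"
      using i1 i2 E[OF \<open>1 \<le> j\<close> gm] by (simp add: prob_space \<mu>_def[symmetric] power2_eq_square)
    also have "\<dots> \<le> expectation (\<lambda>\<omega>. (g (X j \<omega>))\<^sup>2)" by simp
    also have "\<dots> = (LINT z|lborel. f z * (g z)\<^sup>2)" by (rule E[OF \<open>1 \<le> j\<close>]) measurable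
    also have "\<dots> \<le> V * h ^ CARD('d)" unfolding g_def V_def by (rule scaled_second_moment_le[OF f B \<phi> h])
    finally show ?thesis .
  qed
  have "\<theta> * h ^ (CARD('d) + 2) \<le> empirical_deviation f \<phi> h n (\<lambda>j. X j \<omega>) x \<longleftrightarrow>
      real n * (\<theta> * h ^ (CARD('d) + 2)) \<le> (\<Sum>j=1..n. Y j \<omega>)" for \<omega>
  proof -
    have "empirical_deviation f \<phi> h n (\<lambda>j. X j \<omega>) x = (\<Sum>j=1..n. g (X j \<omega>)) / real n - \<mu>"
      by (simp only: empirical_deviation_def g_def \<mu>_def)
    moreover have "(\<Sum>j=1..n. Y j \<omega>) = (\<Sum>j=1..n. g (X j \<omega>)) - real n * \<mu>"
      by (simp add: Y_def sum_subtractf)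
    ultimately have "(\<Sum>j=1..n. Y j \<omega>) = real n * empirical_deviation f \<phi> h n (\<lambda>j. X j \<omega>) x"
      using n by (simp add: right_diff_distrib)
    then show ?thesis using n by simp
  qed
  then have "prob {\<omega> \<in> space M. \<theta> * h ^ (CARD('d) + 2) \<le> empirical_deviation f \<phi> h n (\<lambda>j. X j \<omega>) x}
     = prob {\<omega> \<in> space M. real n * (\<theta> * h ^ (CARD('d) + 2)) \<le> (\<Sum>j=1..n. Y j \<omega>)}" by simp
  also have "\<dots> \<le> exp (real (card {1..n}) * (a * h\<^sup>2)\<^sup>2 * (V * h ^ CARD('d)) - a * h\<^sup>2 * (real n * (\<theta> * h ^ (CARD('d) + 2))))"
  proof (rule chernoff_bound_centred[OF Yi _ _ mean var])
    show "\<bar>Y j \<omega>\<bar> \<le> 2 * C" for j \<omega> using gb[of "X j \<omega>"] \<mu> unfolding Y_def by linarith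
    show "0 < a * h\<^sup>2" using a h by simp
    show "a * h\<^sup>2 * (2 * C) \<le> 1" by (rule a)
  qed auto
  also have "real (card {1..n}) * (a * h\<^sup>2)\<^sup>2 * (V * h ^ CARD('d)) - a * h\<^sup>2 * (real n * (\<theta> * h ^ (CARD('d) + 2)))
      = - (real n * h ^ (CARD('d) + 4) * (a * \<theta> - a\<^sup>2 * V))"
    by (simp add: power_add power2_eq_square power4_eq_xxxx algebra_simps)
  finally show ?thesis .
qed

lemma empirical_deviation_tail:
  fixes f \<phi> :: "real^'d \<Rightarrow> real" and X :: "nat \<Rightarrow> 'a \<Rightarrow> real^'d"
  assumes f: "probability_density f" and B: "\<And>x. f x \<le> B" and \<phi>: "compact_lipschitz R C \<phi>"
    and indep: "indep_vars (\<lambda>_. borel) X {1..}"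
    and law: "\<And>j. j \<ge> 1 \<Longrightarrow> distributed M lborel (X j) (\<lambda>x. ennreal (f x))"
    and h: "0 < h" and n: "0 < n" and a: "0 < a" "a * h\<^sup>2 * (2 * C) \<le> 1"
  defines "V \<equiv> B * C\<^sup>2 * (unit_ball_vol (real CARD('d)) * R ^ CARD('d))"
  shows "prob {\<omega> \<in> space M. \<theta> * h ^ (CARD('d) + 2) \<le> \<bar>empirical_deviation f \<phi> h n (\<lambda>j. X j \<omega>) x\<bar>}
     \<le> 2 * exp (- (real n * h ^ (CARD('d) + 4) * (a * \<theta> - a\<^sup>2 * V)))"
proof -
  let ?t = "\<theta> * h ^ (CARD('d) + 2)"
  let ?D = "\<lambda>\<omega>. empirical_deviation f \<phi> h n (\<lambda>j. X j \<omega>) x"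
  have [measurable]: "?D \<in> borel_measurable M"
    using distributed_measurable[OF law]
    by (intro empirical_deviation_measurable compact_lipschitz_measurable[OF \<phi>]) simp
  have "prob {\<omega> \<in> space M. ?t \<le> \<bar>?D \<omega>\<bar>} \<le> prob ({\<omega> \<in> space M. ?t \<le> ?D \<omega>} \<union> {\<omega> \<in> space M. ?t \<le> - ?D \<omega>})"
    by (intro finite_measure_mono) auto
  also have "\<dots> \<le> prob {\<omega> \<in> space M. ?t \<le> ?D \<omega>} + prob {\<omega> \<in> space M. ?t \<le> - ?D \<omega>}"
    by (intro measure_Un_le) auto
  also have "\<dots> \<le> exp (- (real n * h ^ (CARD('d) + 4) * (a * \<theta> - a\<^sup>2 * V))) + exp (- (real n * h ^ (CARD('d) + 4) * (a * \<theta> - a\<^sup>2 * V)))"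
    unfolding V_def
    using empirical_deviation_upper_tail[OF f B \<phi> indep law h n a, of \<theta> x]
      empirical_deviation_upper_tail[OF f B compact_lipschitz_uminus[OF \<phi>] indep law h n a, of \<theta> x]
    by (intro add_mono) (auto simp: empirical_deviation_uminus)
  finally show ?thesis by simp
qed

end

text \<open>For \<open>n \<ge> 3\<close> the logarithm is at least one, so that the rate also bounds
\<open>n h ^ p\<close> from below.\<close>

lemma log_rate_consequences:
  fixes h :: "nat \<Rightarrow> real"
  assumes pos: "\<And>n. h n > 0" and rate: "(\<lambda>n. ln (real n) / (real n * h n ^ p)) \<longlonglongrightarrow> 0" and c: "0 < c"
  shows "\<forall>\<^sub>F n in sequentially. c * ln (real n) \<le> real n * h n ^ p \<and> 1 \<le> real n * h n ^ p"
proof -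
  define q where "q = min 1 (1 / c)"
  have "0 < q" using c by (simp add: q_def)
  with rate have "\<forall>\<^sub>F n in sequentially. ln (real n) / (real n * h n ^ p) < q"
    by (rule order_tendstoD(2))
  with eventually_ge_at_top[of 3] show ?thesis
  proof eventually_elim
    case (elim n)
    have P: "0 < real n * h n ^ p" using elim pos[of n] by simp
    have le: "ln (real n) \<le> q * (real n * h n ^ p)" using elim P by (simp add: divide_less_eq less_imp_le)
    have "exp 1 \<le> real n" using exp_le elim by linarith
    then have ln1: "1 \<le> ln (real n)" using elim by (subst ln_ge_iff) auto
    have "q * (real n * h n ^ p) \<le> 1 * (real n * h n ^ p)" using P by (intro mult_right_mono) (auto simp: q_def)
    then have one: "1 \<le> real n * h n ^ p" using le ln1 by linarith
    have "c * ln (real n) \<le> c * (q * (real n * h n ^ p))" using le c by (intro mult_left_mono) auto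
    also have "\<dots> \<le> c * (1 / c * (real n * h n ^ p))" using P c by (intro mult_left_mono mult_right_mono) (auto simp: q_def)
    also have "\<dots> = real n * h n ^ p" using c by simp
    finally show ?case using one by simp
  qed
qed

context prob_space
begin

text \<open>A union bound over a net of mesh \<open>s n\<close>, chosen such that between neighbouring
points the Lipschitz bound \<open>2 C / h\<close> costs only half of the admissible deviation.  The net
has at most \<open>(C2 n) ^ d\<close> points because \<open>h ^ (d + 3) \<ge> 1 / n\<close> eventually,
whereas each point fails with probability at most \<open>2 / n ^ (d + 1)\<close>.\<close>

lemma empirical_deviation_uniform:
  fixes f \<phi> :: "real^'d \<Rightarrow> real" and X :: "nat \<Rightarrow> 'a \<Rightarrow> real^'d"
  assumes f: "probability_density f" and B: "\<And>x. f x \<le> B" and \<phi>: "compact_lipschitz R C \<phi>"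
    and indep: "indep_vars (\<lambda>_. borel) X {1..}"
    and law: "\<And>j. j \<ge> 1 \<Longrightarrow> distributed M lborel (X j) (\<lambda>x. ennreal (f x))"
    and h_pos: "\<And>n. h n > 0" and h_lim: "h \<longlonglongrightarrow> 0"
    and h_rate: "(\<lambda>n. ln (real n) / (real n * h n ^ (CARD('d) + 4))) \<longlonglongrightarrow> 0"
    and \<theta>: "0 < \<theta>" and \<rho>: "0 \<le> \<rho>"
  shows "\<exists>G. (\<forall>n. G n \<in> events) \<and> (\<lambda>n. prob (G n)) \<longlonglongrightarrow> 1 \<and>
    (\<forall>n \<omega> x. 0 < n \<longrightarrow> \<omega> \<in> G n \<longrightarrow> norm x \<le> \<rho> \<longrightarrow>
        \<bar>empirical_deviation f \<phi> (h n) n (\<lambda>j. X j \<omega>) x\<bar> \<le> \<theta> * h n ^ (CARD('d) + 2))"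
proof -
  note D = compact_lipschitzD[OF \<phi>]
  define d where "d = CARD('d)"
  define V where "V = B * C\<^sup>2 * (unit_ball_vol (real CARD('d)) * R ^ CARD('d))"
  have f0: "0 \<le> f z" for z using f by (simp add: probability_density_def)
  have V: "0 \<le> V" using f0[of 0] B[of 0] D(1) by (auto simp: V_def intro!: mult_nonneg_nonneg)
  \<comment> \<open>the first bound is the range condition of the Chernoff bound, the second keeps the quadratic term of the exponent below half of the linear one\<close>
  define a where "a = min (1 / (2 * C)) (\<theta> / (4 * (V + 1)))"
  have a: "0 < a" using D(2) \<theta> V by (simp add: a_def)
  define \<kappa> where "\<kappa> = a * \<theta> / 4"
  have \<kappa>: "0 < \<kappa>" using a \<theta> by (simp add: \<kappa>_def)
  have \<kappa>_le: "\<kappa> \<le> a * (\<theta> / 2) - a\<^sup>2 * V"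
  proof -
    have "a * V \<le> \<theta> / (4 * (V + 1)) * V" using V by (intro mult_right_mono) (auto simp: a_def)
    also have "\<dots> \<le> \<theta> / 4" using V \<theta> by (simp add: field_simps)
    finally have "a * (a * V) \<le> a * (\<theta> / 4)" using a by (intro mult_left_mono) auto
    then show ?thesis by (simp add: \<kappa>_def power2_eq_square mult_ac)
  qed
  define s where "s n = \<theta> * h n ^ (d + 3) / (4 * C)" for n
  have s: "0 < s n" for n using h_pos \<theta> D(2) by (simp add: s_def)
  have "\<exists>F. finite F \<and> real (card F) \<le> (2 * (\<rho> * CARD('d) / s n) + 3) ^ CARD('d) \<and>
      (\<forall>x::real^'d. norm x \<le> \<rho> \<longrightarrow> (\<exists>y\<in>F. dist x y \<le> s n))" for n
    using finite_net_cball[OF s \<rho>] by metis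
  then obtain F :: "nat \<Rightarrow> (real^'d) set" where F: "\<And>n. finite (F n)"
    "\<And>n. real (card (F n)) \<le> (2 * (\<rho> * CARD('d) / s n) + 3) ^ CARD('d)"
    "\<And>n x. norm x \<le> \<rho> \<Longrightarrow> \<exists>y\<in>F n. dist x y \<le> s n" by metis
  let ?D = "\<lambda>n x \<omega>. empirical_deviation f \<phi> (h n) n (\<lambda>j. X j \<omega>) x"
  have [measurable]: "?D n x \<in> borel_measurable M" for n x
    using distributed_measurable[OF law]
    by (intro empirical_deviation_measurable compact_lipschitz_measurable[OF \<phi>]) simp
  define bad where "bad n x = {\<omega> \<in> space M. \<theta> / 2 * h n ^ (d + 2) \<le> \<bar>?D n x \<omega>\<bar>}" for n x
  have [measurable]: "bad n x \<in> events" for n x unfolding bad_def by measurable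
  define G where "G n = space M - (\<Union>x\<in>F n. bad n x)" for n
  have G: "G n \<in> events" for n unfolding G_def using F(1) by (intro sets.Diff sets.top sets.finite_UN) auto
  have uniform: "\<bar>?D n x \<omega>\<bar> \<le> \<theta> * h n ^ (d + 2)" if "0 < n" "\<omega> \<in> G n" "norm x \<le> \<rho>" for n \<omega> x
  proof -
    obtain y where y: "y \<in> F n" "dist x y \<le> s n" using F(3) \<open>norm x \<le> \<rho>\<close> by blast
    have "\<bar>?D n x \<omega> - ?D n y \<omega>\<bar> \<le> 2 * C / h n * norm (x - y)"
      by (rule empirical_deviation_lipschitz[OF f \<phi> h_pos that(1)])
    also have "\<dots> \<le> 2 * C / h n * s n"
      using y(2) D(2) h_pos[of n] by (intro mult_left_mono) (auto simp: dist_norm)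
    also have "\<dots> = \<theta> / 2 * h n ^ (d + 2)"
      using D(2) h_pos[of n] by (simp add: s_def power_add power2_eq_square power3_eq_cube field_simps)
    finally have "\<bar>?D n x \<omega> - ?D n y \<omega>\<bar> \<le> \<theta> / 2 * h n ^ (d + 2)" .
    moreover have "\<bar>?D n y \<omega>\<bar> < \<theta> / 2 * h n ^ (d + 2)"
      using that(2) y(1) by (auto simp: G_def bad_def not_le)
    ultimately show ?thesis by linarith
  qed
  define C2 where "C2 = 8 * C * \<rho> * d / \<theta> + 3"
  have C2: "0 < C2" using D(2) \<rho> \<theta> by (simp add: C2_def add_nonneg_pos)
  have "\<forall>\<^sub>F n in sequentially. h n < 1" using h_lim by (rule order_tendstoD(2)) simp
  moreover have "\<forall>\<^sub>F n in sequentially. (real (d + 1) / \<kappa>) * ln (real n) \<le> real n * h n ^ (d + 4) \<and> 1 \<le> real n * h n ^ (d + 4)"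
    using \<kappa> h_rate unfolding d_def by (intro log_rate_consequences h_pos) auto
  ultimately have "\<forall>\<^sub>F n in sequentially. 1 - 2 * C2 ^ d / real n \<le> prob (G n)"
    using eventually_gt_at_top[of 0]
  proof eventually_elim
    case (elim n)
    have hn: "0 < h n" "h n < 1" using h_pos elim by auto
    have P: "prob (bad n x) \<le> 2 * (1 / real n ^ (d + 1))" for x
    proof -
      have "a * (h n)\<^sup>2 * (2 * C) \<le> 1"
      proof -
        have "(h n)\<^sup>2 \<le> 1" using hn by (simp add: power_le_one)
        then have "a * (h n)\<^sup>2 * (2 * C) \<le> a * 1 * (2 * C)"
          using a D(2) by (intro mult_right_mono mult_left_mono) auto
        also have "\<dots> \<le> 1 / (2 * C) * (2 * C)"
          using D(2) by (intro mult_right_mono) (auto simp: a_def)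
        finally show ?thesis using D(2) by simp
      qed
      then have "prob (bad n x) \<le> 2 * exp (- (real n * h n ^ (d + 4) * (a * (\<theta> / 2) - a\<^sup>2 * V)))"
        unfolding bad_def V_def d_def
        using elim by (intro empirical_deviation_tail[OF f B \<phi> indep law h_pos _ a]) auto
      also have "\<dots> \<le> 2 * exp (- (real n * h n ^ (d + 4) * \<kappa>))"
        using \<kappa>_le hn by (auto intro!: mult_left_mono)
      also have "\<dots> \<le> 2 * exp (- (real (d + 1) * ln (real n)))"
        using elim \<kappa> by (simp add: divide_le_eq mult.commute)
      also have "exp (- (real (d + 1) * ln (real n))) = 1 / real n ^ (d + 1)"
        using elim by (simp add: exp_minus exp_of_nat_mult divide_inverse del: of_nat_Suc of_nat_add)
      finally show ?thesis .
    qed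
    have card: "real (card (F n)) \<le> (C2 * real n) ^ d"
    proof -
      have "real (card (F n)) \<le> (2 * (\<rho> * real d / s n) + 3) ^ d" using F(2) by (simp add: d_def)
      also have "\<dots> \<le> (C2 * real n) ^ d"
      proof (rule power_mono)
        have "2 * (\<rho> * real d / s n) + 3 = (8 * C * \<rho> * d / \<theta>) * (1 / h n ^ (d + 3)) + 3 * 1"
          using D(2) \<theta> hn by (simp add: s_def field_simps)
        also have "\<dots> \<le> (8 * C * \<rho> * d / \<theta>) * real n + 3 * real n"
        proof (intro add_mono mult_left_mono)
          have "h n ^ (d + 4) \<le> h n ^ (d + 3)" using hn by (intro power_decreasing) auto
          then have "real n * h n ^ (d + 4) \<le> real n * h n ^ (d + 3)" by (intro mult_left_mono) auto
          then have "1 \<le> real n * h n ^ (d + 3)" using elim by linarith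
          then show "1 / h n ^ (d + 3) \<le> real n" using hn by (simp add: divide_le_eq)
        qed (use D(2) \<rho> \<theta> elim in auto)
        finally show "2 * (\<rho> * real d / s n) + 3 \<le> C2 * real n" by (simp add: C2_def algebra_simps)
        show "0 \<le> 2 * (\<rho> * real d / s n) + 3" using \<rho> s[of n] by (simp add: add_nonneg_nonneg)
      qed
      finally show ?thesis .
    qed
    have "prob (\<Union>x\<in>F n. bad n x) \<le> (\<Sum>x\<in>F n. prob (bad n x))"
      using F(1) by (intro finite_measure_subadditive_finite) auto
    also have "\<dots> \<le> real (card (F n)) * (2 * (1 / real n ^ (d + 1)))"
      using sum_mono[of "F n" "\<lambda>x. prob (bad n x)" "\<lambda>_. 2 * (1 / real n ^ (d + 1))"] P by simp
    also have "\<dots> \<le> (C2 * real n) ^ d * (2 * (1 / real n ^ (d + 1)))"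
      using card by (intro mult_right_mono) auto
    also have "\<dots> = 2 * C2 ^ d / real n" using elim by (simp add: power_mult_distrib)
    finally have "prob (\<Union>x\<in>F n. bad n x) \<le> 2 * C2 ^ d / real n" .
    moreover have "prob (G n) = 1 - prob (\<Union>x\<in>F n. bad n x)"
      unfolding G_def using F(1) by (intro prob_compl sets.finite_UN) auto
    ultimately show ?case by simp
  qed
  moreover have "(\<lambda>n. 1 - 2 * C2 ^ d / real n) \<longlonglongrightarrow> 1 - 0"
    by (intro tendsto_intros lim_const_over_n)
  ultimately have "(\<lambda>n. prob (G n)) \<longlonglongrightarrow> 1"
    by (rule_tac tendsto_sandwich[where f = "\<lambda>n. 1 - 2 * C2 ^ d / real n" and h = "\<lambda>_. 1"])
       (simp_all add: always_eventually)
  then show ?thesis using G uniform unfolding d_def by (intro exI[of _ G]) simp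
qed

text \<open>The union bound for the complements.\<close>

lemma prob_Inter_finite_tendsto_1:
  fixes G :: "'i \<Rightarrow> nat \<Rightarrow> 'a set"
  assumes fin: "finite I" and G: "\<And>i n. i \<in> I \<Longrightarrow> G i n \<in> events"
    and lim: "\<And>i. i \<in> I \<Longrightarrow> (\<lambda>n. prob (G i n)) \<longlonglongrightarrow> 1"
  shows "(\<lambda>n. prob (space M - (\<Union>i\<in>I. space M - G i n))) \<longlonglongrightarrow> 1"
proof (rule tendsto_sandwich)
  show "(\<lambda>n. 1 - (\<Sum>i\<in>I. 1 - prob (G i n))) \<longlonglongrightarrow> 1"
  proof -
    have "(\<lambda>n. 1 - (\<Sum>i\<in>I. 1 - prob (G i n))) \<longlonglongrightarrow> 1 - (\<Sum>i\<in>I. 1 - 1)"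
      by (intro tendsto_diff tendsto_sum tendsto_const lim)
    then show ?thesis by simp
  qed
  show "(\<lambda>_. 1) \<longlonglongrightarrow> (1::real)" by simp
  show "\<forall>\<^sub>F n in sequentially. 1 - (\<Sum>i\<in>I. 1 - prob (G i n)) \<le> prob (space M - (\<Union>i\<in>I. space M - G i n))"
  proof (rule always_eventually, rule allI)
    fix n
    have ev: "(\<Union>i\<in>I. space M - G i n) \<in> events" using fin G by (intro sets.finite_UN) auto
    have "prob (\<Union>i\<in>I. space M - G i n) \<le> (\<Sum>i\<in>I. prob (space M - G i n))"
      using fin G by (intro finite_measure_subadditive_finite) auto
    also have "\<dots> = (\<Sum>i\<in>I. 1 - prob (G i n))" by (intro sum.cong refl prob_compl G)
    finally show "1 - (\<Sum>i\<in>I. 1 - prob (G i n)) \<le> prob (space M - (\<Union>i\<in>I. space M - G i n))"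
      using prob_compl[OF ev] by simp
  qed
qed (simp add: always_eventually)

end

section \<open>Perturbed ascent from the basin of attraction\<close>

text \<open>A zero of the nonnegative \<open>f\<close> is a minimum, hence critical, and the flow would
rest there.  Its limit \<open>xs\<close> would then be that zero, although \<open>f\<close> is positive
at its mode.\<close>

lemma basin_density_pos:
  fixes f :: "real^'d \<Rightarrow> real"
  assumes f: "regular_density f" and mode: "is_mode f xs"
    and flow: "is_gradient_flow f x0 \<gamma>" and lim: "(\<gamma> \<longlongrightarrow> xs) at_top"
  shows "0 < f x0"
proof (rule ccontr)
  assume "\<not> 0 < f x0"
  have td: "twice_differentiable f" and nonneg: "\<And>x. 0 \<le> f x"
    using f unfolding regular_density_def probability_density_def by auto
  have "f x0 = 0" using \<open>\<not> 0 < f x0\<close> nonneg[of x0] by simp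
  have "(\<lambda>v. v \<bullet> grad f x0) = (\<lambda>v. 0)"
    using differential_zero_maxmin[OF _ _ has_derivative_twice_differentiable[OF td], of x0 UNIV]
      nonneg \<open>f x0 = 0\<close> by auto
  then have crit: "grad f x0 = 0" by (metis inner_eq_zero_iff)
  obtain \<Lambda> where "\<And>x v. norm (hessian f x *v v) \<le> \<Lambda> * norm v"
    using regular_density_uniform_bounds[OF f] by metis
  note lip = grad_lipschitz[OF td this]
  have "\<gamma> t = x0" if "0 \<le> t" for t
    by (rule gradient_flow_from_critical_point[OF flow lip crit that])
  then have "\<forall>\<^sub>F t in at_top. x0 = \<gamma> t"
    by (intro eventually_mono[OF eventually_ge_at_top[of 0]]) simp
  then have "(\<gamma> \<longlongrightarrow> x0) at_top" by (rule Lim_transform_eventually[OF tendsto_const])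
  then have "x0 = xs" using lim by (rule tendsto_unique[OF trivial_limit_at_top_linorder])
  then show False using mode_density_pos[OF f mode] \<open>f x0 = 0\<close> by simp
qed

text \<open>\<open>S\<close> is a thin tube around the flow line together with a ball around the mode.
Since \<open>f\<close> increases along the flow, it is bounded below by a positive constant on
\<open>S\<close>; this later keeps the denominators of the iteration away from zero.  The flow line
enters a ball of radius \<open>r / 6\<close> around the mode for good, the iterates track it with error
\<open>r / 6\<close>, and from distance \<open>r / 3\<close> on the contraction takes over.  The limit
is a zero of \<open>g\<close>, at distance at most \<open>|g xs| / m\<close> from the mode.\<close>

lemma perturbed_ascent_reaches_mode:
  fixes f :: "real^'d \<Rightarrow> real"
  assumes f: "regular_density f" and mode: "is_mode f xs" and basin: "x0 \<in> basin_of_attraction f xs"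
    and pos: "0 < m" "0 < r1" "0 < \<epsilon>"
  obtains S \<rho> c r \<delta> \<eta> where "0 \<le> \<rho>" "0 < c" "0 < r" "r \<le> r1" "0 < \<delta>" "0 < \<eta>"
    "\<And>z. z \<in> S \<Longrightarrow> norm z \<le> \<rho>" "\<And>z. z \<in> S \<Longrightarrow> c \<le> f z" "cball xs r \<subseteq> S"
    "\<And>g \<tau> y \<tau>lo. y 0 = x0 \<Longrightarrow> (\<And>j. y (Suc j) = y j + \<tau> (y j) *\<^sub>R g (y j)) \<Longrightarrow>
       (\<And>z. z \<in> S \<Longrightarrow> norm (g z - grad f z) \<le> \<delta>) \<Longrightarrow>
       0 < \<tau>lo \<Longrightarrow> (\<And>z. z \<in> S \<Longrightarrow> \<tau>lo \<le> \<tau> z \<and> \<tau> z \<le> \<eta>) \<Longrightarrow>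
       (\<And>x y. x \<in> cball xs r \<Longrightarrow> y \<in> cball xs r \<Longrightarrow> (g x - g y) \<bullet> (x - y) \<le> - m * (norm (x - y))\<^sup>2) \<Longrightarrow>
       (\<And>x y. x \<in> cball xs r \<Longrightarrow> y \<in> cball xs r \<Longrightarrow> norm (g x - g y) \<le> L * norm (x - y)) \<Longrightarrow>
       (\<forall>j. y j \<in> S) \<and> (\<exists>z. y \<longlonglongrightarrow> z \<and> dist z xs < \<epsilon>)"
proof -
  obtain \<gamma> where flow: "is_gradient_flow f x0 \<gamma>" and lim: "(\<gamma> \<longlongrightarrow> xs) at_top"
    using basin unfolding basin_of_attraction_def by blast
  have td: "twice_differentiable f" using f unfolding regular_density_def by auto
  obtain B \<Lambda> where B: "B > 0" "\<And>x. norm (grad f x) \<le> B" and \<Lambda>: "\<Lambda> > 0"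
    "\<And>x v. norm (hessian f x *v v) \<le> \<Lambda> * norm v"
    using regular_density_uniform_bounds[OF f] by metis
  note lipg = grad_lipschitz[OF td \<Lambda>(2)] and lipf = lipschitz_of_bounded_grad[OF td B(2)]
  define c0 where "c0 = f x0"
  have c0: "0 < c0" unfolding c0_def by (rule basin_density_pos[OF f mode flow lim])
  have f\<gamma>: "c0 \<le> f (\<gamma> t)" if "0 \<le> t" for t
    using gradient_flow_ascends[OF flow td, of 0 t] that flow by (simp add: c0_def is_gradient_flow_def)
  have cont: "isCont f xs" using has_derivative_continuous[OF has_derivative_twice_differentiable[OF td]] .
  have fxs: "c0 \<le> f xs"
  proof (rule tendsto_lowerbound[OF isCont_tendsto_compose[OF cont lim]])
    show "\<forall>\<^sub>F t in at_top. c0 \<le> f (\<gamma> t)"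
      by (rule eventually_mono[OF eventually_ge_at_top[of 0] f\<gamma>])
  qed simp
  define r where "r = min r1 (c0 / (4 * B))"
  have r: "0 < r" "r \<le> r1" "B * r \<le> c0 / 4"
  proof -
    show "0 < r" "r \<le> r1" using pos c0 B(1) by (auto simp: r_def)
    have "B * r \<le> B * (c0 / (4 * B))" using B(1) by (intro mult_left_mono) (auto simp: r_def)
    then show "B * r \<le> c0 / 4" using B(1) by simp
  qed
  have "\<forall>\<^sub>F t in at_top. dist (\<gamma> t) xs < r / 6" using r(1) by (intro tendstoD[OF lim]) simp
  then obtain T0 where T0: "\<And>t. T0 \<le> t \<Longrightarrow> dist (\<gamma> t) xs < r / 6"
    by (auto simp: eventually_at_top_linorder)
  define T where "T = max T0 0"
  have T: "0 \<le> T" "\<And>t. T \<le> t \<Longrightarrow> dist (\<gamma> t) xs \<le> r / 6"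
    using T0 by (auto simp: T_def less_imp_le)
  define S where "S = {z. \<exists>t\<ge>0. dist z (\<gamma> t) \<le> r / 6} \<union> cball xs r"
  define \<rho> where "\<rho> = norm x0 + B * T + norm xs + 2 * r"
  have \<rho>0: "0 \<le> \<rho>" using B(1) T(1) r(1) by (auto simp: \<rho>_def intro!: add_nonneg_nonneg)
  have near: "norm z \<le> norm a + b" if "dist z a \<le> b" for z a :: "real^'d" and b
    using that norm_triangle_ineq2[of z a] by (simp add: dist_norm)
  have S\<rho>: "norm z \<le> \<rho>" if "z \<in> S" for z
  proof -
    have \<gamma>b: "norm (\<gamma> t) \<le> norm x0 + B * T + norm xs + r" if "0 \<le> t" for t
    proof (cases "t \<le> T")
      case True
      have "norm (\<gamma> t - \<gamma> 0) \<le> B * (t - 0)"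
        by (rule gradient_flow_displacement[OF flow B(2)]) (use that in auto)
      also have "\<dots> \<le> B * T" using True B(1) by simp
      finally have "norm (\<gamma> t) \<le> norm x0 + B * T"
        using near[of "\<gamma> t" "\<gamma> 0" "B * T"] flow by (simp add: dist_norm is_gradient_flow_def)
      then show ?thesis using r(1) norm_ge_zero[of xs] by linarith
    next
      case False
      then have "norm (\<gamma> t) \<le> norm xs + r / 6" using T(2)[of t] near by auto
      moreover have "0 \<le> B * T" using B(1) T(1) by simp
      ultimately show ?thesis using r(1) norm_ge_zero[of x0] by linarith
    qed
    from that consider t where "0 \<le> t" "dist z (\<gamma> t) \<le> r / 6" | "dist z xs \<le> r"
      by (auto simp: S_def dist_commute)
    then show ?thesis
    proof cases
      case 1
      then show ?thesis using near[OF 1(2)] \<gamma>b[OF 1(1)] r(1) unfolding \<rho>_def by linarith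
    next
      case 2
      moreover have "0 \<le> B * T" using B(1) T(1) by simp
      ultimately show ?thesis using near[OF 2] r(1) norm_ge_zero[of x0] unfolding \<rho>_def by linarith
    qed
  qed
  have Sc: "3 * c0 / 4 \<le> f z" if "z \<in> S" for z
  proof -
    have "\<exists>a. c0 \<le> f a \<and> dist z a \<le> r"
    proof (cases "z \<in> cball xs r")
      case True
      then show ?thesis using fxs by (auto simp: dist_commute)
    next
      case False
      then obtain t where "0 \<le> t" "dist z (\<gamma> t) \<le> r / 6" using \<open>z \<in> S\<close> by (auto simp: S_def)
      then show ?thesis using f\<gamma> r(1) by (intro exI[of _ "\<gamma> t"]) auto
    qed
    then obtain a where a: "c0 \<le> f a" "dist z a \<le> r" by blast
    have "\<bar>f z - f a\<bar> \<le> B * norm (z - a)" by (rule lipf)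
    also have "\<dots> \<le> B * r" using a(2) B(1) by (intro mult_left_mono) (auto simp: dist_norm)
    finally show ?thesis using a(1) r(3) by linarith
  qed
  \<comment> \<open>the amplification of errors up to the time \<open>T + 1\<close>, within which the tracking phase ends\<close>
  define E where "E = (T + 1) * exp (\<Lambda> * (T + 1))"
  have E: "0 < E" using T(1) by (simp add: E_def)
  define \<delta> where "\<delta> = min (r / (12 * E)) (min (m * r / 3) (m * \<epsilon> / 2))"
  have \<delta>: "0 < \<delta>" "\<delta> \<le> r / (12 * E)" "\<delta> \<le> m * r / 3" "\<delta> \<le> m * \<epsilon> / 2"
    using r(1) E pos by (auto simp: \<delta>_def)
  define \<eta> where "\<eta> = min 1 (min (r / (12 * E * (\<Lambda> * B))) (min (m / (L\<^sup>2 + 1)) (1 / m)))"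
  have L: "0 < L\<^sup>2 + 1" by (simp add: add_nonneg_pos)
  have \<eta>: "0 < \<eta>" "\<eta> \<le> 1" "\<eta> \<le> r / (12 * E * (\<Lambda> * B))" "\<eta> \<le> m / (L\<^sup>2 + 1)" "\<eta> \<le> 1 / m"
    using r(1) E pos \<Lambda>(1) B(1) L by (auto simp: \<eta>_def)
  show ?thesis
  proof (rule that[of \<rho> "3 * c0 / 4" r \<delta> \<eta> S])
    show "cball xs r \<subseteq> S" by (auto simp: S_def)
    fix g \<tau> y \<tau>lo
    assume y0: "y 0 = x0" and ySuc: "\<And>j. y (Suc j) = y j + \<tau> (y j) *\<^sub>R g (y j)"
      and g: "\<And>z. z \<in> S \<Longrightarrow> norm (g z - grad f z) \<le> \<delta>" and \<tau>lo: "0 < \<tau>lo"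
      and \<tau>: "\<And>z. z \<in> S \<Longrightarrow> \<tau>lo \<le> \<tau> z \<and> \<tau> z \<le> \<eta>"
      and mono: "\<And>x y. x \<in> cball xs r \<Longrightarrow> y \<in> cball xs r \<Longrightarrow> (g x - g y) \<bullet> (x - y) \<le> - m * (norm (x - y))\<^sup>2"
      and lip: "\<And>x y. x \<in> cball xs r \<Longrightarrow> y \<in> cball xs r \<Longrightarrow> norm (g x - g y) \<le> L * norm (x - y)"
    have "\<exists>J. \<exists>t\<ge>T. dist (y J) (\<gamma> t) \<le> r / 6 \<and> (\<forall>j\<le>J. \<exists>s\<ge>0. dist (y j) (\<gamma> s) \<le> r / 6)"
    proof (rule variable_step_euler_tracks_flow[OF flow B(2) lipg _ y0 ySuc _ _ \<tau>lo _ T(1)])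
      show "norm (g z - grad f z) \<le> \<delta> \<and> \<tau>lo \<le> \<tau> z \<and> \<tau> z \<le> \<eta>"
        if "0 \<le> t" "dist z (\<gamma> t) \<le> r / 6" for z t
        using that g[of z] \<tau>[of z] by (auto simp: S_def)
      have "(T + \<eta>) * exp (\<Lambda> * (T + \<eta>)) \<le> E"
        unfolding E_def using T(1) \<eta>(1,2) \<Lambda>(1) by (intro mult_mono) auto
      moreover have "\<Lambda> * B * \<eta> \<le> r / (12 * E)"
      proof -
        have "\<Lambda> * B * \<eta> \<le> \<Lambda> * B * (r / (12 * E * (\<Lambda> * B)))"
          using \<eta>(3) \<Lambda>(1) B(1) by (intro mult_left_mono) auto
        then show ?thesis using \<Lambda>(1) B(1) by simp
      qed
      then have "\<delta> + \<Lambda> * B * \<eta> \<le> r / (6 * E)" using \<delta>(2) by simp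
      ultimately have "(\<delta> + \<Lambda> * B * \<eta>) * ((T + \<eta>) * exp (\<Lambda> * (T + \<eta>))) \<le> r / (6 * E) * E"
        using \<delta>(1) \<Lambda>(1) B(1) \<eta>(1) T(1) r(1) E by (intro mult_mono) auto
      then show "(\<delta> + \<Lambda> * B * \<eta>) * (T + \<eta>) * exp (\<Lambda> * (T + \<eta>)) \<le> r / 6" using E by (simp add: mult.assoc)
    qed (use \<Lambda>(1) \<delta>(1) r(1) in auto)
    then obtain J t where J: "T \<le> t" "dist (y J) (\<gamma> t) \<le> r / 6" "\<And>j. j \<le> J \<Longrightarrow> y j \<in> S"
      by (auto simp: S_def)
    have "norm (g xs - grad f xs) \<le> \<delta>" by (rule g) (use r(1) in \<open>simp add: S_def\<close>)
    then have gxs: "norm (g xs) \<le> \<delta>" using mode_properties(1)[OF f mode] by simp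
    have tail: "(\<forall>j. y (J + j) \<in> cball xs r) \<and> (\<exists>z. (\<lambda>j. y (J + j)) \<longlonglongrightarrow> z \<and> norm (z - xs) \<le> norm (g xs) / m)"
    proof (rule variable_step_ascent_converges[OF mono lip r(1) pos(1), where \<tau> = \<tau> and \<tau>lo = \<tau>lo and \<tau>hi = \<eta>])
      show "norm (g xs) \<le> m * r / 3" using gxs \<delta>(3) by linarith
      have "dist (y J) xs \<le> dist (y J) (\<gamma> t) + dist (\<gamma> t) xs" by (rule dist_triangle)
      also have "\<dots> \<le> r / 6 + r / 6" by (intro add_mono J(2) T(2) J(1))
      finally show "y (J + 0) \<in> cball xs (r / 3)" by (simp add: dist_commute)
      show "y (J + Suc j) = y (J + j) + \<tau> (y (J + j)) *\<^sub>R g (y (J + j))" for j using ySuc[of "J + j"] by simp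
      show "\<tau>lo \<le> \<tau> z \<and> \<tau> z \<le> \<eta>" if "z \<in> cball xs r" for z using that by (intro \<tau>) (simp add: S_def)
      have "\<eta> * L\<^sup>2 \<le> m / (L\<^sup>2 + 1) * (L\<^sup>2 + 1)"
        using \<eta>(1,4) pos(1) L by (intro mult_mono) auto
      then show "\<eta> * L\<^sup>2 \<le> m" using L by simp
      show "\<eta> * m \<le> 1" using \<eta>(5) pos(1) by (simp add: field_simps)
    qed (use \<tau>lo in simp_all)
    then obtain z where z: "(\<lambda>j. y (J + j)) \<longlonglongrightarrow> z" "norm (z - xs) \<le> norm (g xs) / m" by blast
    have "y \<longlonglongrightarrow> z" using z(1) by (subst (asm) add.commute) (rule LIMSEQ_offset)
    moreover have "dist z xs < \<epsilon>"
    proof -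
      have "norm (g xs) / m \<le> (m * \<epsilon> / 2) / m" using gxs \<delta>(4) pos(1) by (intro divide_right_mono) auto
      also have "\<dots> < \<epsilon>" using pos by simp
      finally show ?thesis using z(2) by (simp add: dist_norm)
    qed
    moreover have "y j \<in> S" for j
    proof (cases "j \<le> J")
      case False
      then have "y j = y (J + (j - J))" by simp
      then show ?thesis using tail by (auto simp: S_def)
    qed (rule J(3))
    ultimately show "(\<forall>j. y j \<in> S) \<and> (\<exists>z. y \<longlonglongrightarrow> z \<and> dist z xs < \<epsilon>)" by blast
  qed (use \<rho>0 c0 r \<delta> \<eta> S\<rho> Sc in auto)
qed

section \<open>Mean shift\<close>

lemma lborel_integral_scale:
  fixes f \<phi> :: "real^'d \<Rightarrow> real"
  assumes [measurable]: "f \<in> borel_measurable borel" "\<phi> \<in> borel_measurable borel" and h: "0 < h"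
  shows "(LINT z|lborel. f z * \<phi> ((z - x) /\<^sub>R h)) = h ^ CARD('d) * (LINT u|lborel. \<phi> u * f (x + h *\<^sub>R u))"
proof -
  have "(LINT z|lborel. f z * \<phi> ((z - x) /\<^sub>R h))
     = (LINT z|density (distr lborel borel (\<lambda>u. x + h *\<^sub>R u)) (\<lambda>_. ennreal (\<bar>h\<bar> ^ DIM(real^'d))). f z * \<phi> ((z - x) /\<^sub>R h))"
    using lborel_affine[of h x] h by simp
  also have "\<dots> = (LINT z|distr lborel borel (\<lambda>u. x + h *\<^sub>R u). (h ^ CARD('d)) *\<^sub>R (f z * \<phi> ((z - x) /\<^sub>R h)))"
    using h by (subst integral_density) auto
  also have "\<dots> = (LINT u|lborel. h ^ CARD('d) * (\<phi> u * f (x + h *\<^sub>R u)))"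
    using h by (subst integral_distr) (auto simp: mult.commute)
  finally show ?thesis by simp
qed

definition kde :: "(real^'d \<Rightarrow> real) \<Rightarrow> real \<Rightarrow> nat \<Rightarrow> (nat \<Rightarrow> real^'d) \<Rightarrow> real^'d \<Rightarrow> real" where
  "kde K h n X x = (\<Sum>j=1..n. K ((X j - x) /\<^sub>R h)) / (real n * h ^ CARD('d))"

definition kde_gradient :: "(real^'d \<Rightarrow> real) \<Rightarrow> real \<Rightarrow> nat \<Rightarrow> (nat \<Rightarrow> real^'d) \<Rightarrow> real^'d \<Rightarrow> real^'d" where
  "kde_gradient K h n X x = (\<chi> i. (\<Sum>j=1..n. kernel_moment K i ((X j - x) /\<^sub>R h)) / (real n * h ^ (CARD('d) + 1)))"

text \<open>Write \<open>X j = y + h u\<close> in the numerator: the part with \<open>y\<close>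
reproduces \<open>y\<close>, the part with \<open>h u\<close> is the shift.\<close>

lemma mean_shift_step:
  fixes K :: "real^'d \<Rightarrow> real"
  assumes h: "0 < h" and n: "0 < n" and nz: "kernel_weight_sum K h n X y \<noteq> 0"
  shows "(\<Sum>j=1..n. K ((X j - y) /\<^sub>R h) *\<^sub>R X j) /\<^sub>R kernel_weight_sum K h n X y
     = y + (h\<^sup>2 / kde K h n X y) *\<^sub>R kde_gradient K h n X y"
proof -
  let ?W = "kernel_weight_sum K h n X y"
  have "(\<Sum>j=1..n. K ((X j - y) /\<^sub>R h) *\<^sub>R X j) $ i = ?W * y $ i + h * (\<Sum>j=1..n. kernel_moment K i ((X j - y) /\<^sub>R h))" for i
  proof -
    have "(\<Sum>j=1..n. K ((X j - y) /\<^sub>R h) *\<^sub>R X j) $ i = (\<Sum>j=1..n. K ((X j - y) /\<^sub>R h) * y $ i + h * kernel_moment K i ((X j - y) /\<^sub>R h))"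
      unfolding sum_component kernel_moment_def
    proof (intro sum.cong refl)
      fix j
      define u where "u = (X j - y) /\<^sub>R h"
      have "X j = y + h *\<^sub>R u" using h by (simp add: u_def)
      then have "X j $ i = y $ i + h * u $ i" by simp
      then show "(K ((X j - y) /\<^sub>R h) *\<^sub>R X j) $ i = K ((X j - y) /\<^sub>R h) * y $ i
          + h * (K ((X j - y) /\<^sub>R h) * ((X j - y) /\<^sub>R h) $ i)"
        unfolding u_def[symmetric] by (simp add: algebra_simps)
    qed
    then show ?thesis by (simp add: kernel_weight_sum_def sum.distrib sum_distrib_right sum_distrib_left)
  qed
  then have "((\<Sum>j=1..n. K ((X j - y) /\<^sub>R h) *\<^sub>R X j) /\<^sub>R ?W) $ i
     = y $ i + h * (\<Sum>j=1..n. kernel_moment K i ((X j - y) /\<^sub>R h)) / ?W" for i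
    using nz by (simp add: divide_inverse algebra_simps)
  moreover have "((h\<^sup>2 / kde K h n X y) *\<^sub>R kde_gradient K h n X y) $ i = h * (\<Sum>j=1..n. kernel_moment K i ((X j - y) /\<^sub>R h)) / ?W" for i
    using h n by (simp add: kde_def kde_gradient_def kernel_weight_sum_def power2_eq_square)
  ultimately show ?thesis by (simp only: vec_eq_iff vector_add_component simp_thms)
qed

lemma kde_deviation:
  fixes K f :: "real^'d \<Rightarrow> real"
  assumes "f \<in> borel_measurable borel" "K \<in> borel_measurable borel" and h: "0 < h"
  shows "kde K h n X x - smoothed_density K f h x = empirical_deviation f K h n X x / h ^ CARD('d)"
  using h by (simp add: kde_def smoothed_density_def empirical_deviation_def lborel_integral_scale[OF assms]
      diff_divide_distrib)

lemma kde_gradient_deviation: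
  fixes K f :: "real^'d \<Rightarrow> real"
  assumes "f \<in> borel_measurable borel" "kernel_moment K i \<in> borel_measurable borel" and h: "0 < h"
  shows "(kde_gradient K h n X x - smoothed_gradient K f h x) $ i
     = empirical_deviation f (kernel_moment K i) h n X x / h ^ (CARD('d) + 1)"
  using h by (simp add: kde_gradient_def smoothed_gradient_def empirical_deviation_def lborel_integral_scale[OF assms]
      diff_divide_distrib)

text \<open>A quadratic remainder makes \<open>L x\<close> the derivative of \<open>F\<close>, so that a
bound on \<open>L\<close> is a Lipschitz constant.\<close>

lemma lipschitz_of_quadratic_remainder:
  fixes F :: "'a::real_normed_vector \<Rightarrow> real"
  assumes S: "convex S" and L: "\<And>x. linear (L x)" and bound: "\<And>x v. x \<in> S \<Longrightarrow> \<bar>L x v\<bar> \<le> \<kappa> * norm v"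
    and rem: "\<And>x v. \<bar>F (x + v) - F x - L x v\<bar> \<le> C * (norm v)\<^sup>2"
    and xy: "x \<in> S" "y \<in> S"
  shows "\<bar>F x - F y\<bar> \<le> \<kappa> * norm (x - y)"
proof (cases "x = y")
  case False
  have "norm (F x - F y) \<le> \<kappa> * norm (x - y)"
  proof (rule differentiable_bound[where f = F and f' = L, OF S _ _ xy])
    fix z assume z: "z \<in> S"
    have "\<bar>L z (x - y)\<bar> \<le> \<kappa> * norm (x - y)" by (rule bound[OF z])
    then have "0 \<le> \<kappa> * norm (x - y)" by linarith
    then have \<kappa>: "0 \<le> \<kappa>" using False by (simp add: zero_le_mult_iff)
    show "onorm (L z) \<le> \<kappa>" by (rule onorm_bound[OF \<kappa>]) (use bound[OF z] in simp)
    show "(F has_derivative L z) (at z within S)"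
      unfolding has_derivative_iff_norm
    proof
      show "bounded_linear (L z)"
        using L[of z] bound[OF z] by (intro bounded_linear_intro[where K = \<kappa>]) (auto simp: linear_add linear_scale mult.commute)
      show "((\<lambda>w. norm (F w - F z - L z (w - z)) / norm (w - z)) \<longlongrightarrow> 0) (at z within S)"
      proof (rule real_tendsto_sandwich[where f = "\<lambda>_. 0" and h = "\<lambda>w. C * norm (w - z)"])
        show "\<forall>\<^sub>F w in at z within S. norm (F w - F z - L z (w - z)) / norm (w - z) \<le> C * norm (w - z)"
        proof (rule always_eventually, rule allI)
          fix w
          show "norm (F w - F z - L z (w - z)) / norm (w - z) \<le> C * norm (w - z)"
            using rem[of z "w - z"] by (cases "w = z") (auto simp: divide_le_eq power2_eq_square mult.assoc)
        qed
        show "((\<lambda>w. C * norm (w - z)) \<longlongrightarrow> 0) (at z within S)"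
          by (auto intro!: tendsto_eq_intros)
      qed (auto simp: always_eventually)
    qed
  qed
  then show ?thesis by simp
qed simp

lemma empirical_deviation_bound:
  fixes f r :: "real^'d \<Rightarrow> real"
  assumes f: "probability_density f" and n: "0 < n" and r: "r \<in> borel_measurable borel" "\<And>u. \<bar>r u\<bar> \<le> E"
  shows "\<bar>empirical_deviation f r h n X x\<bar> \<le> 2 * E"
proof -
  have "\<bar>\<Sum>j=1..n. r ((X j - x) /\<^sub>R h)\<bar> \<le> (\<Sum>j=1..n. E)"
    by (rule order_trans[OF sum_abs sum_mono]) (rule r(2))
  then have "\<bar>(\<Sum>j=1..n. r ((X j - x) /\<^sub>R h)) / real n\<bar> \<le> E"
    using n by (simp add: abs_divide divide_le_eq mult.commute)
  moreover have "\<bar>LINT z|lborel. f z * r ((z - x) /\<^sub>R h)\<bar> \<le> E"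
    by (rule density_average_le[OF f shifted_scaled_measurable[OF r(1)] r(2)])
  ultimately show ?thesis unfolding empirical_deviation_def by linarith
qed

text \<open>The deviation is linear in the function that is averaged.  So the Taylor estimate for
\<^const>\<open>kernel_moment\<close> carries over to its deviation, whose partial derivatives are
deviations of \<^const>\<open>kernel_moment_deriv\<close>, divided by \<open>- h\<close>.\<close>

lemma moment_deviation_lipschitz:
  fixes K f :: "real^'d \<Rightarrow> real"
  assumes f: "probability_density f" and n: "0 < n" and h: "0 < h"
    and C: "compact_lipschitz R C (kernel_moment K i)" "\<And>j. compact_lipschitz R C (kernel_moment_deriv K i j)"
    and taylor: "\<And>w v. \<bar>kernel_moment K i (w + v) - kernel_moment K i w
               - (\<Sum>j\<in>UNIV. v $ j * kernel_moment_deriv K i j w)\<bar> \<le> C * (norm v)\<^sup>2"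
    and dev: "\<And>j x. norm x \<le> \<rho> \<Longrightarrow> \<bar>empirical_deviation f (kernel_moment_deriv K i j) h n X x\<bar> \<le> \<theta> * h ^ (CARD('d) + 2)"
    and xy: "norm x \<le> \<rho>" "norm y \<le> \<rho>"
  shows "\<bar>empirical_deviation f (kernel_moment K i) h n X x - empirical_deviation f (kernel_moment K i) h n X y\<bar>
     \<le> real CARD('d) * \<theta> * h ^ (CARD('d) + 1) * norm (x - y)"
proof -
  let ?F = "empirical_deviation f (kernel_moment K i) h n X"
  let ?D = "\<lambda>j. empirical_deviation f (kernel_moment_deriv K i j) h n X"
  define L where "L x v = - (\<Sum>j\<in>UNIV. v $ j / h * ?D j x)" for x v
  have [measurable]: "kernel_moment K i \<in> borel_measurable borel" "kernel_moment_deriv K i j \<in> borel_measurable borel" for j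
    using compact_lipschitz_measurable C by blast+
  show ?thesis
  proof (rule lipschitz_of_quadratic_remainder[where F = ?F and L = L and S = "cball 0 \<rho>"])
    show "linear (L x)" for x
      by (rule linearI) (simp_all add: L_def algebra_simps add_divide_distrib sum.distrib sum_distrib_left sum_negf)
    fix x v :: "real^'d"
    define v' where "v' = - (v /\<^sub>R h)"
    define r where "r w = kernel_moment K i (w + v') - kernel_moment K i w - (\<Sum>j\<in>UNIV. v' $ j * kernel_moment_deriv K i j w)" for w
    have [measurable]: "(\<lambda>w. kernel_moment K i (w + v')) \<in> borel_measurable borel"
      by (rule measurable_compose[of "\<lambda>w. w + v'" _ borel]) measurable
    have r: "r \<in> borel_measurable borel" unfolding r_def by measurable
    have I: "integrable lborel (\<lambda>z. f z * \<phi> ((z - y) /\<^sub>R h))" if "compact_lipschitz R C \<phi>" for \<phi> y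
      by (rule integrable_density_times_bounded[OF f shifted_scaled_measurable compact_lipschitzD(4)[OF that]])
         (rule compact_lipschitz_measurable[OF that])
    have shift: "(z - (x + v)) /\<^sub>R h = (z - x) /\<^sub>R h + v'" for z
      by (simp add: v'_def algebra_simps)
    have divn: "(\<Sum>j\<in>UNIV. v' $ j * s j) / real n = (\<Sum>j\<in>UNIV. v' $ j * (s j / real n))" for s :: "'d \<Rightarrow> real"
      by (simp add: sum_divide_distrib)
    have gen: "(LINT z|lborel. a z - b z - (\<Sum>j\<in>UNIV. v' $ j * c j z))
        = (LINT z|lborel. a z) - (LINT z|lborel. b z) - (\<Sum>j\<in>UNIV. v' $ j * (LINT z|lborel. c j z))"
      if "integrable lborel a" "integrable lborel b" "\<And>j. integrable lborel (c j)"
      for a b :: "real^'d \<Rightarrow> real" and c :: "'d \<Rightarrow> real^'d \<Rightarrow> real"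
      using that by simp
    have "?F (x + v) - ?F x - L x v = empirical_deviation f r h n X x"
    proof -
      have "(LINT z|lborel. f z * r ((z - x) /\<^sub>R h)) =
        (LINT z|lborel. f z * kernel_moment K i ((z - (x + v)) /\<^sub>R h) - f z * kernel_moment K i ((z - x) /\<^sub>R h)
           - (\<Sum>j\<in>UNIV. v' $ j * (f z * kernel_moment_deriv K i j ((z - x) /\<^sub>R h))))"
        by (simp only: r_def shift right_diff_distrib sum_distrib_left mult.left_commute)
      also have "\<dots> = (LINT z|lborel. f z * kernel_moment K i ((z - (x + v)) /\<^sub>R h))
          - (LINT z|lborel. f z * kernel_moment K i ((z - x) /\<^sub>R h))
           - (\<Sum>j\<in>UNIV. v' $ j * (LINT z|lborel. f z * kernel_moment_deriv K i j ((z - x) /\<^sub>R h)))"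
        by (rule gen[OF I[OF C(1)] I[OF C(1)] I[OF C(2)]])
      finally have int: "(LINT z|lborel. f z * r ((z - x) /\<^sub>R h)) = \<dots>" .
      have "(\<Sum>k=1..n. r ((X k - x) /\<^sub>R h)) = (\<Sum>k=1..n. kernel_moment K i ((X k - (x + v)) /\<^sub>R h))
          - (\<Sum>k=1..n. kernel_moment K i ((X k - x) /\<^sub>R h))
          - (\<Sum>j\<in>UNIV. v' $ j * (\<Sum>k=1..n. kernel_moment_deriv K i j ((X k - x) /\<^sub>R h)))"
        unfolding r_def shift sum_subtractf sum_distrib_left
        by (simp only: sum.swap[where A = "{1..n}" and B = "UNIV :: 'd set"])
      then have "empirical_deviation f r h n X x = ?F (x + v) - ?F x - (\<Sum>j\<in>UNIV. v' $ j * ?D j x)"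
        unfolding empirical_deviation_def int
        by (simp add: diff_divide_distrib right_diff_distrib sum_subtractf divn)
      moreover have "(\<Sum>j\<in>UNIV. v' $ j * ?D j x) = L x v"
        by (simp add: L_def v'_def sum_negf divide_inverse mult.commute)
      ultimately show ?thesis by simp
    qed
    also have "\<bar>\<dots>\<bar> \<le> 2 * (C * (norm v')\<^sup>2)"
      by (rule empirical_deviation_bound[OF f n r]) (simp add: r_def taylor)
    also have "\<dots> = 2 * C / h\<^sup>2 * (norm v)\<^sup>2"
      using h by (simp add: v'_def power_mult_distrib divide_inverse power_inverse)
    finally show "\<bar>?F (x + v) - ?F x - L x v\<bar> \<le> 2 * C / h\<^sup>2 * (norm v)\<^sup>2" .
  next
    fix x v :: "real^'d" assume x: "x \<in> cball 0 \<rho>"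
    have "\<bar>L x v\<bar> \<le> (\<Sum>j\<in>UNIV. \<bar>v $ j / h * ?D j x\<bar>)"
      unfolding L_def abs_minus_cancel by (rule sum_abs)
    also have "\<dots> \<le> (\<Sum>j::'d\<in>UNIV. \<theta> * h ^ (CARD('d) + 1) * norm v)"
    proof (rule sum_mono)
      fix j
      have "\<bar>v $ j / h * ?D j x\<bar> \<le> norm v / h * (\<theta> * h ^ (CARD('d) + 2))"
        unfolding abs_mult using dev[of x j] x h component_le_norm_cart[of v j]
        by (intro mult_mono) (auto simp: abs_divide divide_right_mono)
      also have "\<dots> = \<theta> * h ^ (CARD('d) + 1) * norm v" using h by simp
      finally show "\<bar>v $ j / h * ?D j x\<bar> \<le> \<theta> * h ^ (CARD('d) + 1) * norm v" .
    qed
    finally show "\<bar>L x v\<bar> \<le> real CARD('d) * \<theta> * h ^ (CARD('d) + 1) * norm v" by (simp add: mult.assoc)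
  qed (use xy in auto)
qed

lemma mean_shift_measurable:
  fixes K :: "real^'d \<Rightarrow> real" and X :: "nat \<Rightarrow> 'w \<Rightarrow> real^'d"
  assumes K: "K \<in> borel_measurable borel" and X: "\<And>j. 1 \<le> j \<Longrightarrow> X j \<in> M \<rightarrow>\<^sub>M borel"
  shows "(\<lambda>\<omega>. mean_shift K h n (\<lambda>j. X j \<omega>) x0 k) \<in> borel_measurable M"
    and "(\<lambda>\<omega>. kernel_weight_sum K h n (\<lambda>j. X j \<omega>) (mean_shift K h n (\<lambda>j. X j \<omega>) x0 k)) \<in> borel_measurable M"
proof -
  have Xm [measurable]: "X j \<in> M \<rightarrow>\<^sub>M borel" if "j \<in> {1..n}" for j using X that by simp
  have w: "(\<lambda>\<omega>. kernel_weight_sum K h n (\<lambda>j. X j \<omega>) (y \<omega>)) \<in> borel_measurable M"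
    "(\<lambda>\<omega>. (\<Sum>j=1..n. K ((X j \<omega> - y \<omega>) /\<^sub>R h) *\<^sub>R X j \<omega>)) \<in> borel_measurable M"
    if y [measurable]: "y \<in> borel_measurable M" for y
  proof -
    have [measurable]: "(\<lambda>\<omega>. K ((X j \<omega> - y \<omega>) /\<^sub>R h)) \<in> borel_measurable M" if "j \<in> {1..n}" for j
      by (rule measurable_compose[OF _ K]) (use that in measurable)
    show "(\<lambda>\<omega>. kernel_weight_sum K h n (\<lambda>j. X j \<omega>) (y \<omega>)) \<in> borel_measurable M"
      unfolding kernel_weight_sum_def by measurable
    show "(\<lambda>\<omega>. (\<Sum>j=1..n. K ((X j \<omega> - y \<omega>) /\<^sub>R h) *\<^sub>R X j \<omega>)) \<in> borel_measurable M"
      by measurable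
  qed
  show ms: "(\<lambda>\<omega>. mean_shift K h n (\<lambda>j. X j \<omega>) x0 k) \<in> borel_measurable M"
  proof (induction k)
    case (Suc k)
    show ?case unfolding mean_shift.simps Let_def
      using w[OF Suc] by measurable
  qed simp
  show "(\<lambda>\<omega>. kernel_weight_sum K h n (\<lambda>j. X j \<omega>) (mean_shift K h n (\<lambda>j. X j \<omega>) x0 k)) \<in> borel_measurable M"
    by (rule w(1)[OF ms])
qed

text \<open>Convergence is the Cauchy property, which involves only countably many measurable
conditions, and the limit is then a measurable function.\<close>

lemma mean_shift_converges_near_measurable:
  fixes K :: "real^'d \<Rightarrow> real" and X :: "nat \<Rightarrow> 'w \<Rightarrow> real^'d"
  assumes K: "K \<in> borel_measurable borel" and X: "\<And>j. 1 \<le> j \<Longrightarrow> X j \<in> M \<rightarrow>\<^sub>M borel"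
  shows "{\<omega> \<in> space M. mean_shift_converges_near K h n (\<lambda>j. X j \<omega>) x0 xs \<epsilon>} \<in> sets M"
proof -
  let ?s = "\<lambda>k \<omega>. mean_shift K h n (\<lambda>j. X j \<omega>) x0 k"
  note [measurable] = mean_shift_measurable[OF K X]
  have "mean_shift_converges_near K h n (\<lambda>j. X j \<omega>) x0 xs \<epsilon> \<longleftrightarrow>
     (\<forall>k. kernel_weight_sum K h n (\<lambda>j. X j \<omega>) (?s k \<omega>) \<noteq> 0) \<and> Cauchy (\<lambda>k. ?s k \<omega>) \<and> dist (lim (\<lambda>k. ?s k \<omega>)) xs < \<epsilon>" for \<omega>
    unfolding mean_shift_converges_near_def mean_shift_defined_def Cauchy_convergent_iff convergent_def
    by (metis limI)
  then have "{\<omega> \<in> space M. mean_shift_converges_near K h n (\<lambda>j. X j \<omega>) x0 xs \<epsilon>} =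
     {\<omega> \<in> space M. \<forall>k. kernel_weight_sum K h n (\<lambda>j. X j \<omega>) (?s k \<omega>) \<noteq> 0} \<inter> {\<omega> \<in> space M. Cauchy (\<lambda>k. ?s k \<omega>)}
     \<inter> {\<omega> \<in> space M. dist (lim (\<lambda>k. ?s k \<omega>)) xs < \<epsilon>}" by auto
  also have "\<dots> \<in> sets M"
    by (intro sets.Int sets_Collect_Cauchy) measurable
  finally show ?thesis .
qed

lemma norm_le_of_components:
  fixes z :: "real^'d"
  assumes "\<And>i. \<bar>z $ i\<bar> \<le> b"
  shows "norm z \<le> real CARD('d) * b"
  using order_trans[OF norm_le_l1_cart[of z] sum_mono[of UNIV "\<lambda>i. \<bar>z $ i\<bar>" "\<lambda>_. b"]] assms by simp

text \<open>The iteration is an ascent with field \<open>g = G / \<sigma>\<close> and step \<open>\<tau>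
= h\<^sup>2 \<sigma> / p\<close> in the sense of \<open>perturbed_ascent_reaches_mode\<close>.  A
deviation below \<open>\<theta> h ^ (d + 2)\<close> means an error of at most \<open>\<theta>
h\<^sup>2\<close> in \<open>p\<close>, \<open>\<theta> h\<close> in each coordinate of \<open>G\<close>,
and \<open>\<theta>\<close> in each of its partial derivatives.  Of the constant \<open>m0\<close> of
negative definiteness at the mode, one quarter is spent on the variation of the Hessian and one quarter
on the deviation of the derivative, which leaves \<open>m = m0 / 2\<close>.\<close>

lemma mean_shift_converges_on_good_samples:
  fixes f K :: "real^'d \<Rightarrow> real"
  assumes f: "regular_density f" and K: "is_kernel K k"
    and mode: "is_mode f xs" and basin: "x0 \<in> basin_of_attraction f xs" and \<epsilon>: "0 < \<epsilon>"
    and CK: "\<And>\<phi>. \<phi> \<in> kernel_functions K \<Longrightarrow> compact_lipschitz R C \<phi>"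
    and taylor: "\<And>i w v. \<bar>kernel_moment K i (w + v) - kernel_moment K i w
               - (\<Sum>j\<in>UNIV. v $ j * kernel_moment_deriv K i j w)\<bar> \<le> C * (norm v)\<^sup>2"
  obtains \<rho> \<theta> h0 where "0 \<le> \<rho>" "0 < \<theta>" "0 < h0"
    "\<And>h n X. 0 < h \<Longrightarrow> h < h0 \<Longrightarrow> 0 < n \<Longrightarrow>
       (\<And>\<phi> x. \<phi> \<in> kernel_functions K \<Longrightarrow> norm x \<le> \<rho> \<Longrightarrow> \<bar>empirical_deviation f \<phi> h n X x\<bar> \<le> \<theta> * h ^ (CARD('d) + 2)) \<Longrightarrow>
       mean_shift_converges_near K h n X x0 xs \<epsilon>"
proof -
  define d where "d = real CARD('d)"
  have d: "1 \<le> d" unfolding d_def by (simp add: Suc_leI)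
  have td: "twice_differentiable f" and pd: "probability_density f"
    and unif: "uniformly_continuous_on UNIV (hessian f)"
    using f unfolding regular_density_def bounded_unif_continuous_def by auto
  have fm: "f \<in> borel_measurable borel"
    using pd unfolding probability_density_def by (auto dest: borel_measurable_integrable)
  note CKK = CK[OF kernel_functions_mem(1)] and CKm = CK[OF kernel_functions_mem(2)]
    and CKd = CK[OF kernel_functions_mem(3)]
  note Km = CKK[THEN compact_lipschitz_measurable] CKm[THEN compact_lipschitz_measurable]
  have R: "0 < R" by (rule compact_lipschitzD(1)[OF CKK])
  define \<sigma> where "\<sigma> = kernel_variance K"
  have \<sigma>: "0 < \<sigma>" unfolding \<sigma>_def by (rule kernel_variance_pos[OF K CKK])
  obtain B \<Lambda> where B: "B > 0" "\<And>x. f x \<le> B" "\<And>x. norm (grad f x) \<le> B" and \<Lambda>: "\<Lambda> > 0"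
    "\<And>x v. norm (hessian f x *v v) \<le> \<Lambda> * norm v"
    using regular_density_uniform_bounds[OF f] by metis
  note lipg = grad_lipschitz[OF td \<Lambda>(2)]
  define H where "H = hessian f xs"
  obtain m0 where m0: "0 < m0" "\<And>v. v \<bullet> (H *v v) \<le> - m0 * (norm v)\<^sup>2"
    using mode_properties(2)[OF f mode] unfolding H_def by blast
  define \<delta>H where "\<delta>H = \<sigma> * m0 / (4 * R\<^sup>2)"
  have \<delta>H: "0 < \<delta>H" "R\<^sup>2 * \<delta>H = \<sigma> * m0 / 4" using \<sigma> m0(1) R by (simp_all add: \<delta>H_def)
  obtain r1 where r1: "0 < r1" "\<And>\<xi>. dist \<xi> xs < r1 \<Longrightarrow> dist (hessian f \<xi>) H < \<delta>H"
    using unif \<delta>H(1) unfolding uniformly_continuous_on_def H_def by (metis UNIV_I dist_commute)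
  have Hclose: "norm ((hessian f \<xi> - H) *v v) \<le> \<delta>H * norm v" if "dist \<xi> xs < r1" for \<xi> v
  proof -
    have "norm ((hessian f \<xi> - H) *v v) \<le> norm (hessian f \<xi> - H) * norm v" by (rule norm_matrix_vector_mult_le)
    also have "\<dots> \<le> \<delta>H * norm v" using r1(2)[OF that] by (intro mult_right_mono) (auto simp: dist_norm)
    finally show ?thesis .
  qed
  define L where "L = R\<^sup>2 * \<Lambda> / \<sigma> + m0 / 4"
  define m where "m = m0 / 2"
  have m: "0 < m" using m0 by (simp add: m_def)
  \<comment> \<open>for \<open>x\<close>, \<open>y\<close> in the ball of radius \<open>r \<le> r1 / 5\<close> and \<open>h R \<le> r\<close>, the points at which the Hessian is evaluated are within \<open>4 r < r1\<close> of the mode\<close>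
  have r15: "0 < r1 / 5" using r1 by simp
  show ?thesis
  proof (rule perturbed_ascent_reaches_mode[OF f mode basin m r15 \<epsilon>, where L = L])
    fix S \<rho> c r \<delta> \<eta>
    assume pos: "0 \<le> \<rho>" "0 < c" "0 < r" "r \<le> r1 / 5" "0 < \<delta>" "0 < \<eta>"
      and S\<rho>: "\<And>z. z \<in> S \<Longrightarrow> norm z \<le> \<rho>" and Sc: "\<And>z. z \<in> S \<Longrightarrow> c \<le> f z" and Sr: "cball xs r \<subseteq> S"
      and ascent: "\<And>g \<tau> y \<tau>lo. y 0 = x0 \<Longrightarrow> (\<And>j. y (Suc j) = y j + \<tau> (y j) *\<^sub>R g (y j)) \<Longrightarrow>
         (\<And>z. z \<in> S \<Longrightarrow> norm (g z - grad f z) \<le> \<delta>) \<Longrightarrow>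
         0 < \<tau>lo \<Longrightarrow> (\<And>z. z \<in> S \<Longrightarrow> \<tau>lo \<le> \<tau> z \<and> \<tau> z \<le> \<eta>) \<Longrightarrow>
         (\<And>x y. x \<in> cball xs r \<Longrightarrow> y \<in> cball xs r \<Longrightarrow> (g x - g y) \<bullet> (x - y) \<le> - m * (norm (x - y))\<^sup>2) \<Longrightarrow>
         (\<And>x y. x \<in> cball xs r \<Longrightarrow> y \<in> cball xs r \<Longrightarrow> norm (g x - g y) \<le> L * norm (x - y)) \<Longrightarrow>
         (\<forall>j. y j \<in> S) \<and> (\<exists>z. y \<longlonglongrightarrow> z \<and> dist z xs < \<epsilon>)"
    define \<theta> where "\<theta> = min (\<sigma> * \<delta> / (2 * d)) (min (c / 4) (\<sigma> * m0 / (4 * d\<^sup>2)))"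
    have \<theta>: "0 < \<theta>" "d * \<theta> \<le> \<sigma> * \<delta> / 2" "\<theta> \<le> c / 4" "d\<^sup>2 * \<theta> \<le> \<sigma> * m0 / 4"
    proof -
      show "0 < \<theta>" "\<theta> \<le> c / 4" using \<sigma> pos m0 d by (auto simp: \<theta>_def)
      have "d * \<theta> \<le> d * (\<sigma> * \<delta> / (2 * d))" using d by (intro mult_left_mono) (auto simp: \<theta>_def)
      then show "d * \<theta> \<le> \<sigma> * \<delta> / 2" using d by simp
      have "d\<^sup>2 * \<theta> \<le> d\<^sup>2 * (\<sigma> * m0 / (4 * d\<^sup>2))" by (intro mult_left_mono) (auto simp: \<theta>_def)
      then show "d\<^sup>2 * \<theta> \<le> \<sigma> * m0 / 4" using d by simp
    qed
    define h0 where "h0 = min 1 (min (r / R) (min (\<sigma> * \<delta> / (2 * (\<Lambda> * R ^ 3))) (min (c / (4 * (B * R))) (\<eta> * c / (2 * \<sigma>)))))"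
    have h0: "0 < h0" using pos R \<sigma> \<Lambda>(1) B(1) by (simp add: h0_def)
    show thesis
    proof (rule that[OF pos(1) \<theta>(1) h0])
      fix h n and X :: "nat \<Rightarrow> real^'d"
      assume h: "0 < h" "h < h0" and n: "0 < n"
        and dev: "\<And>\<phi> x. \<phi> \<in> kernel_functions K \<Longrightarrow> norm x \<le> \<rho> \<Longrightarrow> \<bar>empirical_deviation f \<phi> h n X x\<bar> \<le> \<theta> * h ^ (CARD('d) + 2)"
      note devK = dev[OF kernel_functions_mem(1)] and devM = dev[OF kernel_functions_mem(2)]
        and devD = dev[OF kernel_functions_mem(3)]
      have h1: "h \<le> 1" and hR: "h * R \<le> r" and h\<delta>: "\<Lambda> * R ^ 3 * h \<le> \<sigma> * \<delta> / 2" and hB: "B * R * h \<le> c / 4"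
        and h\<eta>: "h * \<sigma> \<le> \<eta> * c / 2"
      proof -
        have le: "h \<le> 1" "h \<le> r / R" "h \<le> \<sigma> * \<delta> / (2 * (\<Lambda> * R ^ 3))" "h \<le> c / (4 * (B * R))" "h \<le> \<eta> * c / (2 * \<sigma>)"
          using h(2) by (simp_all add: h0_def)
        show "h \<le> 1" by (rule le(1))
        show "h * R \<le> r" using le(2) R by (simp add: pos_le_divide_eq)
        have "0 < 2 * (\<Lambda> * R ^ 3)" using \<Lambda>(1) R by simp
        then have "h * (2 * (\<Lambda> * R ^ 3)) \<le> \<sigma> * \<delta>" using le(3) by (simp only: pos_le_divide_eq)
        then show "\<Lambda> * R ^ 3 * h \<le> \<sigma> * \<delta> / 2" by (simp add: mult_ac)
        have "0 < 4 * (B * R)" using B(1) R by simp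
        then have "h * (4 * (B * R)) \<le> c" using le(4) by (simp only: pos_le_divide_eq)
        then show "B * R * h \<le> c / 4" by (simp add: mult_ac)
        have "0 < 2 * \<sigma>" using \<sigma> by simp
        then have "h * (2 * \<sigma>) \<le> \<eta> * c" using le(5) by (simp only: pos_le_divide_eq)
        then show "h * \<sigma> \<le> \<eta> * c / 2" by (simp add: mult_ac)
      qed
      let ?p = "kde K h n X" and ?G = "kde_gradient K h n X" and ?Q = "smoothed_gradient K f h"
      have p_bounds: "c / 2 \<le> ?p z \<and> ?p z \<le> B + c" if z: "z \<in> S" for z
      proof -
        have "\<bar>?p z - smoothed_density K f h z\<bar> = \<bar>empirical_deviation f K h n X z\<bar> / h ^ CARD('d)"
          using h by (simp add: kde_deviation[OF fm Km(1) h(1)])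
        also have "\<dots> \<le> \<theta> * h ^ (CARD('d) + 2) / h ^ CARD('d)"
          using devK[OF S\<rho>[OF z]] h by (intro divide_right_mono) auto
        also have "\<dots> = \<theta> * h\<^sup>2" using h by (simp add: power_add power2_eq_square)
        also have "\<dots> \<le> \<theta>" using \<theta>(1) h h1 by (simp add: mult_left_le power_le_one)
        finally have "\<bar>?p z - smoothed_density K f h z\<bar> \<le> c / 4" using \<theta>(3) by linarith
        moreover have "\<bar>smoothed_density K f h z - f z\<bar> \<le> c / 4"
          using smoothed_density_bias[OF K CKK td B(3) h(1), of z] hB by linarith
        ultimately show ?thesis using Sc[OF z] B(2)[of z] pos(2) by linarith
      qed
      have G_bias: "norm (?G z - \<sigma> *\<^sub>R grad f z) \<le> \<sigma> * \<delta>" if z: "z \<in> S" for z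
      proof -
        have "norm (?G z - ?Q z) \<le> real CARD('d) * \<theta>"
        proof (rule norm_le_of_components)
          fix i
          have "\<bar>(?G z - ?Q z) $ i\<bar> = \<bar>empirical_deviation f (kernel_moment K i) h n X z\<bar> / h ^ (CARD('d) + 1)"
            using h by (simp only: kde_gradient_deviation[OF fm Km(2) h(1)] abs_divide) simp
          also have "\<dots> \<le> \<theta> * h ^ (CARD('d) + 2) / h ^ (CARD('d) + 1)"
            using devM[OF S\<rho>[OF z]] h by (intro divide_right_mono) auto
          also have "\<dots> = \<theta> * h" using h by simp
          also have "\<dots> \<le> \<theta>" using \<theta>(1) h1 by (simp add: mult_left_le)
          finally show "\<bar>(?G z - ?Q z) $ i\<bar> \<le> \<theta>" .
        qed
        moreover have "norm (?Q z - \<sigma> *\<^sub>R grad f z) \<le> \<Lambda> * R ^ 3 * h"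
          unfolding \<sigma>_def using \<Lambda>(1) by (intro smoothed_gradient_bias[OF K CKK td lipg _ h(1)]) simp
        ultimately show ?thesis
          using norm_triangle_ineq[of "?G z - ?Q z" "?Q z - \<sigma> *\<^sub>R grad f z"] \<theta>(2) h\<delta> unfolding d_def by simp
      qed
      have G_dev: "norm ((?G x - ?Q x) - (?G y - ?Q y)) \<le> \<sigma> * m0 / 4 * norm (x - y)"
        if xy: "norm x \<le> \<rho>" "norm y \<le> \<rho>" for x y
      proof -
        have "norm ((?G x - ?Q x) - (?G y - ?Q y)) \<le> real CARD('d) * (d * \<theta> * norm (x - y))"
        proof (rule norm_le_of_components)
          fix i
          have "((?G x - ?Q x) - (?G y - ?Q y)) $ i = (empirical_deviation f (kernel_moment K i) h n X x
              - empirical_deviation f (kernel_moment K i) h n X y) / h ^ (CARD('d) + 1)"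
            by (simp only: vector_minus_component[of "?G x - ?Q x"] kde_gradient_deviation[OF fm Km(2) h(1)] diff_divide_distrib)
          also have "\<bar>\<dots>\<bar> \<le> (real CARD('d) * \<theta> * h ^ (CARD('d) + 1) * norm (x - y)) / h ^ (CARD('d) + 1)"
          proof -
            have "0 < h ^ (CARD('d) + 1)" using h by simp
            then show ?thesis
              using moment_deviation_lipschitz[OF pd n h(1) CKm CKd taylor devD xy, of i]
              unfolding abs_divide by (simp only: abs_of_pos) (rule divide_right_mono; simp)
          qed
          also have "\<dots> = d * \<theta> * norm (x - y)" using h by (simp add: d_def)
          finally show "\<bar>((?G x - ?Q x) - (?G y - ?Q y)) $ i\<bar> \<le> d * \<theta> * norm (x - y)" .
        qed
        also have "\<dots> = d\<^sup>2 * \<theta> * norm (x - y)" by (simp add: d_def power2_eq_square)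
        also have "\<dots> \<le> \<sigma> * m0 / 4 * norm (x - y)" by (intro mult_right_mono \<theta>(4)) simp
        finally show ?thesis .
      qed
      have mono: "(?G x - ?G y) \<bullet> (x - y) \<le> - (\<sigma> * m) * (norm (x - y))\<^sup>2"
        and lip: "norm (?G x - ?G y) \<le> \<sigma> * L * norm (x - y)"
        if x: "x \<in> cball xs r" and y: "y \<in> cball xs r" for x y
      proof -
        have dev: "norm ((?G x - ?Q x) - (?G y - ?Q y)) \<le> \<sigma> * m0 / 4 * norm (x - y)"
          using x y Sr S\<rho> by (intro G_dev) blast+
        have "norm (x - y) \<le> 2 * r"
          using x y dist_triangle[of x y xs] by (simp add: dist_norm norm_minus_commute)
        have "norm (?Q x - ?Q y - \<sigma> *\<^sub>R (H *v (x - y))) \<le> R\<^sup>2 * \<delta>H * norm (x - y)"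
          unfolding \<sigma>_def
        proof (rule smoothed_gradient_increment[OF K CKK td h(1)])
          fix \<xi> assume "dist \<xi> y \<le> h * R + norm (x - y)"
          then have "dist \<xi> xs < r1"
            using \<open>norm (x - y) \<le> 2 * r\<close> hR y pos(3,4) dist_triangle[of \<xi> xs y] by (simp add: dist_commute)
          then show "norm ((hessian f \<xi> - H) *v (x - y)) \<le> \<delta>H * norm (x - y)" by (rule Hclose)
        qed
        then have QH: "norm (?Q x - ?Q y - \<sigma> *\<^sub>R (H *v (x - y))) \<le> \<sigma> * m0 / 4 * norm (x - y)" by (simp only: \<delta>H(2))
        have cs: "a \<bullet> (x - y) \<le> b * (norm (x - y))\<^sup>2" if "norm a \<le> b * norm (x - y)" for a b
          using norm_cauchy_schwarz[of a "x - y"] mult_right_mono[OF that norm_ge_zero[of "x - y"]]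
          by (simp add: power2_eq_square mult.assoc)
        have "(?G x - ?G y) \<bullet> (x - y) = ((?G x - ?Q x) - (?G y - ?Q y)) \<bullet> (x - y)
           + (?Q x - ?Q y - \<sigma> *\<^sub>R (H *v (x - y))) \<bullet> (x - y) + \<sigma> * ((x - y) \<bullet> (H *v (x - y)))"
          by (simp add: inner_diff_left inner_commute[of "H *v (x - y)" "x - y"])
        also have "\<dots> \<le> \<sigma> * m0 / 4 * (norm (x - y))\<^sup>2 + \<sigma> * m0 / 4 * (norm (x - y))\<^sup>2 + \<sigma> * (- m0 * (norm (x - y))\<^sup>2)"
          using \<sigma> by (intro add_mono cs dev QH mult_left_mono m0(2)) simp
        also have "\<dots> = - (\<sigma> * m) * (norm (x - y))\<^sup>2" by (simp add: m_def field_simps)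
        finally show "(?G x - ?G y) \<bullet> (x - y) \<le> - (\<sigma> * m) * (norm (x - y))\<^sup>2" .
        have "norm (?Q x - ?Q y - kernel_variance K *\<^sub>R (0 *v (x - y))) \<le> R\<^sup>2 * \<Lambda> * norm (x - y)"
          by (rule smoothed_gradient_increment[OF K CKK td h(1)]) (simp add: \<Lambda>(2))
        then have "norm (?Q x - ?Q y) \<le> R\<^sup>2 * \<Lambda> * norm (x - y)" by simp
        then have "norm (?G x - ?G y) \<le> \<sigma> * m0 / 4 * norm (x - y) + R\<^sup>2 * \<Lambda> * norm (x - y)"
          using norm_triangle_ineq[of "(?G x - ?Q x) - (?G y - ?Q y)" "?Q x - ?Q y"] dev by simp
        also have "\<dots> = \<sigma> * L * norm (x - y)" using \<sigma> by (simp add: L_def field_simps)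
        finally show "norm (?G x - ?G y) \<le> \<sigma> * L * norm (x - y)" .
      qed
      \<comment> \<open>if the weights at \<open>z\<close> sum to zero, the iteration jumps to the origin; the default values make it an ascent step there, too, and it turns out not to visit such points\<close>
      define g where "g z = (if ?p z = 0 then - z else ?G z /\<^sub>R \<sigma>)" for z
      define \<tau> where "\<tau> z = (if ?p z = 0 then 1 else h\<^sup>2 * \<sigma> / ?p z)" for z
      have p0: "?p z \<noteq> 0" if "z \<in> S" for z using p_bounds[OF that] pos(2) by auto
      have gS: "g z = ?G z /\<^sub>R \<sigma>" "\<tau> z = h\<^sup>2 * \<sigma> / ?p z" if "z \<in> S" for z
        using p0[OF that] by (simp_all add: g_def \<tau>_def)
      have weight: "kernel_weight_sum K h n X z = 0 \<longleftrightarrow> ?p z = 0" for z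
        using h n by (simp add: kernel_weight_sum_def kde_def)
      have "(\<forall>j. mean_shift K h n X x0 j \<in> S) \<and> (\<exists>z. mean_shift K h n X x0 \<longlonglongrightarrow> z \<and> dist z xs < \<epsilon>)"
      proof (rule ascent[of _ \<tau> g "h\<^sup>2 * \<sigma> / (B + c)"])
        fix j
        let ?y = "mean_shift K h n X x0 j"
        show "mean_shift K h n X x0 (Suc j) = ?y + \<tau> ?y *\<^sub>R g ?y"
        proof (cases "?p ?y = 0")
          case True
          then show ?thesis by (simp add: Let_def weight g_def \<tau>_def)
        next
          case False
          then have "kernel_weight_sum K h n X ?y \<noteq> 0" by (simp add: weight)
          from mean_shift_step[OF h(1) n this] show ?thesis
            using False \<sigma> by (simp add: Let_def g_def \<tau>_def divide_inverse)
        qed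
      next
        fix z assume z: "z \<in> S"
        have "g z - grad f z = (?G z - \<sigma> *\<^sub>R grad f z) /\<^sub>R \<sigma>" using \<sigma> gS[OF z] by (simp add: algebra_simps)
        then have "norm (g z - grad f z) = norm (?G z - \<sigma> *\<^sub>R grad f z) / \<sigma>"
          using \<sigma> by (simp only: norm_scaleR) (simp add: divide_inverse mult.commute)
        then show "norm (g z - grad f z) \<le> \<delta>" using G_bias[OF z] \<sigma> by (simp add: pos_divide_le_eq mult.commute)
        note p = p_bounds[OF z]
        have "h\<^sup>2 * \<sigma> / (B + c) \<le> \<tau> z"
          unfolding gS(2)[OF z] using p pos(2) \<sigma> by (intro divide_left_mono mult_pos_pos) (auto simp: less_imp_le)
        moreover have "\<tau> z \<le> \<eta>"
        proof -
          have "\<tau> z \<le> h\<^sup>2 * \<sigma> / (c / 2)"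
            unfolding gS(2)[OF z] using p pos(2) \<sigma> by (intro divide_left_mono mult_pos_pos) (auto simp: less_imp_le)
          also have "\<dots> \<le> (\<eta> * c / 2) / (c / 2)"
          proof (rule divide_right_mono)
            have "h * (h * \<sigma>) \<le> 1 * (h * \<sigma>)" using h1 h(1) \<sigma> by (intro mult_right_mono) auto
            then show "h\<^sup>2 * \<sigma> \<le> \<eta> * c / 2" using h\<eta> by (simp add: power2_eq_square)
          qed (use pos in simp)
          also have "\<dots> = \<eta>" using pos(2) by simp
          finally show ?thesis .
        qed
        ultimately show "h\<^sup>2 * \<sigma> / (B + c) \<le> \<tau> z \<and> \<tau> z \<le> \<eta>" by simp
      next
        fix x y assume x: "x \<in> cball xs r" and y: "y \<in> cball xs r"
        have g: "g x - g y = (?G x - ?G y) /\<^sub>R \<sigma>" using x y Sr gS(1) by (simp add: subset_iff scaleR_diff_right)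
        show "(g x - g y) \<bullet> (x - y) \<le> - m * (norm (x - y))\<^sup>2"
        proof -
          have "(g x - g y) \<bullet> (x - y) = ((?G x - ?G y) \<bullet> (x - y)) / \<sigma>"
            unfolding g inner_scaleR_left by (simp only: divide_inverse mult.commute)
          also have "\<dots> \<le> - m * (norm (x - y))\<^sup>2"
            using mono[OF x y] \<sigma> by (simp add: pos_divide_le_eq mult_ac)
          finally show ?thesis .
        qed
        show "norm (g x - g y) \<le> L * norm (x - y)"
        proof -
          have "norm (g x - g y) = norm (?G x - ?G y) / \<sigma>"
            unfolding g using \<sigma> by (simp only: norm_scaleR) (simp add: divide_inverse mult.commute)
          also have "\<dots> \<le> L * norm (x - y)"
            using lip[OF x y] \<sigma> by (simp add: pos_divide_le_eq mult_ac)
          finally show ?thesis .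
        qed
      next
        show "0 < h\<^sup>2 * \<sigma> / (B + c)" using h \<sigma> B(1) pos(2) by simp
      qed simp
      then show "mean_shift_converges_near K h n X x0 xs \<epsilon>"
        unfolding mean_shift_converges_near_def mean_shift_defined_def weight using p0 by blast
    qed
  qed
qed

theorem theorem4p2:
  fixes f :: "real^'d \<Rightarrow> real"
    and K L :: "real^'d \<Rightarrow> real"
    and k :: "real \<Rightarrow> real" and c :: real
    and M :: "'w measure" and X :: "nat \<Rightarrow> 'w \<Rightarrow> real^'d"
    and h :: "nat \<Rightarrow> real"
    and xs x0 :: "real^'d"
  assumes density: "regular_density f"
    and kernel: "is_kernel K k"
    and shadow: "is_shadow_kernel k c L"
    and prob_space: "prob_space M"
    and indep: "prob_space.indep_vars M (\<lambda>_. borel) X {1..}"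
    and law: "\<And>j. j \<ge> 1 \<Longrightarrow> distributed M lborel (X j) (\<lambda>x. ennreal (f x))"
    and h_pos: "\<And>n. h n > 0"
    and h_lim: "h \<longlonglongrightarrow> 0"
    and h_rate: "(\<lambda>n. ln (real n) / (real n * h n ^ (CARD('d) + 4))) \<longlonglongrightarrow> 0"
    and mode: "is_mode f xs"
    and basin: "x0 \<in> basin_of_attraction f xs"
  shows "\<forall>\<epsilon>>0. (\<lambda>n. measure M {\<omega> \<in> space M.
           mean_shift_converges_near K (h n) n (\<lambda>j. X j \<omega>) x0 xs \<epsilon>}) \<longlonglongrightarrow> 1"
proof (intro allI impI)
  interpret prob_space M by (rule prob_space)
  fix \<epsilon> :: real assume \<epsilon>: "0 < \<epsilon>"
  have pd: "probability_density f" using density unfolding regular_density_def by simp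
  obtain B :: real where B: "\<And>x. f x \<le> B" using regular_density_uniform_bounds[OF density] by metis
  let ?E = "\<lambda>n. {\<omega> \<in> space M. mean_shift_converges_near K (h n) n (\<lambda>j. X j \<omega>) x0 xs \<epsilon>}"
  have Xm: "X j \<in> M \<rightarrow>\<^sub>M borel" if "1 \<le> j" for j
    using distributed_measurable[OF law[OF that]] by simp
  show "(\<lambda>n. prob (?E n)) \<longlonglongrightarrow> 1"
  proof (rule kernel_moment_regularity[OF kernel])
    fix R C
    assume CK: "\<And>\<phi>. \<phi> \<in> kernel_functions K \<Longrightarrow> compact_lipschitz R C \<phi>"
      and taylor: "\<And>i w v. \<bar>kernel_moment K i (w + v) - kernel_moment K i w
               - (\<Sum>j\<in>UNIV. v $ j * kernel_moment_deriv K i j w)\<bar> \<le> C * (norm v)\<^sup>2"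
    have E: "?E n \<in> events" for n
      by (rule mean_shift_converges_near_measurable[OF compact_lipschitz_measurable[OF CK[OF kernel_functions_mem(1)]] Xm])
    show "(\<lambda>n. prob (?E n)) \<longlonglongrightarrow> 1"
    proof (rule mean_shift_converges_on_good_samples[OF density kernel mode basin \<epsilon> CK taylor])
      fix \<rho> \<theta> h0 :: real
      assume pos: "0 \<le> \<rho>" "0 < \<theta>" "0 < h0"
        and converges: "\<And>h n X. 0 < h \<Longrightarrow> h < h0 \<Longrightarrow> 0 < n \<Longrightarrow>
         (\<And>\<phi> x. \<phi> \<in> kernel_functions K \<Longrightarrow> norm x \<le> \<rho> \<Longrightarrow> \<bar>empirical_deviation f \<phi> h n X x\<bar> \<le> \<theta> * h ^ (CARD('d) + 2)) \<Longrightarrow>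
         mean_shift_converges_near K h n X x0 xs \<epsilon>"
      have "\<exists>G. (\<forall>n. G n \<in> events) \<and> (\<lambda>n. prob (G n)) \<longlonglongrightarrow> 1 \<and>
        (\<forall>n \<omega> x. 0 < n \<longrightarrow> \<omega> \<in> G n \<longrightarrow> norm x \<le> \<rho> \<longrightarrow>
          \<bar>empirical_deviation f \<phi> (h n) n (\<lambda>j. X j \<omega>) x\<bar> \<le> \<theta> * h n ^ (CARD('d) + 2))"
        if "\<phi> \<in> kernel_functions K" for \<phi>
        by (rule empirical_deviation_uniform[OF pd B CK[OF that] indep law h_pos h_lim h_rate pos(2,1)])
      then obtain G where G: "\<And>\<phi> n. \<phi> \<in> kernel_functions K \<Longrightarrow> G \<phi> n \<in> events"
        "\<And>\<phi>. \<phi> \<in> kernel_functions K \<Longrightarrow> (\<lambda>n. prob (G \<phi> n)) \<longlonglongrightarrow> 1"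
        "\<And>\<phi> n \<omega> x. \<phi> \<in> kernel_functions K \<Longrightarrow> 0 < n \<Longrightarrow> \<omega> \<in> G \<phi> n \<Longrightarrow> norm x \<le> \<rho> \<Longrightarrow>
          \<bar>empirical_deviation f \<phi> (h n) n (\<lambda>j. X j \<omega>) x\<bar> \<le> \<theta> * h n ^ (CARD('d) + 2)"
        by metis
      define good where "good n = space M - (\<Union>\<phi>\<in>kernel_functions K. space M - G \<phi> n)" for n
      have "finite (kernel_functions K)" by (simp add: kernel_functions_def)
      then have "(\<lambda>n. prob (good n)) \<longlonglongrightarrow> 1"
        unfolding good_def by (rule prob_Inter_finite_tendsto_1[OF _ G(1,2)])
      moreover have "\<forall>\<^sub>F n in sequentially. prob (good n) \<le> prob (?E n)"
        using order_tendstoD(2)[OF h_lim pos(3)] eventually_gt_at_top[of 0]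
      proof eventually_elim
        case (elim n)
        have "good n \<subseteq> ?E n"
        proof
          fix \<omega> assume \<omega>: "\<omega> \<in> good n"
          then have "\<omega> \<in> G \<phi> n" if "\<phi> \<in> kernel_functions K" for \<phi> using that by (auto simp: good_def)
          then have "mean_shift_converges_near K (h n) n (\<lambda>j. X j \<omega>) x0 xs \<epsilon>"
            using G(3) elim(2) by (intro converges[OF h_pos elim]) blast
          then show "\<omega> \<in> ?E n" using \<omega> by (simp add: good_def)
        qed
        then show ?case by (rule finite_measure_mono[OF _ E])
      qed
      moreover have "\<forall>\<^sub>F n in sequentially. prob (?E n) \<le> 1" by (simp add: always_eventually)
      ultimately show "(\<lambda>n. prob (?E n)) \<longlonglongrightarrow> 1"
        by (rule_tac tendsto_sandwich[where f = "\<lambda>n. prob (good n)" and h = "\<lambda>_. 1"]) simp_all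
    qed
  qed
qed

end
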